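(* Let $\delta\ge 3$ be an odd integer and let $K^{(\delta)}$ be a $\delta$-PHO Hamiltonian. Then there exists a $(2\delta-2)$-PHO Hamiltonian $K^{(2\delta-2)}$ whose BGNF up to degree $2\delta-2$ coincides with the BGNF up to degree $2\delta-2$ of $K^{(\delta)}$ if and only if $K^{(\delta)}$ is separable within a rotation of Cartesian coordinates. Moreover, if $K^{(\delta)}$ is separable within the rotation $\sigma(\psi)$, then the $(2\delta-2)$-PHO $K^{(2\delta-2)}$ sharing its BGNF is separable within the same rotation $\sigma(\psi)$, i.e. its potential satisfies $V^{(2\delta-2)}(\sigma(\psi)^{-1}\tilde q)=\tilde w_0\tilde q_2^{2\delta-2}+\tilde w_{2\delta-2}\tilde q_1^{2\delta-2}$ for some constants $\tilde w_0,\tilde w_{2\delta-2}$.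
   Context: For an integer $d\ge3$, a $d$-PHO (perturbed 2-dimensional isotropic harmonic oscillator with homogeneous polynomial potential of degree $d$) is the Hamiltonian on $\mathbb R^4\ni(q,p)=(q_1,q_2,p_1,p_2)$ $$K^{(d)}(q,p)=\tfrac12\sum_{j=1}^2(p_j^2+q_j^2)+V^{(d)}(q),\qquad V^{(d)}(q)=\sum_{h=0}^{d}v^{(d)}_h\binom{d}{h}q_1^hq_2^{d-h},$$ with real coefficients $v^{(d)}_h$ and $V^{(d)}$ not identically zero. For $\psi\in[0,2\pi)$ let $\sigma(\psi)=\begin{pmatrix}\cos\psi&-\sin\psi\\ \sin\psi&\cos\psi\end{pmatrix}$. The $d$-PHO is separable within a rotation of Cartesian coordinates if there exist $\psi\in[0,2\pi)$ and reals $(\tilde v_0,\tilde v_d)\ne(0,0)$ with $V^{(d)}(\sigma(\psi)^{-1}\tilde q)=\tilde v_0\tilde q_2^{d}+\tilde v_d\tilde q_1^{d}$ for all $\tilde q\in\mathbb R^2$. BG normal form. For $x,y\in\mathbb R^2$ let $D_{x,y}=\sum_{j=1}^2\big(x_j\partial/\partial y_j-y_j\partial/\partial x_j\big)$ and let $D^{(k)}_{x,y}$ be its restriction to the real vector space of homogeneous polynomials of degree $k$ in $(x,y)$. Given a $d$-PHO Hamiltonian $K$ and an integer $\rho\ge3$, its BGNF (Birkhoff–Gustavson normal form) up to degree $\rho$ is the polynomial $G(\xi,\eta)=\tfrac12\sum_j(\eta_j^2+\xi_j^2)+\sum_{k=3}^{\rho}G_k(\xi,\eta)$, each $G_k$ homogeneous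 of degree $k$ with $G_k\in\ker D^{(k)}_{\xi,\eta}$, for which there is a generating function $W(q,\eta)=\sum_j q_j\eta_j+\sum_{k=3}^{\rho}W_k(q,\eta)$, each $W_k$ homogeneous of degree $k$ with $W_k\in\operatorname{image}D^{(k)}_{q,\eta}$, such that the power series in $(q,\eta)$ of $K(q,\partial W/\partial q)-G(\partial W/\partial\eta,\eta)$ has no terms of degree $\le\rho$; these conditions determine $G$ uniquely. Two Hamiltonians share their BGNF up to degree $\rho$ if their BGNFs up to degree $\rho$ coincide. *)

theory Defs
  imports "HOL-Analysis.Analysis"
begin

text \<open>Real-valued functions of four real variables, curried.  For a Hamiltonian
  the argument order is (q1,q2,p1,p2); for the operator D_{x,y} it is (x1,x2,y1,y2).\<close>
type_synonym fun4 = "real \<Rightarrow> real \<Rightarrow> real \<Rightarrow> real \<Rightarrow> real"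

definition hom_poly :: "nat \<Rightarrow> fun4 \<Rightarrow> bool" where
  "hom_poly k F \<longleftrightarrow> (\<exists>c :: nat \<Rightarrow> nat \<Rightarrow> nat \<Rightarrow> nat \<Rightarrow> real.
     F = (\<lambda>x1 x2 y1 y2. \<Sum>(a,b,e,f)\<in>{(a,b,e,f). a + b + e + f = k}.
                          c a b e f * x1 ^ a * x2 ^ b * y1 ^ e * y2 ^ f))"

definition no_terms_upto :: "nat \<Rightarrow> fun4 \<Rightarrow> bool" where
  "no_terms_upto \<rho> F \<longleftrightarrow> (\<exists>(N::nat) (c :: nat \<Rightarrow> nat \<Rightarrow> nat \<Rightarrow> nat \<Rightarrow> real).
     F = (\<lambda>x1 x2 y1 y2. \<Sum>(a,b,e,f)\<in>{(a,b,e,f). a + b + e + f \<le> N}.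
                          c a b e f * x1 ^ a * x2 ^ b * y1 ^ e * y2 ^ f)
     \<and> (\<forall>a b e f. a + b + e + f \<le> \<rho> \<longrightarrow> c a b e f = 0))"

definition Dop :: "fun4 \<Rightarrow> fun4" where
  "Dop F = (\<lambda>x1 x2 y1 y2.
      x1 * deriv (\<lambda>t. F x1 x2 t y2) y1 + x2 * deriv (\<lambda>t. F x1 x2 y1 t) y2
    - y1 * deriv (\<lambda>t. F t x2 y1 y2) x1 - y2 * deriv (\<lambda>t. F x1 t y1 y2) x2)"

definition in_ker_D :: "nat \<Rightarrow> fun4 \<Rightarrow> bool" where
  "in_ker_D k F \<longleftrightarrow> hom_poly k F \<and> Dop F = (\<lambda>_ _ _ _. 0)"

definition in_image_D :: "nat \<Rightarrow> fun4 \<Rightarrow> bool" where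
  "in_image_D k F \<longleftrightarrow> (\<exists>U. hom_poly k U \<and> F = Dop U)"

definition is_BGNF :: "fun4 \<Rightarrow> nat \<Rightarrow> fun4 \<Rightarrow> bool" where
  "is_BGNF K \<rho> G \<longleftrightarrow> (\<exists>(Gk :: nat \<Rightarrow> fun4) (Wk :: nat \<Rightarrow> fun4).
     (\<forall>k\<in>{3..\<rho>}. in_ker_D k (Gk k) \<and> in_image_D k (Wk k))
     \<and> G = (\<lambda>\<xi>1 \<xi>2 \<eta>1 \<eta>2. (\<eta>1\<^sup>2 + \<xi>1\<^sup>2 + \<eta>2\<^sup>2 + \<xi>2\<^sup>2) / 2
                            + (\<Sum>k=3..\<rho>. Gk k \<xi>1 \<xi>2 \<eta>1 \<eta>2))
     \<and> (let W = (\<lambda>q1 q2 \<eta>1 \<eta>2. q1 * \<eta>1 + q2 * \<eta>2 + (\<Sum>k=3..\<rho>. Wk k q1 q2 \<eta>1 \<eta>2))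
        in no_terms_upto \<rho> (\<lambda>q1 q2 \<eta>1 \<eta>2.
              K q1 q2 (deriv (\<lambda>t. W t q2 \<eta>1 \<eta>2) q1) (deriv (\<lambda>t. W q1 t \<eta>1 \<eta>2) q2)
            - G (deriv (\<lambda>t. W q1 q2 t \<eta>2) \<eta>1) (deriv (\<lambda>t. W q1 q2 \<eta>1 t) \<eta>2) \<eta>1 \<eta>2)))"

text \<open>Two Hamiltonians share their BGNF up to degree \<rho> (the BGNF is unique).\<close>
definition share_BGNF :: "fun4 \<Rightarrow> fun4 \<Rightarrow> nat \<Rightarrow> bool" where
  "share_BGNF K1 K2 \<rho> \<longleftrightarrow> (\<exists>G. is_BGNF K1 \<rho> G \<and> is_BGNF K2 \<rho> G)"

definition pot :: "nat \<Rightarrow> (nat \<Rightarrow> real) \<Rightarrow> real \<Rightarrow> real \<Rightarrow> real" where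
  "pot d v q1 q2 = (\<Sum>h=0..d. v h * real (d choose h) * q1 ^ h * q2 ^ (d - h))"

definition PHO :: "nat \<Rightarrow> (nat \<Rightarrow> real) \<Rightarrow> fun4" where
  "PHO d v = (\<lambda>q1 q2 p1 p2. (p1\<^sup>2 + q1\<^sup>2 + p2\<^sup>2 + q2\<^sup>2) / 2 + pot d v q1 q2)"

definition is_PHO :: "nat \<Rightarrow> (nat \<Rightarrow> real) \<Rightarrow> bool" where
  "is_PHO d v \<longleftrightarrow> 3 \<le> d \<and> (\<exists>q1 q2. pot d v q1 q2 \<noteq> 0)"

text \<open>Separable within the rotation sigma(psi):
  V(sigma(psi)^{-1} q~) = v0~ q2~^d + vd~ q1~^d, where
  sigma(psi)^{-1} (x,y) = (cos psi x + sin psi y, - sin psi x + cos psi y).\<close>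
definition separable_within :: "nat \<Rightarrow> (nat \<Rightarrow> real) \<Rightarrow> real \<Rightarrow> bool" where
  "separable_within d v \<psi> \<longleftrightarrow> (\<exists>v0 vd. (v0, vd) \<noteq> (0, 0) \<and>
     (\<forall>x y. pot d v (cos \<psi> * x + sin \<psi> * y) (- sin \<psi> * x + cos \<psi> * y)
             = v0 * y ^ d + vd * x ^ d))"

definition separable :: "nat \<Rightarrow> (nat \<Rightarrow> real) \<Rightarrow> bool" where
  "separable d v \<longleftrightarrow> (\<exists>\<psi>. 0 \<le> \<psi> \<and> \<psi> < 2 * pi \<and> separable_within d v \<psi>)"

end

theory Submission
  imports Defs "HOL-Computational_Algebra.Polynomial"
begin

text \<open>Order by order, the BG equations for a PHO with odd degree d = n + 1 reduce to D W = V at degree d,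
  and at degree 2 n to splitting the bracket Q = (|W_q|^2 - |W_eta|^2) / 2 into kernel and image of D.
  Hence a PHO with potential V' of degree 2 n has the same BGNF iff Q - V' has mean zero along every orbit
  of the flow of D.

  Writing V as a sum of powers a_i (l_i q_1 + m_i q_2)^d makes W, and modulo the image of D also Q, an explicit
  sum built from a one-dimensional solution B of (D^2 + 1) B = X^n.  On the straight orbits (eta = 0) the mean
  condition forces V' to be a fixed negative multiple of |grad V|^2, and at second order in eta it
  forces a sum over pairs i, k to vanish which is the Wronskian of V_11 - V_22 and V_12.  So these two forms
  are proportional, and a rotation makes the mixed derivative of V vanish.  Both constants involved are
  nonzero because B is positive on the unit circle.\<close>

subsection \<open>Polynomial functions of four variables\<close>

text \<open>Oddness of d enters through the flow of D at time pi, which is minus the identity: D has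
  no kernel in odd degree, so W is the only solution of D W = V and no normal form term appears
  below degree 2 d - 2. Comparing coefficients through a substitution such as G(W_eta, eta) is
  awkward, so \<open>hom_poly\<close> and \<open>no_terms_upto\<close> are first turned into scaling
  and limit conditions. Sums of powers are used because a linear form carries the flow of D to the
  rotation of a plane; all averages then concern pairs of rotating points (X, Y), (X', Y'). Straight
  orbits determine V' but put no condition on V. Once V' is eliminated, the second-order term of
  each pair is a multiple of (X X')^(2h-2) (X Y' - X' Y)^2. Weighted by the inner product l_i l_k +
  m_i m_k, it turns into a Wronskian because inner product times determinant of two plane vectors is
  (l_i^2 - m_i^2) l_k m_k - (l_k^2 - m_k^2) l_i m_i. Conversely, a separable V uses two orthonormal
  forms: cross terms drop out, and each diagonal average has the shape of the average of a single
  power.\<close>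

inductive polyfun4 :: "fun4 \<Rightarrow> bool" where
  polyfun4_const: "polyfun4 (\<lambda>_ _ _ _. c)"
| polyfun4_x1: "polyfun4 (\<lambda>x1 x2 y1 y2. x1)"
| polyfun4_x2: "polyfun4 (\<lambda>x1 x2 y1 y2. x2)"
| polyfun4_y1: "polyfun4 (\<lambda>x1 x2 y1 y2. y1)"
| polyfun4_y2: "polyfun4 (\<lambda>x1 x2 y1 y2. y2)"
| polyfun4_add: "polyfun4 F \<Longrightarrow> polyfun4 G \<Longrightarrow> polyfun4 (\<lambda>x1 x2 y1 y2. F x1 x2 y1 y2 + G x1 x2 y1 y2)"
| polyfun4_mult: "polyfun4 F \<Longrightarrow> polyfun4 G \<Longrightarrow> polyfun4 (\<lambda>x1 x2 y1 y2. F x1 x2 y1 y2 * G x1 x2 y1 y2)"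

lemma polyfun4_power:
  "polyfun4 F \<Longrightarrow> polyfun4 (\<lambda>x1 x2 y1 y2. F x1 x2 y1 y2 ^ n)"
  by (induction n) (auto intro: polyfun4.intros)

lemma polyfun4_sum:
  "(\<And>i. i \<in> S \<Longrightarrow> polyfun4 (F i)) \<Longrightarrow> polyfun4 (\<lambda>x1 x2 y1 y2. \<Sum>i\<in>S. F i x1 x2 y1 y2)"
  by (induction S rule: infinite_finite_induct) (auto intro: polyfun4.intros)

lemma polyfun4_uminus: "polyfun4 F \<Longrightarrow> polyfun4 (\<lambda>x1 x2 y1 y2. - F x1 x2 y1 y2)"
  using polyfun4_mult[OF polyfun4_const[of "-1"], of F] by simp

lemma polyfun4_diff:
  "polyfun4 F \<Longrightarrow> polyfun4 G \<Longrightarrow> polyfun4 (\<lambda>x1 x2 y1 y2. F x1 x2 y1 y2 - G x1 x2 y1 y2)"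
  using polyfun4_add[OF _ polyfun4_uminus, of F G] by simp

lemma polyfun4_divide: "polyfun4 F \<Longrightarrow> polyfun4 (\<lambda>x1 x2 y1 y2. F x1 x2 y1 y2 / c)"
  using polyfun4_mult[OF _ polyfun4_const[of "1/c"], of F] by simp

lemma polyfun4_compose:
  assumes "polyfun4 F" "polyfun4 A" "polyfun4 B" "polyfun4 C" "polyfun4 E"
  shows "polyfun4 (\<lambda>x1 x2 y1 y2. F (A x1 x2 y1 y2) (B x1 x2 y1 y2) (C x1 x2 y1 y2) (E x1 x2 y1 y2))"
  using assms(1) by induction (auto intro: polyfun4.intros assms(2-5))

lemmas polyfun4_intros =
  polyfun4.intros polyfun4_power polyfun4_sum polyfun4_uminus polyfun4_diff polyfun4_divide

definition pd1 :: "fun4 \<Rightarrow> fun4" where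
  "pd1 F = (\<lambda>x1 x2 y1 y2. deriv (\<lambda>t. F t x2 y1 y2) x1)"
definition pd2 :: "fun4 \<Rightarrow> fun4" where
  "pd2 F = (\<lambda>x1 x2 y1 y2. deriv (\<lambda>t. F x1 t y1 y2) x2)"
definition pd3 :: "fun4 \<Rightarrow> fun4" where
  "pd3 F = (\<lambda>x1 x2 y1 y2. deriv (\<lambda>t. F x1 x2 t y2) y1)"
definition pd4 :: "fun4 \<Rightarrow> fun4" where
  "pd4 F = (\<lambda>x1 x2 y1 y2. deriv (\<lambda>t. F x1 x2 y1 t) y2)"

text \<open>The gradient is stated as a chain rule along arbitrary curves, so that partial derivatives and
  derivatives along the flow of D are both instances of it.\<close>

definition grad4 :: "fun4 \<Rightarrow> fun4 \<Rightarrow> fun4 \<Rightarrow> fun4 \<Rightarrow> fun4 \<Rightarrow> bool" where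
  "grad4 F F1 F2 F3 F4 \<longleftrightarrow>
     (\<forall>u1 u2 u3 u4 d1 d2 d3 d4 t.
        (u1 has_real_derivative d1) (at t) \<longrightarrow> (u2 has_real_derivative d2) (at t) \<longrightarrow>
        (u3 has_real_derivative d3) (at t) \<longrightarrow> (u4 has_real_derivative d4) (at t) \<longrightarrow>
        ((\<lambda>t. F (u1 t) (u2 t) (u3 t) (u4 t)) has_real_derivative
           F1 (u1 t) (u2 t) (u3 t) (u4 t) * d1 + F2 (u1 t) (u2 t) (u3 t) (u4 t) * d2
         + F3 (u1 t) (u2 t) (u3 t) (u4 t) * d3 + F4 (u1 t) (u2 t) (u3 t) (u4 t) * d4) (at t))"

lemma grad4D:
  assumes "grad4 F F1 F2 F3 F4"
    and "(u1 has_real_derivative d1) (at t)" "(u2 has_real_derivative d2) (at t)"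
    and "(u3 has_real_derivative d3) (at t)" "(u4 has_real_derivative d4) (at t)"
  shows "((\<lambda>t. F (u1 t) (u2 t) (u3 t) (u4 t)) has_real_derivative
           F1 (u1 t) (u2 t) (u3 t) (u4 t) * d1 + F2 (u1 t) (u2 t) (u3 t) (u4 t) * d2
         + F3 (u1 t) (u2 t) (u3 t) (u4 t) * d3 + F4 (u1 t) (u2 t) (u3 t) (u4 t) * d4) (at t)"
  using assms unfolding grad4_def by blast

lemma grad4_add:
  assumes "grad4 F F1 F2 F3 F4" "grad4 G G1 G2 G3 G4"
  shows "grad4 (\<lambda>x1 x2 y1 y2. F x1 x2 y1 y2 + G x1 x2 y1 y2)
     (\<lambda>x1 x2 y1 y2. F1 x1 x2 y1 y2 + G1 x1 x2 y1 y2) (\<lambda>x1 x2 y1 y2. F2 x1 x2 y1 y2 + G2 x1 x2 y1 y2)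
     (\<lambda>x1 x2 y1 y2. F3 x1 x2 y1 y2 + G3 x1 x2 y1 y2) (\<lambda>x1 x2 y1 y2. F4 x1 x2 y1 y2 + G4 x1 x2 y1 y2)"
  unfolding grad4_def
  by (intro allI impI, rule DERIV_cong, rule DERIV_add, rule grad4D[OF assms(1)], assumption+,
      rule grad4D[OF assms(2)], assumption+) (simp add: algebra_simps)

lemma grad4_mult:
  assumes "grad4 F F1 F2 F3 F4" "grad4 G G1 G2 G3 G4"
  shows "grad4 (\<lambda>x1 x2 y1 y2. F x1 x2 y1 y2 * G x1 x2 y1 y2)
     (\<lambda>x1 x2 y1 y2. F1 x1 x2 y1 y2 * G x1 x2 y1 y2 + F x1 x2 y1 y2 * G1 x1 x2 y1 y2)
     (\<lambda>x1 x2 y1 y2. F2 x1 x2 y1 y2 * G x1 x2 y1 y2 + F x1 x2 y1 y2 * G2 x1 x2 y1 y2)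
     (\<lambda>x1 x2 y1 y2. F3 x1 x2 y1 y2 * G x1 x2 y1 y2 + F x1 x2 y1 y2 * G3 x1 x2 y1 y2)
     (\<lambda>x1 x2 y1 y2. F4 x1 x2 y1 y2 * G x1 x2 y1 y2 + F x1 x2 y1 y2 * G4 x1 x2 y1 y2)"
  unfolding grad4_def
  by (intro allI impI, rule DERIV_cong, rule DERIV_mult, rule grad4D[OF assms(1)], assumption+,
      rule grad4D[OF assms(2)], assumption+) (simp add: algebra_simps)

lemma polyfun4_grad4_ex:
  "polyfun4 F \<Longrightarrow> \<exists>F1 F2 F3 F4. polyfun4 F1 \<and> polyfun4 F2 \<and> polyfun4 F3 \<and> polyfun4 F4 \<and> grad4 F F1 F2 F3 F4"
proof (induction rule: polyfun4.induct)
  case (polyfun4_const c)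
  have "grad4 (\<lambda>_ _ _ _. c) (\<lambda>_ _ _ _. 0) (\<lambda>_ _ _ _. 0) (\<lambda>_ _ _ _. 0) (\<lambda>_ _ _ _. 0)"
    by (auto simp: grad4_def)
  then show ?case using polyfun4.polyfun4_const by blast
next
  case polyfun4_x1
  have "grad4 (\<lambda>x1 x2 y1 y2. x1) (\<lambda>_ _ _ _. 1) (\<lambda>_ _ _ _. 0) (\<lambda>_ _ _ _. 0) (\<lambda>_ _ _ _. 0)"
    by (auto simp: grad4_def)
  then show ?case using polyfun4.polyfun4_const by blast
next
  case polyfun4_x2
  have "grad4 (\<lambda>x1 x2 y1 y2. x2) (\<lambda>_ _ _ _. 0) (\<lambda>_ _ _ _. 1) (\<lambda>_ _ _ _. 0) (\<lambda>_ _ _ _. 0)"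
    by (auto simp: grad4_def)
  then show ?case using polyfun4.polyfun4_const by blast
next
  case polyfun4_y1
  have "grad4 (\<lambda>x1 x2 y1 y2. y1) (\<lambda>_ _ _ _. 0) (\<lambda>_ _ _ _. 0) (\<lambda>_ _ _ _. 1) (\<lambda>_ _ _ _. 0)"
    by (auto simp: grad4_def)
  then show ?case using polyfun4.polyfun4_const by blast
next
  case polyfun4_y2
  have "grad4 (\<lambda>x1 x2 y1 y2. y2) (\<lambda>_ _ _ _. 0) (\<lambda>_ _ _ _. 0) (\<lambda>_ _ _ _. 0) (\<lambda>_ _ _ _. 1)"
    by (auto simp: grad4_def)
  then show ?case using polyfun4.polyfun4_const by blast
next
  case (polyfun4_add F G)
  then obtain F1 F2 F3 F4 G1 G2 G3 G4 where
    "polyfun4 F1" "polyfun4 F2" "polyfun4 F3" "polyfun4 F4" "grad4 F F1 F2 F3 F4"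
    "polyfun4 G1" "polyfun4 G2" "polyfun4 G3" "polyfun4 G4" "grad4 G G1 G2 G3 G4" by metis
  then show ?case
    by (intro exI conjI) (rule_tac [5] grad4_add, auto intro: polyfun4.polyfun4_add)
next
  case (polyfun4_mult F G)
  then obtain F1 F2 F3 F4 G1 G2 G3 G4 where
    "polyfun4 F1" "polyfun4 F2" "polyfun4 F3" "polyfun4 F4" "grad4 F F1 F2 F3 F4"
    "polyfun4 G1" "polyfun4 G2" "polyfun4 G3" "polyfun4 G4" "grad4 G G1 G2 G3 G4" by metis
  then show ?case
    by (intro exI conjI)
       (rule_tac [5] grad4_mult, auto intro!: polyfun4.polyfun4_mult polyfun4.polyfun4_add polyfun4_mult.hyps)
qed

lemma grad4_pd:
  assumes "grad4 F F1 F2 F3 F4"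
  shows "pd1 F = F1" "pd2 F = F2" "pd3 F = F3" "pd4 F = F4"
proof -
  show "pd1 F = F1" unfolding pd1_def
    using grad4D[OF assms DERIV_ident DERIV_const DERIV_const DERIV_const] by (auto intro!: ext DERIV_imp_deriv)
  show "pd2 F = F2" unfolding pd2_def
    using grad4D[OF assms DERIV_const DERIV_ident DERIV_const DERIV_const] by (auto intro!: ext DERIV_imp_deriv)
  show "pd3 F = F3" unfolding pd3_def
    using grad4D[OF assms DERIV_const DERIV_const DERIV_ident DERIV_const] by (auto intro!: ext DERIV_imp_deriv)
  show "pd4 F = F4" unfolding pd4_def
    using grad4D[OF assms DERIV_const DERIV_const DERIV_const DERIV_ident] by (auto intro!: ext DERIV_imp_deriv)
qed

lemma polyfun4_grad4: "polyfun4 F \<Longrightarrow> grad4 F (pd1 F) (pd2 F) (pd3 F) (pd4 F)"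
  using polyfun4_grad4_ex grad4_pd by metis

lemma polyfun4_pd:
  assumes "polyfun4 F"
  shows "polyfun4 (pd1 F)" "polyfun4 (pd2 F)" "polyfun4 (pd3 F)" "polyfun4 (pd4 F)"
  using polyfun4_grad4_ex[OF assms] grad4_pd by metis+

lemma Dop_pd: "Dop F = (\<lambda>x1 x2 y1 y2. x1 * pd3 F x1 x2 y1 y2 + x2 * pd4 F x1 x2 y1 y2
    - y1 * pd1 F x1 x2 y1 y2 - y2 * pd2 F x1 x2 y1 y2)"
  by (simp add: Dop_def pd1_def pd2_def pd3_def pd4_def)

lemma polyfun4_Dop: "polyfun4 F \<Longrightarrow> polyfun4 (Dop F)"
  unfolding Dop_pd by (intro polyfun4_intros polyfun4_pd)

lemma Dop_add:
  assumes "polyfun4 F" "polyfun4 G"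
  shows "Dop (\<lambda>x1 x2 y1 y2. F x1 x2 y1 y2 + G x1 x2 y1 y2)
    = (\<lambda>x1 x2 y1 y2. Dop F x1 x2 y1 y2 + Dop G x1 x2 y1 y2)"
  unfolding Dop_pd grad4_pd[OF grad4_add[OF assms[THEN polyfun4_grad4]]] by (simp add: algebra_simps)

lemma Dop_mult:
  assumes "polyfun4 F" "polyfun4 G"
  shows "Dop (\<lambda>x1 x2 y1 y2. F x1 x2 y1 y2 * G x1 x2 y1 y2)
    = (\<lambda>x1 x2 y1 y2. Dop F x1 x2 y1 y2 * G x1 x2 y1 y2 + F x1 x2 y1 y2 * Dop G x1 x2 y1 y2)"
  unfolding Dop_pd grad4_pd[OF grad4_mult[OF assms[THEN polyfun4_grad4]]] by (simp add: algebra_simps)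

lemma Dop_const: "Dop (\<lambda>_ _ _ _. c) = (\<lambda>_ _ _ _. 0)"
  by (simp add: Dop_def)

lemma Dop_cmult:
  assumes "polyfun4 F"
  shows "Dop (\<lambda>x1 x2 y1 y2. c * F x1 x2 y1 y2) = (\<lambda>x1 x2 y1 y2. c * Dop F x1 x2 y1 y2)"
  using Dop_mult[OF polyfun4_const assms, of c] by (simp add: Dop_const)

lemma Dop_diff:
  assumes "polyfun4 F" "polyfun4 G"
  shows "Dop (\<lambda>x1 x2 y1 y2. F x1 x2 y1 y2 - G x1 x2 y1 y2)
    = (\<lambda>x1 x2 y1 y2. Dop F x1 x2 y1 y2 - Dop G x1 x2 y1 y2)"
  using Dop_add[OF assms(1) polyfun4_uminus[OF assms(2)]] Dop_cmult[OF assms(2), of "-1"] by simp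

lemma Dop_uminus:
  assumes "polyfun4 F"
  shows "Dop (\<lambda>x1 x2 y1 y2. - F x1 x2 y1 y2) = (\<lambda>x1 x2 y1 y2. - Dop F x1 x2 y1 y2)"
  using Dop_cmult[OF assms, of "-1"] by simp

lemma polyfun4_tendsto:
  assumes "polyfun4 F" "(f1 \<longlongrightarrow> l1) A" "(f2 \<longlongrightarrow> l2) A" "(f3 \<longlongrightarrow> l3) A" "(f4 \<longlongrightarrow> l4) A"
  shows "((\<lambda>t. F (f1 t) (f2 t) (f3 t) (f4 t)) \<longlongrightarrow> F l1 l2 l3 l4) A"
  using assms(1) by induction (auto intro!: tendsto_intros assms(2-5))

subsection \<open>The flow of the operator D\<close>

text \<open>Every plane (x_j, y_j) turns by the angle t. The velocity of a point is (-y, x), the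
  vector field of D, so differentiating in t applies \<open>Dop\<close>; all orbits close after time
  2 pi.\<close>

definition on_flow :: "fun4 \<Rightarrow> real \<Rightarrow> fun4" where
  "on_flow F t = (\<lambda>x1 x2 y1 y2. F (cos t * x1 - sin t * y1) (cos t * x2 - sin t * y2)
                                   (sin t * x1 + cos t * y1) (sin t * x2 + cos t * y2))"

lemma on_flow_0: "on_flow F 0 = F"
  and on_flow_2pi: "on_flow F (2 * pi) = F"
  by (simp_all add: on_flow_def)

lemma on_flow_deriv:
  assumes "polyfun4 F"
  shows "((\<lambda>t. on_flow F t x1 x2 y1 y2) has_real_derivative on_flow (Dop F) t x1 x2 y1 y2) (at t)"
  unfolding on_flow_def
  by (rule DERIV_cong, rule grad4D[OF polyfun4_grad4[OF assms]])
     (auto intro!: derivative_eq_intros simp: Dop_pd algebra_simps)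

text \<open>A total derivative integrates to zero along a closed orbit, so orbit averages do not see
  the image of D.\<close>

lemma on_flow_integral_Dop:
  assumes "polyfun4 F"
  shows "((\<lambda>t. on_flow (Dop F) t x1 x2 y1 y2) has_integral 0) {0..2*pi}"
proof -
  have "((\<lambda>t. on_flow (Dop F) t x1 x2 y1 y2) has_integral
      (on_flow F (2*pi) x1 x2 y1 y2 - on_flow F 0 x1 x2 y1 y2)) {0..2*pi}"
    by (intro fundamental_theorem_of_calculus)
       (auto simp flip: has_real_derivative_iff_has_vector_derivative intro!: has_field_derivative_at_within on_flow_deriv assms)
  then show ?thesis by (simp add: on_flow_0 on_flow_2pi)
qed

lemma on_flow_ker:
  assumes "polyfun4 F" "Dop F = (\<lambda>_ _ _ _. 0)"
  shows "on_flow F t x1 x2 y1 y2 = F x1 x2 y1 y2"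
proof -
  have "\<And>t. ((\<lambda>t. on_flow F t x1 x2 y1 y2) has_real_derivative 0) (at t)"
    using on_flow_deriv[OF assms(1)] by (simp add: assms(2) on_flow_def)
  then have "on_flow F t x1 x2 y1 y2 = on_flow F 0 x1 x2 y1 y2"
    by (intro DERIV_isconst_all) auto
  then show ?thesis by (simp add: on_flow_0)
qed

text \<open>\<open>Dop F\<close> is constant along orbits because D kills it, and it has mean zero
  along them because it lies in the image.\<close>

lemma ker_inter_image_Dop:
  assumes "polyfun4 F" "Dop (Dop F) = (\<lambda>_ _ _ _. 0)"
  shows "Dop F = (\<lambda>_ _ _ _. 0)"
proof (intro ext)
  fix x1 x2 y1 y2
  have "((\<lambda>t::real. Dop F x1 x2 y1 y2) has_integral 0) {0..2*pi}"
    using on_flow_integral_Dop[OF assms(1)] on_flow_ker[OF polyfun4_Dop[OF assms(1)] assms(2)] by simp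
  moreover have "((\<lambda>t::real. Dop F x1 x2 y1 y2) has_integral (2*pi) * Dop F x1 x2 y1 y2) {0..2*pi}"
    using has_integral_const_real[of "Dop F x1 x2 y1 y2" 0 "2*pi"] by simp
  ultimately have "(2*pi) * Dop F x1 x2 y1 y2 = 0" by (rule has_integral_unique[rotated])
  then show "Dop F x1 x2 y1 y2 = 0" by simp
qed

subsection \<open>Homogeneous components\<close>

lemma finite_exponents: "finite {(a,b,e,f). a + b + e + f \<le> (N::nat)}"
  by (rule finite_subset[of _ "{..N} \<times> {..N} \<times> {..N} \<times> {..N}"]) auto

lemma sum_by_degree:
  fixes h :: "nat \<times> nat \<times> nat \<times> nat \<Rightarrow> real"
  shows "sum h {(a,b,e,f). a + b + e + f \<le> N} = (\<Sum>j\<le>N. sum h {(a,b,e,f). a + b + e + f = j})"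
proof -
  let ?S = "{(a,b,e,f). a + b + e + f \<le> N}" and ?g = "\<lambda>(a,b,e,f). a + b + e + f"
  have "(\<Sum>j\<le>N. sum h {x \<in> ?S. ?g x = j}) = sum h ?S"
    by (rule sum.group) (auto simp: finite_exponents)
  moreover have "{x \<in> ?S. ?g x = j} = {(a,b,e,f). a + b + e + f = j}" if "j \<le> N" for j
    using that by auto
  ultimately show ?thesis by simp
qed

text \<open>A stage between \<open>polyfun4\<close> and coefficient arrays: products are multiplied
  out here, so that the expansion below only has to deal with addition.\<close>

inductive monomial_sum :: "fun4 \<Rightarrow> bool" where
  monomial: "monomial_sum (\<lambda>x1 x2 y1 y2. c * x1 ^ a * x2 ^ b * y1 ^ e * y2 ^ f)"
| monomial_add: "monomial_sum F \<Longrightarrow> monomial_sum G \<Longrightarrow>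
    monomial_sum (\<lambda>x1 x2 y1 y2. F x1 x2 y1 y2 + G x1 x2 y1 y2)"

lemma monomial_sum_mult:
  assumes "monomial_sum F" "monomial_sum G"
  shows "monomial_sum (\<lambda>x1 x2 y1 y2. F x1 x2 y1 y2 * G x1 x2 y1 y2)"
  using assms(1)
proof induction
  case (monomial c a b e f)
  show ?case using assms(2)
  proof induction
    case (monomial c' a' b' e' f')
    show ?case using monomial_sum.monomial[of "c * c'" "a + a'" "b + b'" "e + e'" "f + f'"]
      by (simp add: power_add algebra_simps)
  next
    case (monomial_add F G)
    then show ?case using monomial_sum.monomial_add[OF monomial_add.IH]
      by (simp add: distrib_left)
  qed
next
  case (monomial_add F G)
  then show ?case using monomial_sum.monomial_add[OF monomial_add.IH]
    by (simp add: distrib_right)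
qed

lemma polyfun4_monomial_sum: "polyfun4 F \<Longrightarrow> monomial_sum F"
proof (induction rule: polyfun4.induct)
  case (polyfun4_const c) show ?case using monomial[of c 0 0 0 0] by simp
next
  case polyfun4_x1 show ?case using monomial[of 1 1 0 0 0] by simp
next
  case polyfun4_x2 show ?case using monomial[of 1 0 1 0 0] by simp
next
  case polyfun4_y1 show ?case using monomial[of 1 0 0 1 0] by simp
next
  case polyfun4_y2 show ?case using monomial[of 1 0 0 0 1] by simp
qed (auto intro: monomial_add monomial_sum_mult)

definition mono4 :: "(nat \<Rightarrow> nat \<Rightarrow> nat \<Rightarrow> nat \<Rightarrow> real) \<Rightarrow> real \<Rightarrow> real \<Rightarrow> real \<Rightarrow> real \<Rightarrow> nat \<times> nat \<times> nat \<times> nat \<Rightarrow> real" where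
  "mono4 c x1 x2 y1 y2 = (\<lambda>(a,b,e,f). c a b e f * x1 ^ a * x2 ^ b * y1 ^ e * y2 ^ f)"

text \<open>The expansion holds for all degree bounds from some threshold on, so that two expansions
  can be added over a common index set.\<close>

lemma monomial_sum_expand:
  "monomial_sum F \<Longrightarrow> \<exists>N0 c. \<forall>N\<ge>N0. \<forall>x1 x2 y1 y2.
     F x1 x2 y1 y2 = sum (mono4 c x1 x2 y1 y2) {(a,b,e,f). a + b + e + f \<le> N}"
proof (induction rule: monomial_sum.induct)
  case (monomial c a b e f)
  let ?c = "\<lambda>a' b' e' f'. if (a',b',e',f') = (a,b,e,f) then c else 0"
  have "sum (mono4 ?c x1 x2 y1 y2) {(a,b,e,f). a + b + e + f \<le> N} = c * x1 ^ a * x2 ^ b * y1 ^ e * y2 ^ f"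
    if "N \<ge> a + b + e + f" for N x1 x2 y1 y2
  proof -
    have "mono4 ?c x1 x2 y1 y2 = (\<lambda>p. if p = (a,b,e,f) then c * x1 ^ a * x2 ^ b * y1 ^ e * y2 ^ f else 0)"
      by (auto simp: mono4_def)
    then show ?thesis using that by (simp add: finite_exponents)
  qed
  then show ?case by (intro exI[of _ "a + b + e + f"] exI[of _ ?c]) auto
next
  case (monomial_add F G)
  then obtain N0 c N0' c' where
    *: "\<And>N x1 x2 y1 y2. N \<ge> N0 \<Longrightarrow> F x1 x2 y1 y2 = sum (mono4 c x1 x2 y1 y2) {(a,b,e,f). a + b + e + f \<le> N}"
    "\<And>N x1 x2 y1 y2. N \<ge> N0' \<Longrightarrow> G x1 x2 y1 y2 = sum (mono4 c' x1 x2 y1 y2) {(a,b,e,f). a + b + e + f \<le> N}"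
    by metis
  have "mono4 (\<lambda>a b e f. c a b e f + c' a b e f) x1 x2 y1 y2 = (\<lambda>p. mono4 c x1 x2 y1 y2 p + mono4 c' x1 x2 y1 y2 p)"
    for x1 x2 y1 y2
    by (auto simp: mono4_def algebra_simps)
  then show ?case
    by (intro exI[of _ "max N0 N0'"] exI[of _ "\<lambda>a b e f. c a b e f + c' a b e f"])
       (auto simp: sum.distrib simp flip: *)
qed

lemma mono4_scale:
  "sum (mono4 c (s*x1) (s*x2) (s*y1) (s*y2)) {(a,b,e,f). a + b + e + f = j}
   = s ^ j * sum (mono4 c x1 x2 y1 y2) {(a,b,e,f). a + b + e + f = j}"
  unfolding sum_distrib_left
  by (intro sum.cong) (auto simp: mono4_def power_mult_distrib power_add algebra_simps)

lemma polyfun4_expand: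
  assumes "polyfun4 F"
  obtains N0 c where "\<And>N x1 x2 y1 y2. N \<ge> N0 \<Longrightarrow>
     F x1 x2 y1 y2 = sum (mono4 c x1 x2 y1 y2) {(a,b,e,f). a + b + e + f \<le> N}"
    "\<And>N s x1 x2 y1 y2. N \<ge> N0 \<Longrightarrow>
     F (s*x1) (s*x2) (s*y1) (s*y2) = (\<Sum>j\<le>N. s ^ j * sum (mono4 c x1 x2 y1 y2) {(a,b,e,f). a + b + e + f = j})"
proof -
  obtain N0 c where *: "\<And>N x1 x2 y1 y2. N \<ge> N0 \<Longrightarrow>
     F x1 x2 y1 y2 = sum (mono4 c x1 x2 y1 y2) {(a,b,e,f). a + b + e + f \<le> N}"
    using monomial_sum_expand[OF polyfun4_monomial_sum[OF assms]] by metis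
  show ?thesis
    by (rule that[of N0 c]) (auto simp: * sum_by_degree mono4_scale)
qed

lemma mono4_polyfun4: "polyfun4 (\<lambda>x1 x2 y1 y2. sum (mono4 c x1 x2 y1 y2) S)"
  unfolding mono4_def split_def by (intro polyfun4_intros)

lemma hom_poly_mono4:
  "hom_poly k F \<longleftrightarrow> (\<exists>c. F = (\<lambda>x1 x2 y1 y2. sum (mono4 c x1 x2 y1 y2) {(a,b,e,f). a + b + e + f = k}))"
  by (simp add: hom_poly_def mono4_def)

lemma no_terms_upto_mono4:
  "no_terms_upto r F \<longleftrightarrow> (\<exists>N c. F = (\<lambda>x1 x2 y1 y2. sum (mono4 c x1 x2 y1 y2) {(a,b,e,f). a + b + e + f \<le> N})
     \<and> (\<forall>a b e f. a + b + e + f \<le> r \<longrightarrow> c a b e f = 0))"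
  by (simp add: no_terms_upto_def mono4_def)

text \<open>Replaces the coefficient array by Euler scaling. For the converse, both sides of the
  scaling identity are polynomials in s, and comparing coefficients of s^k leaves only the component
  of degree k.\<close>

lemma hom_poly_iff:
  "hom_poly k F \<longleftrightarrow> polyfun4 F \<and> (\<forall>s x1 x2 y1 y2. F (s*x1) (s*x2) (s*y1) (s*y2) = s ^ k * F x1 x2 y1 y2)"
proof safe
  assume "hom_poly k F"
  then obtain c where F: "F = (\<lambda>x1 x2 y1 y2. sum (mono4 c x1 x2 y1 y2) {(a,b,e,f). a + b + e + f = k})"
    unfolding hom_poly_mono4 by blast
  show "polyfun4 F" unfolding F by (rule mono4_polyfun4)
  show "F (s*x1) (s*x2) (s*y1) (s*y2) = s ^ k * F x1 x2 y1 y2" for s x1 x2 y1 y2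
    unfolding F by (rule mono4_scale)
next
  assume "polyfun4 F" and hom: "\<forall>s x1 x2 y1 y2. F (s*x1) (s*x2) (s*y1) (s*y2) = s ^ k * F x1 x2 y1 y2"
  from this(1) obtain N0 c where
    ex: "\<And>N s x1 x2 y1 y2. N \<ge> N0 \<Longrightarrow>
     F (s*x1) (s*x2) (s*y1) (s*y2) = (\<Sum>j\<le>N. s ^ j * sum (mono4 c x1 x2 y1 y2) {(a,b,e,f). a + b + e + f = j})"
    by (rule polyfun4_expand) blast
  let ?C = "\<lambda>x1 x2 y1 y2 j. sum (mono4 c x1 x2 y1 y2) {(a,b,e,f). a + b + e + f = j}"
  let ?N = "max N0 k"
  have "F x1 x2 y1 y2 = ?C x1 x2 y1 y2 k" for x1 x2 y1 y2
  proof -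
    have "(\<Sum>j\<le>?N. (?C x1 x2 y1 y2 j - (if j = k then F x1 x2 y1 y2 else 0)) * s ^ j) = 0" for s
    proof -
      have "(\<Sum>j\<le>?N. (?C x1 x2 y1 y2 j - (if j = k then F x1 x2 y1 y2 else 0)) * s ^ j)
        = (\<Sum>j\<le>?N. s ^ j * ?C x1 x2 y1 y2 j) - (\<Sum>j\<le>?N. if j = k then F x1 x2 y1 y2 * s ^ k else 0)"
        unfolding sum_subtractf[symmetric] by (intro sum.cong) (auto simp: algebra_simps)
      also have "\<dots> = F (s*x1) (s*x2) (s*y1) (s*y2) - F x1 x2 y1 y2 * s ^ k"
        by (subst ex[of ?N]) simp_all
      also have "\<dots> = 0" using hom by simp
      finally show ?thesis .
    qed
    then have "\<forall>j\<le>?N. ?C x1 x2 y1 y2 j - (if j = k then F x1 x2 y1 y2 else 0) = 0"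
      using polyfun_eq_0[of "\<lambda>j. ?C x1 x2 y1 y2 j - (if j = k then F x1 x2 y1 y2 else 0)" ?N] by blast
    from this[rule_format, of k] show ?thesis by simp
  qed
  then show "hom_poly k F" unfolding hom_poly_mono4 by blast
qed

text \<open>Reads off the lowest-order term. The coefficients may depend on s, as needed for normal
  form terms evaluated at arguments that themselves move with s.\<close>

lemma power_sum_limit:
  fixes c :: "nat \<Rightarrow> real \<Rightarrow> real"
  assumes "finite J" "\<And>j s. j \<in> J \<Longrightarrow> j < k \<Longrightarrow> c j s = 0"
    and "\<And>j. j \<in> J \<Longrightarrow> (c j \<longlongrightarrow> c' j) (at 0)"
  shows "((\<lambda>s. (\<Sum>j\<in>J. s ^ j * c j s) / s ^ k) \<longlongrightarrow> (if k \<in> J then c' k else 0)) (at 0)"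
proof -
  have "((\<lambda>s. s ^ j * c j s / s ^ k) \<longlongrightarrow> (if k = j then c' j else 0)) (at 0)" if j: "j \<in> J" for j
  proof (cases j k rule: linorder_cases)
    case less
    then show ?thesis using assms(2)[OF j less] by simp
  next
    case equal
    have "\<forall>\<^sub>F s in at 0. c j s = s ^ j * c j s / s ^ k"
      unfolding eventually_at_filter by (auto simp: equal intro!: always_eventually)
    from Lim_transform_eventually[OF assms(3)[OF j] this] show ?thesis using equal by simp
  next
    case greater
    have "((\<lambda>s. s ^ (j - k) * c j s) \<longlongrightarrow> 0 ^ (j - k) * c' j) (at 0)"
      by (intro tendsto_intros assms(3) j)
    moreover have "\<forall>\<^sub>F s in at 0. s ^ (j - k) * c j s = s ^ j * c j s / s ^ k"
      unfolding eventually_at_filter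
      using greater by (auto simp: power_diff intro!: always_eventually)
    ultimately have "((\<lambda>s. s ^ j * c j s / s ^ k) \<longlongrightarrow> 0 ^ (j - k) * c' j) (at 0)"
      by (rule Lim_transform_eventually)
    moreover have e: "0 ^ (j - k) * c' j = (if k = j then c' j else 0)" using greater by simp
    ultimately show ?thesis unfolding e by blast
  qed
  then have "((\<lambda>s. \<Sum>j\<in>J. s ^ j * c j s / s ^ k) \<longlongrightarrow> (\<Sum>j\<in>J. if k = j then c' j else 0)) (at 0)"
    by (rule tendsto_sum)
  then show ?thesis using assms(1) by (simp add: sum_divide_distrib)
qed

text \<open>Absence of low-order terms becomes F(s x) = o(s^r) along every ray. For the converse,
  the components are shown to vanish by induction on their degree j: once the lower ones are zero,
  component j is the limit of F(s x) / s^j, which is zero.\<close>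

lemma no_terms_upto_iff:
  "no_terms_upto r F \<longleftrightarrow> polyfun4 F \<and>
     (\<forall>x1 x2 y1 y2. ((\<lambda>s. F (s*x1) (s*x2) (s*y1) (s*y2) / s ^ r) \<longlongrightarrow> 0) (at 0))"
proof safe
  assume "no_terms_upto r F"
  then obtain N c where F: "F = (\<lambda>x1 x2 y1 y2. sum (mono4 c x1 x2 y1 y2) {(a,b,e,f). a + b + e + f \<le> N})"
    and c: "\<And>a b e f. a + b + e + f \<le> r \<Longrightarrow> c a b e f = 0"
    unfolding no_terms_upto_mono4 by blast
  show "polyfun4 F" unfolding F by (rule mono4_polyfun4)
  fix x1 x2 y1 y2
  let ?C = "\<lambda>j. sum (mono4 c x1 x2 y1 y2) {(a,b,e,f). a + b + e + f = j}"
  have C0: "?C j = 0" if "j \<le> r" for j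
    using that by (intro sum.neutral) (auto simp: mono4_def c)
  have "((\<lambda>s. (\<Sum>j\<le>N. s ^ j * ?C j) / s ^ r) \<longlongrightarrow> (if r \<in> {..N} then ?C r else 0)) (at 0)"
    by (rule power_sum_limit) (auto simp: C0)
  then show "((\<lambda>s. F (s*x1) (s*x2) (s*y1) (s*y2) / s ^ r) \<longlongrightarrow> 0) (at 0)"
    unfolding C0[OF order_refl] by (simp add: F sum_by_degree mono4_scale)
next
  assume "polyfun4 F" and lim: "\<forall>x1 x2 y1 y2. ((\<lambda>s. F (s*x1) (s*x2) (s*y1) (s*y2) / s ^ r) \<longlongrightarrow> 0) (at 0)"
  from this(1) obtain N0 c where
    F: "\<And>N x1 x2 y1 y2. N \<ge> N0 \<Longrightarrow>
     F x1 x2 y1 y2 = sum (mono4 c x1 x2 y1 y2) {(a,b,e,f). a + b + e + f \<le> N}" and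
    ex: "\<And>N s x1 x2 y1 y2. N \<ge> N0 \<Longrightarrow>
     F (s*x1) (s*x2) (s*y1) (s*y2) = (\<Sum>j\<le>N. s ^ j * sum (mono4 c x1 x2 y1 y2) {(a,b,e,f). a + b + e + f = j})"
    by (rule polyfun4_expand) blast
  let ?C = "\<lambda>x1 x2 y1 y2 j. sum (mono4 c x1 x2 y1 y2) {(a,b,e,f). a + b + e + f = j}"
  let ?N = "max N0 r"
  have C0: "?C x1 x2 y1 y2 j = 0" if "j \<le> r" for j x1 x2 y1 y2
    using that
  proof (induction j rule: less_induct)
    case (less j)
    have "((\<lambda>s. (\<Sum>j\<le>?N. s ^ j * ?C x1 x2 y1 y2 j) / s ^ j) \<longlongrightarrow> (if j \<in> {..?N} then ?C x1 x2 y1 y2 j else 0)) (at 0)"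
      using less by (intro power_sum_limit) auto
    moreover have j: "j \<in> {..?N}" using less.prems by simp
    ultimately have 1: "((\<lambda>s. F (s*x1) (s*x2) (s*y1) (s*y2) / s ^ j) \<longlongrightarrow> ?C x1 x2 y1 y2 j) (at 0)"
      unfolding ex[OF max.cobounded1[of N0 r]] if_P[OF j] by blast
    have "((\<lambda>s. s ^ (r - j) * (F (s*x1) (s*x2) (s*y1) (s*y2) / s ^ r)) \<longlongrightarrow> 0 ^ (r - j) * 0) (at 0)"
      by (intro tendsto_intros lim[rule_format])
    moreover have "\<forall>\<^sub>F s in at 0. s ^ (r - j) * (F (s*x1) (s*x2) (s*y1) (s*y2) / s ^ r)
        = F (s*x1) (s*x2) (s*y1) (s*y2) / s ^ j"
      unfolding eventually_at_filter
      using less.prems by (auto simp: power_diff intro!: always_eventually)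
    ultimately have "((\<lambda>s. F (s*x1) (s*x2) (s*y1) (s*y2) / s ^ j) \<longlongrightarrow> 0 ^ (r - j) * 0) (at 0)"
      by (rule Lim_transform_eventually)
    from tendsto_unique[OF _ 1 this] show ?case by simp
  qed
  \<comment> \<open>The low components were shown to vanish as functions, not coefficient by
    coefficient; cutting off the array gives the same function and makes the coefficients zero
    literally.\<close>
  let ?c = "\<lambda>a b e f. if a + b + e + f \<le> r then 0 else c a b e f"
  have "F x1 x2 y1 y2 = sum (mono4 ?c x1 x2 y1 y2) {(a,b,e,f). a + b + e + f \<le> ?N}" for x1 x2 y1 y2
  proof -
    have "sum (mono4 ?c x1 x2 y1 y2) {(a,b,e,f). a + b + e + f = j} = ?C x1 x2 y1 y2 j" for j
    proof (cases "j \<le> r")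
      case True
      then show ?thesis unfolding C0[OF True] by (intro sum.neutral) (auto simp: mono4_def)
    qed (auto intro!: sum.cong simp: mono4_def)
    then show ?thesis by (subst F[of ?N]) (simp_all add: sum_by_degree)
  qed
  then show "no_terms_upto r F" unfolding no_terms_upto_mono4
    by (intro exI[of _ ?N] exI[of _ ?c] conjI ext) auto
qed

lemma hom_poly_polyfun4: "hom_poly k F \<Longrightarrow> polyfun4 F"
  by (simp add: hom_poly_iff)

lemma hom_poly_scale: "hom_poly k F \<Longrightarrow> F (s*x1) (s*x2) (s*y1) (s*y2) = s ^ k * F x1 x2 y1 y2"
  by (simp add: hom_poly_iff)

lemma hom_poly_zero: "hom_poly k (\<lambda>_ _ _ _. 0)"
  by (auto simp: hom_poly_iff intro: polyfun4_const)

lemma hom_poly_add: "hom_poly k F \<Longrightarrow> hom_poly k G \<Longrightarrow> hom_poly k (\<lambda>x1 x2 y1 y2. F x1 x2 y1 y2 + G x1 x2 y1 y2)"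
  by (simp add: hom_poly_iff polyfun4_add algebra_simps)

lemma hom_poly_cmult: "hom_poly k F \<Longrightarrow> hom_poly k (\<lambda>x1 x2 y1 y2. c * F x1 x2 y1 y2)"
  by (simp add: hom_poly_iff polyfun4_mult polyfun4_const)

lemma hom_poly_diff: "hom_poly k F \<Longrightarrow> hom_poly k G \<Longrightarrow> hom_poly k (\<lambda>x1 x2 y1 y2. F x1 x2 y1 y2 - G x1 x2 y1 y2)"
  using hom_poly_add[OF _ hom_poly_cmult[of k G "-1"], of F] by simp

lemma hom_poly_mult:
  "hom_poly k F \<Longrightarrow> hom_poly l G \<Longrightarrow> hom_poly (k + l) (\<lambda>x1 x2 y1 y2. F x1 x2 y1 y2 * G x1 x2 y1 y2)"
  by (simp add: hom_poly_iff polyfun4_mult power_add algebra_simps)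

text \<open>Chain rule applied to the scaling identity. The factor s stays on the left, which avoids
  the exponent k - 1 and keeps the identity valid for k = 0 and s = 0.\<close>

lemma hom_poly_pd_scale:
  assumes "hom_poly k F"
  shows "s * pd1 F (s*x1) (s*x2) (s*y1) (s*y2) = s ^ k * pd1 F x1 x2 y1 y2"
    and "s * pd2 F (s*x1) (s*x2) (s*y1) (s*y2) = s ^ k * pd2 F x1 x2 y1 y2"
    and "s * pd3 F (s*x1) (s*x2) (s*y1) (s*y2) = s ^ k * pd3 F x1 x2 y1 y2"
    and "s * pd4 F (s*x1) (s*x2) (s*y1) (s*y2) = s ^ k * pd4 F x1 x2 y1 y2"
proof -
  note g = polyfun4_grad4[OF hom_poly_polyfun4[OF assms]]
  have mul: "((*) s has_real_derivative s) (at t)" for t by (auto intro!: derivative_eq_intros)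
  note c = DERIV_const
  note h = hom_poly_scale[OF assms]
  show "s * pd1 F (s*x1) (s*x2) (s*y1) (s*y2) = s ^ k * pd1 F x1 x2 y1 y2"
    using DERIV_unique[OF grad4D[OF g mul[of x1] c[of "s*x2"] c[of "s*y1"] c[of "s*y2"], unfolded h]
        DERIV_cmult[OF grad4D[OF g DERIV_ident[of "at x1"] c[of x2] c[of y1] c[of y2]], of "s^k"]]
    by (simp add: mult.commute)
  show "s * pd2 F (s*x1) (s*x2) (s*y1) (s*y2) = s ^ k * pd2 F x1 x2 y1 y2"
    using DERIV_unique[OF grad4D[OF g c[of "s*x1"] mul[of x2] c[of "s*y1"] c[of "s*y2"], unfolded h]
        DERIV_cmult[OF grad4D[OF g c[of x1] DERIV_ident[of "at x2"] c[of y1] c[of y2]], of "s^k"]]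
    by (simp add: mult.commute)
  show "s * pd3 F (s*x1) (s*x2) (s*y1) (s*y2) = s ^ k * pd3 F x1 x2 y1 y2"
    using DERIV_unique[OF grad4D[OF g c[of "s*x1"] c[of "s*x2"] mul[of y1] c[of "s*y2"], unfolded h]
        DERIV_cmult[OF grad4D[OF g c[of x1] c[of x2] DERIV_ident[of "at y1"] c[of y2]], of "s^k"]]
    by (simp add: mult.commute)
  show "s * pd4 F (s*x1) (s*x2) (s*y1) (s*y2) = s ^ k * pd4 F x1 x2 y1 y2"
    using DERIV_unique[OF grad4D[OF g c[of "s*x1"] c[of "s*x2"] c[of "s*y1"] mul[of y2], unfolded h]
        DERIV_cmult[OF grad4D[OF g c[of x1] c[of x2] c[of y1] DERIV_ident[of "at y2"]], of "s^k"]]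
    by (simp add: mult.commute)
qed

lemma hom_poly_Dop:
  assumes "hom_poly k F" shows "hom_poly k (Dop F)"
proof -
  have "Dop F (s*x1) (s*x2) (s*y1) (s*y2) = s ^ k * Dop F x1 x2 y1 y2" for s x1 x2 y1 y2
  proof -
    have "Dop F (s*x1) (s*x2) (s*y1) (s*y2) =
       x1 * (s * pd3 F (s*x1) (s*x2) (s*y1) (s*y2)) + x2 * (s * pd4 F (s*x1) (s*x2) (s*y1) (s*y2))
     - y1 * (s * pd1 F (s*x1) (s*x2) (s*y1) (s*y2)) - y2 * (s * pd2 F (s*x1) (s*x2) (s*y1) (s*y2))"
      by (simp add: Dop_pd algebra_simps)
    also have "\<dots> = s ^ k * Dop F x1 x2 y1 y2"
      unfolding hom_poly_pd_scale[OF assms] by (simp add: Dop_pd algebra_simps)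
    finally show ?thesis .
  qed
  then show ?thesis using polyfun4_Dop[OF hom_poly_polyfun4[OF assms]] by (simp add: hom_poly_iff)
qed

text \<open>Elements of the kernel are invariant under the flow, whose time-pi map is minus the
  identity; odd degree turns this into F = -F.\<close>

lemma in_ker_D_odd_zero:
  assumes "in_ker_D k F" "odd k"
  shows "F = (\<lambda>_ _ _ _. 0)"
proof (intro ext)
  fix x1 x2 y1 y2
  have F: "hom_poly k F" "Dop F = (\<lambda>_ _ _ _. 0)" using assms(1) by (auto simp: in_ker_D_def)
  have "F x1 x2 y1 y2 = F ((-1)*x1) ((-1)*x2) ((-1)*y1) ((-1)*y2)"
    using on_flow_ker[OF hom_poly_polyfun4[OF F(1)] F(2), of pi x1 x2 y1 y2] by (simp add: on_flow_def)
  also have "\<dots> = - F x1 x2 y1 y2" using assms(2) unfolding hom_poly_scale[OF F(1)] by simp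
  finally show "F x1 x2 y1 y2 = 0" by simp
qed

subsection \<open>Splitting into kernel and image of D\<close>

text \<open>Sums of eigenvectors of the square of D are closed under products: for eigenvectors F, G with
  eigenvalues -i^2, -j^2, both FG + DF DG / (i j) and FG - DF DG / (i j) are eigenvectors, with
  eigenvalues -(i - j)^2 and -(i + j)^2.\<close>

definition eigen_D :: "nat \<Rightarrow> real \<Rightarrow> fun4 \<Rightarrow> bool" where
  "eigen_D k j F \<longleftrightarrow> hom_poly k F \<and> Dop (Dop F) = (\<lambda>x1 x2 y1 y2. - (j\<^sup>2) * F x1 x2 y1 y2)"

inductive eigen_sum :: "nat \<Rightarrow> fun4 \<Rightarrow> bool" for k where
  eigen: "eigen_D k j F \<Longrightarrow> eigen_sum k F"
| eigen_add: "eigen_sum k F \<Longrightarrow> eigen_sum k G \<Longrightarrow> eigen_sum k (\<lambda>x1 x2 y1 y2. F x1 x2 y1 y2 + G x1 x2 y1 y2)"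

lemma eigen_D_cmult: "eigen_D k j F \<Longrightarrow> eigen_D k j (\<lambda>x1 x2 y1 y2. c * F x1 x2 y1 y2)"
  by (auto simp: eigen_D_def hom_poly_cmult Dop_cmult hom_poly_polyfun4 polyfun4_Dop mult.left_commute)

text \<open>D has no nilpotent part, so eigenvalue 0 of D^2 already means the kernel of D.\<close>

lemma eigen_D_ker: "eigen_D k 0 F \<Longrightarrow> Dop F = (\<lambda>_ _ _ _. 0)"
  using ker_inter_image_Dop[of F] by (auto simp: eigen_D_def hom_poly_polyfun4)

lemma eigen_D_mult:
  assumes F: "eigen_D k i F" and G: "eigen_D l j G"
  shows "eigen_sum (k + l) (\<lambda>x1 x2 y1 y2. F x1 x2 y1 y2 * G x1 x2 y1 y2)"
proof -
  have pF: "hom_poly k F" "polyfun4 F" "polyfun4 (Dop F)" "hom_poly k (Dop F)"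
    and DF: "Dop (Dop F) = (\<lambda>x1 x2 y1 y2. - (i\<^sup>2) * F x1 x2 y1 y2)"
    using F by (auto simp: eigen_D_def hom_poly_polyfun4 polyfun4_Dop hom_poly_Dop)
  have pG: "hom_poly l G" "polyfun4 G" "polyfun4 (Dop G)" "hom_poly l (Dop G)"
    and DG: "Dop (Dop G) = (\<lambda>x1 x2 y1 y2. - (j\<^sup>2) * G x1 x2 y1 y2)"
    using G by (auto simp: eigen_D_def hom_poly_polyfun4 polyfun4_Dop hom_poly_Dop)
  note ps = polyfun4_diff polyfun4_uminus polyfun4_mult polyfun4_add polyfun4_const pF(2,3) pG(2,3)
  have DD: "Dop (Dop (\<lambda>x1 x2 y1 y2. F x1 x2 y1 y2 * G x1 x2 y1 y2 + c * (Dop F x1 x2 y1 y2 * Dop G x1 x2 y1 y2)))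
     = (\<lambda>x1 x2 y1 y2. - (i\<^sup>2 + j\<^sup>2) * (F x1 x2 y1 y2 * G x1 x2 y1 y2 + c * (Dop F x1 x2 y1 y2 * Dop G x1 x2 y1 y2))
        + 2 * (Dop F x1 x2 y1 y2 * Dop G x1 x2 y1 y2) + 2 * c * i\<^sup>2 * j\<^sup>2 * (F x1 x2 y1 y2 * G x1 x2 y1 y2))" for c
    by (simp add: Dop_add Dop_diff Dop_uminus Dop_mult Dop_const DF DG ps) (simp add: algebra_simps)
  have hom: "hom_poly (k + l) (\<lambda>x1 x2 y1 y2. F x1 x2 y1 y2 * G x1 x2 y1 y2 + c * (Dop F x1 x2 y1 y2 * Dop G x1 x2 y1 y2))" for c
    by (intro hom_poly_add hom_poly_cmult hom_poly_mult pF pG)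
  show ?thesis
  proof (cases "i = 0 \<or> j = 0")
    case True
    \<comment> \<open>Here one of \<open>Dop F\<close>, \<open>Dop G\<close> is zero, so the product
      is itself an eigenvector; the correction terms with denominator i j are only formed in the
      other case.\<close>
    then have "eigen_D (k + l) (i + j) (\<lambda>x1 x2 y1 y2. F x1 x2 y1 y2 * G x1 x2 y1 y2 + 0 * (Dop F x1 x2 y1 y2 * Dop G x1 x2 y1 y2))"
      unfolding eigen_D_def DD using hom[of 0] F G by (auto dest: eigen_D_ker)
    then show ?thesis using eigen by simp
  next
    case False
    have e: "eigen_D (k + l) (i - e * j) (\<lambda>x1 x2 y1 y2. F x1 x2 y1 y2 * G x1 x2 y1 y2 + e / (i * j) * (Dop F x1 x2 y1 y2 * Dop G x1 x2 y1 y2))"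
      if "e = 1 \<or> e = -1" for e
    proof -
      have "- (i\<^sup>2 + j\<^sup>2) * (a + e / (i * j) * b) + 2 * b + 2 * (e / (i * j)) * i\<^sup>2 * j\<^sup>2 * a
          = - ((i - e * j)\<^sup>2) * (a + e / (i * j) * b)" for a b
        using False that by (auto simp: power2_eq_square field_simps)
      then show ?thesis unfolding eigen_D_def DD using hom[of "e / (i * j)"] by blast
    qed
    \<comment> \<open>Averaging the two eigenvectors cancels the \<open>Dop F\<close>
      \<open>Dop G\<close> terms and leaves the product.\<close>
    have "eigen_sum (k + l) (\<lambda>x1 x2 y1 y2.
        1/2 * (F x1 x2 y1 y2 * G x1 x2 y1 y2 + 1 / (i * j) * (Dop F x1 x2 y1 y2 * Dop G x1 x2 y1 y2))
      + 1/2 * (F x1 x2 y1 y2 * G x1 x2 y1 y2 + (-1) / (i * j) * (Dop F x1 x2 y1 y2 * Dop G x1 x2 y1 y2)))"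
      by (rule eigen_add[OF eigen[OF eigen_D_cmult[OF e]] eigen[OF eigen_D_cmult[OF e]]]) simp_all
    then show ?thesis by (simp add: algebra_simps)
  qed
qed

lemma eigen_sum_mult:
  assumes "eigen_sum k F" "eigen_sum l G"
  shows "eigen_sum (k + l) (\<lambda>x1 x2 y1 y2. F x1 x2 y1 y2 * G x1 x2 y1 y2)"
  using assms(1)
proof induction
  case (eigen i F)
  show ?case using assms(2)
  proof induction
    case (eigen j G)
    then show ?case using \<open>eigen_D k i F\<close> by (intro eigen_D_mult)
  next
    case (eigen_add G H)
    then show ?case using eigen_sum.eigen_add[OF eigen_add.IH] by (simp add: distrib_left)
  qed
next
  case (eigen_add F H)
  then show ?case using eigen_sum.eigen_add[OF eigen_add.IH] by (simp add: distrib_right)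
qed

lemma eigen_sum_const: "eigen_sum 0 (\<lambda>_ _ _ _. c)"
  by (rule eigen[of _ 0]) (auto simp: eigen_D_def Dop_const hom_poly_iff polyfun4_const)

lemma eigen_sum_zero: "eigen_sum k (\<lambda>_ _ _ _. 0)"
  by (rule eigen[of _ 0]) (auto simp: eigen_D_def Dop_const hom_poly_zero)

lemma eigen_sum_coords:
  "eigen_sum 1 (\<lambda>x1 x2 y1 y2. x1)" "eigen_sum 1 (\<lambda>x1 x2 y1 y2. x2)"
  "eigen_sum 1 (\<lambda>x1 x2 y1 y2. y1)" "eigen_sum 1 (\<lambda>x1 x2 y1 y2. y2)"
  by (rule eigen[of _ 1]; auto simp: eigen_D_def hom_poly_iff Dop_def intro: polyfun4.intros)+

lemma eigen_sum_power:
  assumes "eigen_sum 1 F" shows "eigen_sum n (\<lambda>x1 x2 y1 y2. F x1 x2 y1 y2 ^ n)"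
proof (induction n)
  case 0 then show ?case using eigen_sum_const by simp
next
  case (Suc n) then show ?case using eigen_sum_mult[OF assms Suc] by simp
qed

lemma eigen_sum_sum:
  "(\<And>i. i \<in> S \<Longrightarrow> eigen_sum k (F i)) \<Longrightarrow> eigen_sum k (\<lambda>x1 x2 y1 y2. \<Sum>i\<in>S. F i x1 x2 y1 y2)"
  by (induction S rule: infinite_finite_induct) (auto intro: eigen_add eigen_sum_zero)

lemma hom_poly_eigen_sum:
  assumes "hom_poly k F" shows "eigen_sum k F"
proof -
  obtain c where F: "F = (\<lambda>x1 x2 y1 y2. \<Sum>p\<in>{(a,b,e,f). a + b + e + f = k}. mono4 c x1 x2 y1 y2 p)"
    using assms unfolding hom_poly_mono4 by blast
  show ?thesis unfolding F
  proof (rule eigen_sum_sum)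
    fix p assume "p \<in> {(a,b,e,f). a + b + e + f = k}"
    then obtain a b e f where p: "p = (a,b,e,f)" "k = 0 + a + b + e + f" by auto
    show "eigen_sum k (\<lambda>x1 x2 y1 y2. mono4 c x1 x2 y1 y2 p)"
      unfolding p mono4_def split_conv
      by (intro eigen_sum_mult eigen_sum_power eigen_sum_const eigen_sum_coords)
  qed
qed

text \<open>On a nonzero eigenvalue -j^2 of D^2 one inverts by division, F = D^2 (-F / j^2). The
  image part is written as D^2 U rather than D U, so that its preimage D U again lies in the image
  of D, as the definition of the normal form demands of generating functions.\<close>

lemma eigen_split:
  "eigen_sum k F \<Longrightarrow> \<exists>G U. hom_poly k G \<and> hom_poly k U \<and> Dop G = (\<lambda>_ _ _ _. 0) \<and>
    F = (\<lambda>x1 x2 y1 y2. G x1 x2 y1 y2 + Dop (Dop U) x1 x2 y1 y2)"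
proof (induction rule: eigen_sum.induct)
  case (eigen j F)
  show ?case
  proof (cases "j = 0")
    case True
    have F: "hom_poly k F" "Dop F = (\<lambda>_ _ _ _. 0)"
      using eigen eigen_D_ker[of k F] True by (simp_all add: eigen_D_def)
    show ?thesis
      by (rule exI[of _ F], rule exI[of _ "\<lambda>_ _ _ _. 0"]) (simp add: F Dop_const hom_poly_zero)
  next
    case False
    have F: "hom_poly k F" "Dop (Dop F) = (\<lambda>x1 x2 y1 y2. - (j\<^sup>2) * F x1 x2 y1 y2)"
      using eigen unfolding eigen_D_def by blast+
    let ?U = "\<lambda>x1 x2 y1 y2. (- 1 / j\<^sup>2) * F x1 x2 y1 y2"
    have 1: "Dop ?U = (\<lambda>x1 x2 y1 y2. (- 1 / j\<^sup>2) * Dop F x1 x2 y1 y2)"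
      by (rule Dop_cmult[OF hom_poly_polyfun4[OF F(1)]])
    have 2: "Dop (\<lambda>x1 x2 y1 y2. (- 1 / j\<^sup>2) * Dop F x1 x2 y1 y2) = (\<lambda>x1 x2 y1 y2. (- 1 / j\<^sup>2) * Dop (Dop F) x1 x2 y1 y2)"
      by (rule Dop_cmult[OF polyfun4_Dop[OF hom_poly_polyfun4[OF F(1)]]])
    have 3: "F = (\<lambda>x1 x2 y1 y2. 0 + Dop (Dop ?U) x1 x2 y1 y2)"
      unfolding 1 2 F(2) using False by simp
    have 4: "hom_poly k ?U" by (rule hom_poly_cmult[OF F(1)])
    show ?thesis
      by (rule exI[of _ "\<lambda>_ _ _ _. 0"], rule exI[of _ ?U]) (intro conjI hom_poly_zero Dop_const 3 4)
  qed
next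
  case (eigen_add F F')
  from eigen_add.IH(1) obtain G U where 1: "hom_poly k G" "hom_poly k U" "Dop G = (\<lambda>_ _ _ _. 0)"
    "F = (\<lambda>x1 x2 y1 y2. G x1 x2 y1 y2 + Dop (Dop U) x1 x2 y1 y2)" by (elim exE conjE)
  from eigen_add.IH(2) obtain G' U' where 2: "hom_poly k G'" "hom_poly k U'" "Dop G' = (\<lambda>_ _ _ _. 0)"
    "F' = (\<lambda>x1 x2 y1 y2. G' x1 x2 y1 y2 + Dop (Dop U') x1 x2 y1 y2)" by (elim exE conjE)
  let ?G = "\<lambda>x1 x2 y1 y2. G x1 x2 y1 y2 + G' x1 x2 y1 y2"
  let ?U = "\<lambda>x1 x2 y1 y2. U x1 x2 y1 y2 + U' x1 x2 y1 y2"
  note p = 1(1,2)[THEN hom_poly_polyfun4] 2(1,2)[THEN hom_poly_polyfun4]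
  have 3: "hom_poly k ?G" "hom_poly k ?U" by (rule hom_poly_add[OF 1(1) 2(1)], rule hom_poly_add[OF 1(2) 2(2)])
  have 4: "Dop ?G = (\<lambda>_ _ _ _. 0)" unfolding Dop_add[OF p(1,3)] 1(3) 2(3) by simp
  have 5: "(\<lambda>x1 x2 y1 y2. F x1 x2 y1 y2 + F' x1 x2 y1 y2)
     = (\<lambda>x1 x2 y1 y2. ?G x1 x2 y1 y2 + Dop (Dop ?U) x1 x2 y1 y2)"
    unfolding Dop_add[OF p(2,4)] Dop_add[OF p(2,4)[THEN polyfun4_Dop]] 1(4) 2(4)
    by (intro ext) simp
  show ?case
    by (rule exI[of _ ?G], rule exI[of _ ?U]) (intro conjI 3 4 5)
qed

lemma kernel_image_split:
  assumes "hom_poly k F"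
  obtains G U where "hom_poly k G" "hom_poly k U" "Dop G = (\<lambda>_ _ _ _. 0)"
    "F = (\<lambda>x1 x2 y1 y2. G x1 x2 y1 y2 + Dop (Dop U) x1 x2 y1 y2)"
  using eigen_split[OF hom_poly_eigen_sum[OF assms]] by (elim exE conjE)

subsection \<open>The homological equations\<close>

lemma grad4_sum:
  assumes "\<And>i. i \<in> S \<Longrightarrow> grad4 (F i) (F1 i) (F2 i) (F3 i) (F4 i)"
  shows "grad4 (\<lambda>x1 x2 y1 y2. \<Sum>i\<in>S. F i x1 x2 y1 y2)
    (\<lambda>x1 x2 y1 y2. \<Sum>i\<in>S. F1 i x1 x2 y1 y2) (\<lambda>x1 x2 y1 y2. \<Sum>i\<in>S. F2 i x1 x2 y1 y2)
    (\<lambda>x1 x2 y1 y2. \<Sum>i\<in>S. F3 i x1 x2 y1 y2) (\<lambda>x1 x2 y1 y2. \<Sum>i\<in>S. F4 i x1 x2 y1 y2)"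
  using assms
proof (induction S rule: infinite_finite_induct)
  case (insert i S)
  show ?case using grad4_add[OF insert.prems[of i] insert.IH[OF insert.prems]] insert.hyps by simp
qed (auto simp: grad4_def)

lemma grad4_pairing:
  "grad4 (\<lambda>x1 x2 y1 y2. x1 * y1 + x2 * y2) (\<lambda>x1 x2 y1 y2. y1) (\<lambda>x1 x2 y1 y2. y2)
     (\<lambda>x1 x2 y1 y2. x1) (\<lambda>x1 x2 y1 y2. x2)"
  unfolding grad4_def by (auto intro!: derivative_eq_intros simp: algebra_simps)

lemma pot_scale: "pot d v (s * q1) (s * q2) = s ^ d * pot d v q1 q2"
  unfolding pot_def sum_distrib_left
  by (intro sum.cong) (auto simp: power_mult_distrib power_add[symmetric] algebra_simps)

lemma polyfun4_pot: "polyfun4 (\<lambda>x1 x2 y1 y2. pot d v x1 x2)"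
  unfolding pot_def by (intro polyfun4_intros)

lemma hom_poly_pot: "hom_poly d (\<lambda>x1 x2 y1 y2. pot d v x1 x2)"
  by (simp add: hom_poly_iff polyfun4_pot pot_scale)

section \<open>The residual of the generating function equation, degree by degree\<close>

definition quad_bracket :: "fun4 \<Rightarrow> fun4" where
  "quad_bracket F = (\<lambda>x1 x2 y1 y2. ((pd1 F x1 x2 y1 y2)\<^sup>2 + (pd2 F x1 x2 y1 y2)\<^sup>2
      - (pd3 F x1 x2 y1 y2)\<^sup>2 - (pd4 F x1 x2 y1 y2)\<^sup>2) / 2)"

text \<open>This is K(q, W_q) - G(W_eta, eta) with x = q, y = eta and the squares multiplied out:
  the oscillator parts cancel, and the cross terms eta W_q - q W_eta add up to -D W.\<close>

definition bg_residual :: "nat \<Rightarrow> (nat \<Rightarrow> real) \<Rightarrow> nat \<Rightarrow> (nat \<Rightarrow> fun4) \<Rightarrow> (nat \<Rightarrow> fun4) \<Rightarrow> fun4" where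
  "bg_residual d v \<rho> Gk Wk = (\<lambda>x1 x2 y1 y2. pot d v x1 x2 - (\<Sum>k=3..\<rho>. Dop (Wk k) x1 x2 y1 y2)
     + ((\<Sum>k=3..\<rho>. pd1 (Wk k) x1 x2 y1 y2)\<^sup>2 + (\<Sum>k=3..\<rho>. pd2 (Wk k) x1 x2 y1 y2)\<^sup>2
      - (\<Sum>k=3..\<rho>. pd3 (Wk k) x1 x2 y1 y2)\<^sup>2 - (\<Sum>k=3..\<rho>. pd4 (Wk k) x1 x2 y1 y2)\<^sup>2) / 2
     - (\<Sum>k=3..\<rho>. Gk k (x1 + (\<Sum>k=3..\<rho>. pd3 (Wk k) x1 x2 y1 y2))
                       (x2 + (\<Sum>k=3..\<rho>. pd4 (Wk k) x1 x2 y1 y2)) y1 y2))"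

lemma bg_residual_eq:
  fixes Gk Wk :: "nat \<Rightarrow> fun4"
  assumes "\<And>k. k \<in> {3..\<rho>} \<Longrightarrow> polyfun4 (Wk k)"
  defines "W \<equiv> (\<lambda>q1 q2 \<eta>1 \<eta>2. q1 * \<eta>1 + q2 * \<eta>2 + (\<Sum>k=3..\<rho>. Wk k q1 q2 \<eta>1 \<eta>2))"
    and "G \<equiv> (\<lambda>\<xi>1 \<xi>2 \<eta>1 \<eta>2. (\<eta>1\<^sup>2 + \<xi>1\<^sup>2 + \<eta>2\<^sup>2 + \<xi>2\<^sup>2) / 2 + (\<Sum>k=3..\<rho>. Gk k \<xi>1 \<xi>2 \<eta>1 \<eta>2))"
  shows "(\<lambda>q1 q2 \<eta>1 \<eta>2.
              PHO d v q1 q2 (deriv (\<lambda>t. W t q2 \<eta>1 \<eta>2) q1) (deriv (\<lambda>t. W q1 t \<eta>1 \<eta>2) q2)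
            - G (deriv (\<lambda>t. W q1 q2 t \<eta>2) \<eta>1) (deriv (\<lambda>t. W q1 q2 \<eta>1 t) \<eta>2) \<eta>1 \<eta>2)
       = bg_residual d v \<rho> Gk Wk"
proof -
  have "grad4 W (\<lambda>x1 x2 y1 y2. y1 + (\<Sum>k=3..\<rho>. pd1 (Wk k) x1 x2 y1 y2))
     (\<lambda>x1 x2 y1 y2. y2 + (\<Sum>k=3..\<rho>. pd2 (Wk k) x1 x2 y1 y2))
     (\<lambda>x1 x2 y1 y2. x1 + (\<Sum>k=3..\<rho>. pd3 (Wk k) x1 x2 y1 y2))
     (\<lambda>x1 x2 y1 y2. x2 + (\<Sum>k=3..\<rho>. pd4 (Wk k) x1 x2 y1 y2))"
    unfolding W_def by (intro grad4_add grad4_pairing grad4_sum polyfun4_grad4 assms(1))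
  note pd = grad4_pd[OF this]
  have D: "(\<Sum>k=3..\<rho>. Dop (Wk k) x1 x2 y1 y2) =
      x1 * (\<Sum>k=3..\<rho>. pd3 (Wk k) x1 x2 y1 y2) + x2 * (\<Sum>k=3..\<rho>. pd4 (Wk k) x1 x2 y1 y2)
    - y1 * (\<Sum>k=3..\<rho>. pd1 (Wk k) x1 x2 y1 y2) - y2 * (\<Sum>k=3..\<rho>. pd2 (Wk k) x1 x2 y1 y2)"
    for x1 x2 y1 y2
    by (simp add: Dop_pd sum.distrib sum_subtractf sum_distrib_left)
  have der: "deriv (\<lambda>t. W t x2 y1 y2) x1 = y1 + (\<Sum>k=3..\<rho>. pd1 (Wk k) x1 x2 y1 y2)"
    "deriv (\<lambda>t. W x1 t y1 y2) x2 = y2 + (\<Sum>k=3..\<rho>. pd2 (Wk k) x1 x2 y1 y2)"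
    "deriv (\<lambda>t. W x1 x2 t y2) y1 = x1 + (\<Sum>k=3..\<rho>. pd3 (Wk k) x1 x2 y1 y2)"
    "deriv (\<lambda>t. W x1 x2 y1 t) y2 = x2 + (\<Sum>k=3..\<rho>. pd4 (Wk k) x1 x2 y1 y2)" for x1 x2 y1 y2
    using pd[THEN fun_cong, THEN fun_cong, THEN fun_cong, THEN fun_cong, of x1 x2 y1 y2]
    unfolding pd1_def[of W] pd2_def[of W] pd3_def[of W] pd4_def[of W] by blast+
  show ?thesis
    unfolding der bg_residual_def PHO_def G_def D
    by (intro ext) (simp add: power2_eq_square field_simps)
qed

lemma is_BGNF_iff:
  "is_BGNF (PHO d v) \<rho> G \<longleftrightarrow> (\<exists>Gk Wk.
     (\<forall>k\<in>{3..\<rho>}. in_ker_D k (Gk k) \<and> in_image_D k (Wk k))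
     \<and> G = (\<lambda>\<xi>1 \<xi>2 \<eta>1 \<eta>2. (\<eta>1\<^sup>2 + \<xi>1\<^sup>2 + \<eta>2\<^sup>2 + \<xi>2\<^sup>2) / 2 + (\<Sum>k=3..\<rho>. Gk k \<xi>1 \<xi>2 \<eta>1 \<eta>2))
     \<and> no_terms_upto \<rho> (bg_residual d v \<rho> Gk Wk))"
proof -
  have poly: "polyfun4 (Wk k)" if "\<forall>k\<in>{3..\<rho>}. in_ker_D k (Gk k) \<and> in_image_D k (Wk k)" "k \<in> {3..\<rho>}"
    for Gk Wk :: "nat \<Rightarrow> fun4" and k
    using that by (auto simp: in_image_D_def dest!: bspec intro!: polyfun4_Dop elim: hom_poly_polyfun4)
  show ?thesis
    unfolding is_BGNF_def Let_def
    by (intro ex_cong1 conj_cong refl; clarsimp?; subst bg_residual_eq; auto intro: poly)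
qed

lemma polyfun4_bg_residual:
  assumes "\<And>k. k \<in> {3..\<rho>} \<Longrightarrow> polyfun4 (Gk k)" "\<And>k. k \<in> {3..\<rho>} \<Longrightarrow> polyfun4 (Wk k)"
  shows "polyfun4 (bg_residual d v \<rho> Gk Wk)"
  unfolding bg_residual_def
  by (intro polyfun4_diff polyfun4_add polyfun4_divide polyfun4_power polyfun4_sum polyfun4_pot
      polyfun4_Dop polyfun4_pd polyfun4_compose[OF assms(1)] polyfun4.intros assms(2))

text \<open>The component of degree k0, given that all lower equations are solved. Up to degree 2 d
  - 2 the only nonlinear contribution is the square of the gradient of W_d, and the shift of the
  arguments of G_k by W_eta does not affect the leading term.\<close>

lemma bg_residual_limit:
  assumes G: "\<And>k. k \<in> {3..\<rho>} \<Longrightarrow> hom_poly k (Gk k)" and W: "\<And>k. k \<in> {3..\<rho>} \<Longrightarrow> hom_poly k (Wk k)"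
    and d: "3 \<le> d" "d \<le> \<rho>" and k0: "3 \<le> k0" "k0 \<le> \<rho>" "k0 \<le> 2 * d - 2"
    and G0: "\<And>j. j \<in> {3..<k0} \<Longrightarrow> Gk j = (\<lambda>_ _ _ _. 0)"
    and W0: "\<And>j. j \<in> {3..<k0} \<Longrightarrow> j \<noteq> d \<Longrightarrow> Wk j = (\<lambda>_ _ _ _. 0)"
    and Wd: "d < k0 \<Longrightarrow> Dop (Wk d) = (\<lambda>x1 x2 y1 y2. pot d v x1 x2)"
  shows "((\<lambda>s. bg_residual d v \<rho> Gk Wk (s*x1) (s*x2) (s*y1) (s*y2) / s ^ k0) \<longlongrightarrow>
     (if k0 = d then pot d v x1 x2 else 0) + (if k0 = 2 * d - 2 then quad_bracket (Wk d) x1 x2 y1 y2 else 0)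
     - Dop (Wk k0) x1 x2 y1 y2 - Gk k0 x1 x2 y1 y2) (at 0)"
proof -
  let ?S = "{3..\<rho>}"
  have pd0: "pd1 (\<lambda>_ _ _ _. 0) = (\<lambda>_ _ _ _. 0)" "pd2 (\<lambda>_ _ _ _. 0) = (\<lambda>_ _ _ _. 0)"
    "pd3 (\<lambda>_ _ _ _. 0) = (\<lambda>_ _ _ _. 0)" "pd4 (\<lambda>_ _ _ _. 0) = (\<lambda>_ _ _ _. 0)"
    by (simp_all add: pd1_def pd2_def pd3_def pd4_def)
  define c where "c k = (if k = d then pot d v x1 x2 else 0) - Dop (Wk k) x1 x2 y1 y2" for k
  define a where "a i k = (if i = (1::nat) then pd1 (Wk k) x1 x2 y1 y2 else if i = 2 then pd2 (Wk k) x1 x2 y1 y2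
     else if i = 3 then pd3 (Wk k) x1 x2 y1 y2 else pd4 (Wk k) x1 x2 y1 y2)" for i k
  define A where "A i s = (\<Sum>k\<in>?S. s ^ k * a i k)" for i s
  \<comment> \<open>At the scaled point the first two arguments of G_k are s (x_j + A / s^2);
    homogeneity then extracts s^k.\<close>
  define g where "g k s = Gk k (x1 + A 3 s / s ^ 2) (x2 + A 4 s / s ^ 2) y1 y2" for k s
  have sumA: "(\<Sum>k\<in>?S. pd1 (Wk k) (s*x1) (s*x2) (s*y1) (s*y2)) = A 1 s / s"
    "(\<Sum>k\<in>?S. pd2 (Wk k) (s*x1) (s*x2) (s*y1) (s*y2)) = A 2 s / s"
    "(\<Sum>k\<in>?S. pd3 (Wk k) (s*x1) (s*x2) (s*y1) (s*y2)) = A 3 s / s"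
    "(\<Sum>k\<in>?S. pd4 (Wk k) (s*x1) (s*x2) (s*y1) (s*y2)) = A 4 s / s" if "s \<noteq> 0" for s
    unfolding A_def sum_divide_distrib using that
    by (auto intro!: sum.cong simp: a_def field_simps hom_poly_pd_scale[OF W])
  have res: "bg_residual d v \<rho> Gk Wk (s*x1) (s*x2) (s*y1) (s*y2) =
      (\<Sum>k\<in>?S. s ^ k * c k) + ((A 1 s / s)\<^sup>2 + (A 2 s / s)\<^sup>2 - (A 3 s / s)\<^sup>2 - (A 4 s / s)\<^sup>2) / 2
      - (\<Sum>k\<in>?S. s ^ k * g k s)" if s: "s \<noteq> 0" for s
  proof -
    have "(\<Sum>k\<in>?S. s ^ k * c k) = (\<Sum>k\<in>?S. if k = d then s ^ d * pot d v x1 x2 else 0)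
       - (\<Sum>k\<in>?S. Dop (Wk k) (s*x1) (s*x2) (s*y1) (s*y2))"
      unfolding sum_subtractf[symmetric]
      by (intro sum.cong) (auto simp: c_def algebra_simps hom_poly_scale[OF hom_poly_Dop[OF W]])
    then have 1: "(\<Sum>k\<in>?S. s ^ k * c k) = pot d v (s*x1) (s*x2) - (\<Sum>k\<in>?S. Dop (Wk k) (s*x1) (s*x2) (s*y1) (s*y2))"
      using d by (simp add: pot_scale)
    have 2: "Gk k (s*x1 + A 3 s / s) (s*x2 + A 4 s / s) (s*y1) (s*y2) = s ^ k * g k s" if "k \<in> ?S" for k
    proof -
      have "s*x1 + A 3 s / s = s * (x1 + A 3 s / s ^ 2)" "s*x2 + A 4 s / s = s * (x2 + A 4 s / s ^ 2)"
        using s by (auto simp: field_simps power2_eq_square)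
      then show ?thesis unfolding g_def by (simp only: hom_poly_scale[OF G[OF that]])
    qed
    show ?thesis unfolding bg_residual_def sumA[OF s] using 1 2 by simp
  qed
  have a0: "a i j = 0" if "j \<in> ?S" "j < min d k0" for i j
    using W0[of j] that by (simp add: a_def pd0)
  have limc: "((\<lambda>s. (\<Sum>k\<in>?S. s ^ k * c k) / s ^ k0) \<longlongrightarrow> (if k0 \<in> ?S then c k0 else 0)) (at 0)"
  proof (rule power_sum_limit)
    show "c j = 0" if "j \<in> ?S" "j < k0" for j
      using W0[of j] Wd that by (cases "j = d") (auto simp: c_def Dop_const)
  qed auto
  \<comment> \<open>Degree 2 is outside the range of the sum, so the limit is 0: generating function
    terms start at degree 3.\<close>
  have "((\<lambda>s. A i s / s ^ 2) \<longlongrightarrow> (if 2 \<in> ?S then a i 2 else 0)) (at 0)" for i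
    unfolding A_def by (rule power_sum_limit) auto
  then have limA: "((\<lambda>s. A i s / s ^ 2) \<longlongrightarrow> 0) (at 0)" for i by simp
  have "((\<lambda>s. (\<Sum>k\<in>?S. s ^ k * g k s) / s ^ k0) \<longlongrightarrow> (if k0 \<in> ?S then Gk k0 (x1 + 0) (x2 + 0) y1 y2 else 0)) (at 0)"
  proof (rule power_sum_limit)
    show "g j s = 0" if "j \<in> ?S" "j < k0" for j s
      using G0[of j] that by (simp add: g_def)
    show "(g j \<longlongrightarrow> Gk j (x1 + 0) (x2 + 0) y1 y2) (at 0)" if "j \<in> ?S" for j
      unfolding g_def by (rule polyfun4_tendsto[OF hom_poly_polyfun4[OF G[OF that]]]) (rule tendsto_add[OF tendsto_const limA] tendsto_const)+
  qed auto
  then have limg: "((\<lambda>s. (\<Sum>k\<in>?S. s ^ k * g k s) / s ^ k0) \<longlongrightarrow> (if k0 \<in> ?S then Gk k0 x1 x2 y1 y2 else 0)) (at 0)"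
    unfolding add_0_right .
  have limq: "((\<lambda>s. (A i s / s)\<^sup>2 / s ^ k0) \<longlongrightarrow> (if k0 = 2 * d - 2 then (a i d)\<^sup>2 else 0)) (at 0)" for i
  proof -
    \<comment> \<open>The gradient sum starts with W_r at the earliest, so its squares start at
      degree 2 r - 2. This is at least k0, with equality only for k0 = 2 d - 2, where r = d.\<close>
    define r where "r = min d k0"
    have r: "2 * r - 2 \<ge> k0" "r \<ge> 3" "r \<in> ?S" using d k0 by (auto simp: r_def)
    have "((\<lambda>s. A i s / s ^ r) \<longlongrightarrow> (if r \<in> ?S then a i r else 0)) (at 0)"
      unfolding A_def by (rule power_sum_limit) (auto simp: a0 r_def)
    then have "((\<lambda>s. A i s / s ^ r) \<longlongrightarrow> a i r) (at 0)" unfolding if_P[OF r(3)] .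
    then have 1: "((\<lambda>s. (A i s / s ^ r)\<^sup>2 * s ^ (2 * r - 2 - k0)) \<longlongrightarrow> (a i r)\<^sup>2 * 0 ^ (2 * r - 2 - k0)) (at 0)"
      by (intro tendsto_intros)
    have 2: "(a i r)\<^sup>2 * 0 ^ (2 * r - 2 - k0) = (if k0 = 2 * d - 2 then (a i d)\<^sup>2 else 0)"
      using d k0 by (auto simp: r_def min_def power_0_left)
    have 3: "\<forall>\<^sub>F s in at 0. (A i s / s ^ r)\<^sup>2 * s ^ (2 * r - 2 - k0) = (A i s / s)\<^sup>2 / s ^ k0"
    proof -
      have "(A i s / s ^ r)\<^sup>2 * s ^ (2 * r - 2 - k0) = (A i s / s)\<^sup>2 / s ^ k0" if "s \<noteq> 0" for s
      proof -
        have *: "s ^ (2 * r) = s ^ (2 * r - 2 - k0) * s ^ 2 * s ^ k0"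
          unfolding power_add[symmetric] using r by (intro arg_cong[of _ _ "power s"]) simp
        have **: "(A i s / s ^ r)\<^sup>2 = (A i s)\<^sup>2 / (s ^ (2 * r - 2 - k0) * s ^ 2 * s ^ k0)"
          unfolding power_divide power_mult[symmetric] mult.commute[of r 2] * ..
        show ?thesis unfolding ** using that by (simp add: power_divide)
      qed
      then show ?thesis unfolding eventually_at_filter by (intro always_eventually) blast
    qed
    show ?thesis using Lim_transform_eventually[OF 1 3] unfolding 2 .
  qed
  have 1: "((\<lambda>s. (\<Sum>k\<in>?S. s ^ k * c k) / s ^ k0
      + ((A 1 s / s)\<^sup>2 / s ^ k0 + (A 2 s / s)\<^sup>2 / s ^ k0 - (A 3 s / s)\<^sup>2 / s ^ k0 - (A 4 s / s)\<^sup>2 / s ^ k0) / 2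
      - (\<Sum>k\<in>?S. s ^ k * g k s) / s ^ k0) \<longlongrightarrow> (if k0 \<in> ?S then c k0 else 0) +
        ((if k0 = 2 * d - 2 then (a 1 d)\<^sup>2 else 0) + (if k0 = 2 * d - 2 then (a 2 d)\<^sup>2 else 0)
       - (if k0 = 2 * d - 2 then (a 3 d)\<^sup>2 else 0) - (if k0 = 2 * d - 2 then (a 4 d)\<^sup>2 else 0)) / 2
       - (if k0 \<in> ?S then Gk k0 x1 x2 y1 y2 else 0)) (at 0)"
    by (intro tendsto_add tendsto_diff tendsto_divide tendsto_const limc limq limg) simp
  have 2: "\<forall>\<^sub>F s in at 0. (\<Sum>k\<in>?S. s ^ k * c k) / s ^ k0
      + ((A 1 s / s)\<^sup>2 / s ^ k0 + (A 2 s / s)\<^sup>2 / s ^ k0 - (A 3 s / s)\<^sup>2 / s ^ k0 - (A 4 s / s)\<^sup>2 / s ^ k0) / 2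
      - (\<Sum>k\<in>?S. s ^ k * g k s) / s ^ k0 = bg_residual d v \<rho> Gk Wk (s*x1) (s*x2) (s*y1) (s*y2) / s ^ k0"
    unfolding eventually_at_filter
    by (intro always_eventually allI impI) (simp add: res add_divide_distrib diff_divide_distrib)
  have 3: "(if k0 \<in> ?S then c k0 else 0) +
        ((if k0 = 2 * d - 2 then (a 1 d)\<^sup>2 else 0) + (if k0 = 2 * d - 2 then (a 2 d)\<^sup>2 else 0)
       - (if k0 = 2 * d - 2 then (a 3 d)\<^sup>2 else 0) - (if k0 = 2 * d - 2 then (a 4 d)\<^sup>2 else 0)) / 2
       - (if k0 \<in> ?S then Gk k0 x1 x2 y1 y2 else 0) =
     (if k0 = d then pot d v x1 x2 else 0) + (if k0 = 2 * d - 2 then quad_bracket (Wk d) x1 x2 y1 y2 else 0)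
     - Dop (Wk k0) x1 x2 y1 y2 - Gk k0 x1 x2 y1 y2"
    using k0 by (auto simp: c_def a_def quad_bracket_def)
  show ?thesis using Lim_transform_eventually[OF 1 2] unfolding 3 .
qed

lemma no_terms_upto_mono: "no_terms_upto r F \<Longrightarrow> k \<le> r \<Longrightarrow> no_terms_upto k F"
  unfolding no_terms_upto_mono4 by (elim exE conjE, intro exI conjI, assumption) auto

text \<open>The case s = 0 follows by continuity; this serves scaling identities obtained after
  division by a power of s.\<close>

lemma hom_poly_nonzeroI:
  assumes "polyfun4 F" "\<And>s x1 x2 y1 y2. s \<noteq> 0 \<Longrightarrow> F (s*x1) (s*x2) (s*y1) (s*y2) = s ^ k * F x1 x2 y1 y2"
  shows "hom_poly k F"
proof -
  have "F 0 0 0 0 = 0 ^ k * F x1 x2 y1 y2" for x1 x2 y1 y2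
  proof -
    have 1: "((\<lambda>s. F (s*x1) (s*x2) (s*y1) (s*y2)) \<longlongrightarrow> F (0*x1) (0*x2) (0*y1) (0*y2)) (at 0)"
      by (rule polyfun4_tendsto[OF assms(1)]) (intro tendsto_mult tendsto_const tendsto_ident_at)+
    have 2: "((\<lambda>s. s ^ k * F x1 x2 y1 y2) \<longlongrightarrow> 0 ^ k * F x1 x2 y1 y2) (at 0)"
      by (intro tendsto_mult tendsto_const tendsto_power tendsto_ident_at)
    have 3: "\<forall>\<^sub>F s in at 0. s ^ k * F x1 x2 y1 y2 = F (s*x1) (s*x2) (s*y1) (s*y2)"
      unfolding eventually_at_filter by (intro always_eventually) (simp add: assms(2))
    show ?thesis using tendsto_unique[OF _ 1 Lim_transform_eventually[OF 2 3]] by simp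
  qed
  then have "F (s*x1) (s*x2) (s*y1) (s*y2) = s ^ k * F x1 x2 y1 y2" for s x1 x2 y1 y2
    using assms(2)[of s] by (cases "s = 0") auto
  then show ?thesis using assms(1) by (simp add: hom_poly_iff)
qed

lemma polyfun4_quad_bracket: "polyfun4 W \<Longrightarrow> polyfun4 (quad_bracket W)"
  unfolding quad_bracket_def
  by (intro polyfun4_divide polyfun4_diff polyfun4_add polyfun4_power polyfun4_pd)

lemma hom_poly_quad_bracket:
  assumes "hom_poly k W" "1 \<le> k"
  shows "hom_poly (2 * k - 2) (quad_bracket W)"
proof (rule hom_poly_nonzeroI)
  show "polyfun4 (quad_bracket W)"
    using assms by (intro polyfun4_quad_bracket hom_poly_polyfun4)
next
  fix s x1 x2 y1 y2 :: real assume s: "s \<noteq> 0"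
  have "s ^ 2 * quad_bracket W (s*x1) (s*x2) (s*y1) (s*y2)
     = ((s * pd1 W (s*x1) (s*x2) (s*y1) (s*y2))\<^sup>2 + (s * pd2 W (s*x1) (s*x2) (s*y1) (s*y2))\<^sup>2
      - (s * pd3 W (s*x1) (s*x2) (s*y1) (s*y2))\<^sup>2 - (s * pd4 W (s*x1) (s*x2) (s*y1) (s*y2))\<^sup>2) / 2"
    by (simp add: quad_bracket_def power_mult_distrib algebra_simps)
  also have "\<dots> = (s ^ k)\<^sup>2 * quad_bracket W x1 x2 y1 y2"
    unfolding hom_poly_pd_scale[OF assms(1)] by (simp add: quad_bracket_def power_mult_distrib algebra_simps)
  also have "(s ^ k)\<^sup>2 = s ^ 2 * s ^ (2 * k - 2)"
    unfolding power_add[symmetric] power_mult[symmetric] using assms(2)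
    by (intro arg_cong[of _ _ "power s"]) simp
  finally show "quad_bracket W (s*x1) (s*x2) (s*y1) (s*y2) = s ^ (2 * k - 2) * quad_bracket W x1 x2 y1 y2"
    using s by simp
qed

lemma in_image_D_hom_poly: "in_image_D k W \<Longrightarrow> hom_poly k W"
  by (auto simp: in_image_D_def intro: hom_poly_Dop)

lemma in_ker_D_hom_poly: "in_ker_D k G \<Longrightarrow> hom_poly k G"
  by (auto simp: in_ker_D_def)

lemma in_ker_D_zero: "in_ker_D k (\<lambda>_ _ _ _. 0)"
  by (auto simp: in_ker_D_def hom_poly_zero Dop_const)

lemma in_image_D_zero: "in_image_D k (\<lambda>_ _ _ _. 0)"
  unfolding in_image_D_def by (intro exI[of _ "\<lambda>_ _ _ _. 0"]) (simp add: Dop_const hom_poly_zero)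

text \<open>From D W = -G one gets D^2 W = 0, hence D W = 0 and G = 0. Since W = D U, the same
  argument applied to U gives W = 0.\<close>

lemma homological_equation_zero:
  assumes G: "in_ker_D k G" and W: "in_image_D k W"
    and eq: "\<And>x1 x2 y1 y2. Dop W x1 x2 y1 y2 + G x1 x2 y1 y2 = 0"
  shows "G = (\<lambda>_ _ _ _. 0)" "W = (\<lambda>_ _ _ _. 0)"
proof -
  have pG: "polyfun4 G" "Dop G = (\<lambda>_ _ _ _. 0)" using G hom_poly_polyfun4 by (auto simp: in_ker_D_def)
  obtain U where U: "hom_poly k U" "W = Dop U" using W unfolding in_image_D_def by blast
  have pW: "polyfun4 W" using in_image_D_hom_poly[OF W] by (rule hom_poly_polyfun4)
  have "Dop W = (\<lambda>x1 x2 y1 y2. - G x1 x2 y1 y2)"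
    by (intro ext) (simp add: eq_neg_iff_add_eq_0 eq)
  then have "Dop (Dop W) = (\<lambda>_ _ _ _. 0)"
    using Dop_uminus[OF pG(1)] pG(2) by simp
  then have DW: "Dop W = (\<lambda>_ _ _ _. 0)" by (rule ker_inter_image_Dop[OF pW])
  show "G = (\<lambda>_ _ _ _. 0)" using eq by (intro ext) (simp add: DW)
  show "W = (\<lambda>_ _ _ _. 0)" using ker_inter_image_Dop[OF hom_poly_polyfun4[OF U(1)]] DW U(2) by simp
qed

section \<open>Extracting and solving the homological equations\<close>

definition with_oscillator :: "fun4 \<Rightarrow> fun4" where
  "with_oscillator G = (\<lambda>\<xi>1 \<xi>2 \<eta>1 \<eta>2. (\<eta>1\<^sup>2 + \<xi>1\<^sup>2 + \<eta>2\<^sup>2 + \<xi>2\<^sup>2) / 2 + G \<xi>1 \<xi>2 \<eta>1 \<eta>2)"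

lemma with_oscillator_inject: "with_oscillator G = with_oscillator G' \<longleftrightarrow> G = G'"
  by (auto simp: with_oscillator_def fun_eq_iff)

lemma BGNF_equations:
  assumes ker: "\<And>k. k \<in> {3..\<rho>} \<Longrightarrow> in_ker_D k (Gk k)" and im: "\<And>k. k \<in> {3..\<rho>} \<Longrightarrow> in_image_D k (Wk k)"
    and res: "no_terms_upto \<rho> (bg_residual d v \<rho> Gk Wk)"
    and d: "3 \<le> d" "d \<le> \<rho>" and k0: "3 \<le> k0" "k0 \<le> \<rho>" "k0 \<le> 2 * d - 2"
    and G0: "\<And>j. j \<in> {3..<k0} \<Longrightarrow> Gk j = (\<lambda>_ _ _ _. 0)"
    and W0: "\<And>j. j \<in> {3..<k0} \<Longrightarrow> j \<noteq> d \<Longrightarrow> Wk j = (\<lambda>_ _ _ _. 0)"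
    and Wd: "d < k0 \<Longrightarrow> Dop (Wk d) = (\<lambda>x1 x2 y1 y2. pot d v x1 x2)"
  shows "(if k0 = d then pot d v x1 x2 else 0) + (if k0 = 2 * d - 2 then quad_bracket (Wk d) x1 x2 y1 y2 else 0)
     = Dop (Wk k0) x1 x2 y1 y2 + Gk k0 x1 x2 y1 y2"
proof -
  have "((\<lambda>s. bg_residual d v \<rho> Gk Wk (s*x1) (s*x2) (s*y1) (s*y2) / s ^ k0) \<longlongrightarrow> 0) (at 0)"
    using no_terms_upto_mono[OF res k0(2)] unfolding no_terms_upto_iff by blast
  from tendsto_unique[OF _ this bg_residual_limit[OF in_ker_D_hom_poly[OF ker] in_image_D_hom_poly[OF im] d k0 G0 W0 Wd]]
  show ?thesis by simp
qed

text \<open>Below degree 2 d - 2 every equation other than the one in degree d is homogeneous and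
  has only the zero solution. In degree d the kernel part vanishes by oddness, which leaves D W_d =
  V. The first possible normal form term is in degree 2 d - 2.\<close>

lemma BGNF_odd_PHO:
  assumes "odd d" "3 \<le> d" "is_BGNF (PHO d v) (2 * d - 2) G"
  obtains W T Gr where "hom_poly d W" "Dop W = (\<lambda>x1 x2 y1 y2. pot d v x1 x2)"
    "hom_poly (2 * d - 2) T" "G = with_oscillator Gr"
    "quad_bracket W = (\<lambda>x1 x2 y1 y2. Dop T x1 x2 y1 y2 + Gr x1 x2 y1 y2)"
proof -
  let ?r = "2 * d - 2"
  obtain Gk Wk where ker: "\<And>k. k \<in> {3..?r} \<Longrightarrow> in_ker_D k (Gk k)"
    and im: "\<And>k. k \<in> {3..?r} \<Longrightarrow> in_image_D k (Wk k)"
    and G: "G = with_oscillator (\<lambda>\<xi>1 \<xi>2 \<eta>1 \<eta>2. \<Sum>k=3..?r. Gk k \<xi>1 \<xi>2 \<eta>1 \<eta>2)"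
    and res: "no_terms_upto ?r (bg_residual d v ?r Gk Wk)"
    using assms(3) unfolding is_BGNF_iff with_oscillator_def by blast
  have d: "3 \<le> d" "d \<le> ?r" "d < ?r" using assms(2) by auto
  have low: "Gk j = (\<lambda>_ _ _ _. 0) \<and> (j \<noteq> d \<longrightarrow> Wk j = (\<lambda>_ _ _ _. 0))
      \<and> (j = d \<longrightarrow> Dop (Wk d) = (\<lambda>x1 x2 y1 y2. pot d v x1 x2))" if "3 \<le> j" "j < ?r" for j
    using that
  proof (induction j rule: less_induct)
    case (less j)
    have eq: "(if j = d then pot d v x1 x2 else 0) + (if j = ?r then quad_bracket (Wk d) x1 x2 y1 y2 else 0)
     = Dop (Wk j) x1 x2 y1 y2 + Gk j x1 x2 y1 y2" for x1 x2 y1 y2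
      using less d by (intro BGNF_equations[OF ker im res]) auto
    have j: "j \<in> {3..?r}" using less by auto
    show ?case
    proof (cases "j = d")
      case True
      have G0: "Gk d = (\<lambda>_ _ _ _. 0)" using in_ker_D_odd_zero[OF ker[OF j]] assms(1) True by simp
      moreover have "Dop (Wk d) = (\<lambda>x1 x2 y1 y2. pot d v x1 x2)"
        using eq d unfolding True G0 by (intro ext) simp
      ultimately show ?thesis using True by simp
    next
      case False
      have "Dop (Wk j) x1 x2 y1 y2 + Gk j x1 x2 y1 y2 = 0" for x1 x2 y1 y2
        using eq[of x1 x2 y1 y2] False less.prems by simp
      from homological_equation_zero[OF ker[OF j] im[OF j] this] show ?thesis using False by simp
    qed
  qed
  have eq: "quad_bracket (Wk d) x1 x2 y1 y2 = Dop (Wk ?r) x1 x2 y1 y2 + Gk ?r x1 x2 y1 y2" for x1 x2 y1 y2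
  proof -
    have "(if ?r = d then pot d v x1 x2 else 0) + (if ?r = ?r then quad_bracket (Wk d) x1 x2 y1 y2 else 0)
     = Dop (Wk ?r) x1 x2 y1 y2 + Gk ?r x1 x2 y1 y2"
      by (rule BGNF_equations[OF ker im res]) (use low d in auto)
    then show ?thesis using d by simp
  qed
  have "(\<Sum>k=3..?r. Gk k x1 x2 y1 y2) = Gk ?r x1 x2 y1 y2" for x1 x2 y1 y2
  proof -
    have "(\<Sum>k=3..?r. Gk k x1 x2 y1 y2) = (\<Sum>k\<in>{?r}. Gk k x1 x2 y1 y2)"
      using low d by (intro sum.mono_neutral_right) auto
    then show ?thesis by simp
  qed
  then have G': "G = with_oscillator (Gk ?r)" unfolding G by simp
  show ?thesis
  proof (rule that[OF _ _ _ G'])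
    show "hom_poly d (Wk d)" "hom_poly ?r (Wk ?r)" using d by (auto intro!: in_image_D_hom_poly im)
    show "Dop (Wk d) = (\<lambda>x1 x2 y1 y2. pot d v x1 x2)" using low[of d] d by simp
  qed (use eq in blast)
qed

text \<open>Here the potential sits in the last degree considered, and d < 2 d - 2 keeps the bracket
  out. It is applied to the even potential, whose degree is called d in this lemma.\<close>

lemma BGNF_top_PHO:
  assumes "3 \<le> d" "is_BGNF (PHO d v) d G"
  obtains T Gr where "hom_poly d T" "G = with_oscillator Gr"
    "(\<lambda>x1 x2 y1 y2. pot d v x1 x2) = (\<lambda>x1 x2 y1 y2. Dop T x1 x2 y1 y2 + Gr x1 x2 y1 y2)"
proof -
  obtain Gk Wk where ker: "\<And>k. k \<in> {3..d} \<Longrightarrow> in_ker_D k (Gk k)"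
    and im: "\<And>k. k \<in> {3..d} \<Longrightarrow> in_image_D k (Wk k)"
    and G: "G = with_oscillator (\<lambda>\<xi>1 \<xi>2 \<eta>1 \<eta>2. \<Sum>k=3..d. Gk k \<xi>1 \<xi>2 \<eta>1 \<eta>2)"
    and res: "no_terms_upto d (bg_residual d v d Gk Wk)"
    using assms(2) unfolding is_BGNF_iff with_oscillator_def by blast
  have low: "Gk j = (\<lambda>_ _ _ _. 0) \<and> Wk j = (\<lambda>_ _ _ _. 0)" if "3 \<le> j" "j < d" for j
    using that
  proof (induction j rule: less_induct)
    case (less j)
    have eq: "(if j = d then pot d v x1 x2 else 0) + (if j = 2 * d - 2 then quad_bracket (Wk d) x1 x2 y1 y2 else 0)
     = Dop (Wk j) x1 x2 y1 y2 + Gk j x1 x2 y1 y2" for x1 x2 y1 y2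
      using less by (intro BGNF_equations[OF ker im res]) auto
    have j: "j \<in> {3..d}" using less by auto
    have "Dop (Wk j) x1 x2 y1 y2 + Gk j x1 x2 y1 y2 = 0" for x1 x2 y1 y2
      using eq[of x1 x2 y1 y2] less.prems by (auto split: if_splits)
    from homological_equation_zero[OF ker[OF j] im[OF j] this] show ?case by simp
  qed
  have eq: "pot d v x1 x2 = Dop (Wk d) x1 x2 y1 y2 + Gk d x1 x2 y1 y2" for x1 x2 y1 y2
  proof -
    have "(if d = d then pot d v x1 x2 else 0) + (if d = 2 * d - 2 then quad_bracket (Wk d) x1 x2 y1 y2 else 0)
     = Dop (Wk d) x1 x2 y1 y2 + Gk d x1 x2 y1 y2"
      by (rule BGNF_equations[OF ker im res]) (use low assms(1) in auto)
    then show ?thesis using assms(1) by (auto split: if_splits)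
  qed
  have "(\<Sum>k=3..d. Gk k x1 x2 y1 y2) = Gk d x1 x2 y1 y2" for x1 x2 y1 y2
  proof -
    have "(\<Sum>k=3..d. Gk k x1 x2 y1 y2) = (\<Sum>k\<in>{d}. Gk k x1 x2 y1 y2)"
      using low assms(1) by (intro sum.mono_neutral_right) auto
    then show ?thesis by simp
  qed
  then have G': "G = with_oscillator (Gk d)" unfolding G by simp
  show ?thesis
  proof (rule that[OF _ G'])
    show "hom_poly d (Wk d)" using assms(1) by (auto intro!: in_image_D_hom_poly im)
  qed (use eq in blast)
qed

lemma is_BGNF_odd_PHO:
  assumes d: "3 \<le> d" and W: "in_image_D d W" "Dop W = (\<lambda>x1 x2 y1 y2. pot d v x1 x2)"
    and T: "in_image_D (2 * d - 2) T" and Gr: "in_ker_D (2 * d - 2) Gr"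
    and eq: "quad_bracket W = (\<lambda>x1 x2 y1 y2. Dop T x1 x2 y1 y2 + Gr x1 x2 y1 y2)"
  shows "is_BGNF (PHO d v) (2 * d - 2) (with_oscillator Gr)"
proof -
  let ?r = "2 * d - 2"
  define Gk where "Gk k = (if k = ?r then Gr else (\<lambda>_ _ _ _. 0))" for k
  define Wk where "Wk k = (if k = d then W else if k = ?r then T else (\<lambda>_ _ _ _. 0))" for k
  have ne: "d \<noteq> ?r" using d by simp
  have ker: "in_ker_D k (Gk k)" for k using Gr by (auto simp: Gk_def in_ker_D_zero)
  have im: "in_image_D k (Wk k)" for k using W T by (auto simp: Wk_def in_image_D_zero)
  have G: "with_oscillator Gr = with_oscillator (\<lambda>\<xi>1 \<xi>2 \<eta>1 \<eta>2. \<Sum>k=3..?r. Gk k \<xi>1 \<xi>2 \<eta>1 \<eta>2)"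
  proof -
    have "(\<Sum>k=3..?r. Gk k x1 x2 y1 y2) = (\<Sum>k=3..?r. if k = ?r then Gr x1 x2 y1 y2 else 0)" for x1 x2 y1 y2
      by (intro sum.cong) (auto simp: Gk_def)
    moreover have "3 \<le> ?r" using d by simp
    ultimately show ?thesis by simp
  qed
  have "no_terms_upto ?r (bg_residual d v ?r Gk Wk)"
    unfolding no_terms_upto_iff
  proof (intro conjI allI)
    show "polyfun4 (bg_residual d v ?r Gk Wk)"
      using ker im by (intro polyfun4_bg_residual) (auto intro: hom_poly_polyfun4 in_ker_D_hom_poly in_image_D_hom_poly)
    fix x1 x2 y1 y2
    have "((\<lambda>s. bg_residual d v ?r Gk Wk (s*x1) (s*x2) (s*y1) (s*y2) / s ^ ?r) \<longlongrightarrow>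
     (if ?r = d then pot d v x1 x2 else 0) + (if ?r = ?r then quad_bracket (Wk d) x1 x2 y1 y2 else 0)
     - Dop (Wk ?r) x1 x2 y1 y2 - Gk ?r x1 x2 y1 y2) (at 0)"
      by (rule bg_residual_limit[OF in_ker_D_hom_poly[OF ker] in_image_D_hom_poly[OF im]])
         (use d W(2) in \<open>auto simp: Gk_def Wk_def\<close>)
    moreover have e: "(if ?r = d then pot d v x1 x2 else 0) + (if ?r = ?r then quad_bracket (Wk d) x1 x2 y1 y2 else 0)
     - Dop (Wk ?r) x1 x2 y1 y2 - Gk ?r x1 x2 y1 y2 = 0"
      using ne by (simp add: Gk_def Wk_def eq)
    ultimately show "((\<lambda>s. bg_residual d v ?r Gk Wk (s*x1) (s*x2) (s*y1) (s*y2) / s ^ ?r) \<longlongrightarrow> 0) (at 0)"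
      unfolding e by blast
  qed
  then show ?thesis unfolding is_BGNF_iff using ker im G[unfolded with_oscillator_def]
    by (intro exI[of _ Gk] exI[of _ Wk]) (simp add: with_oscillator_def)
qed

lemma is_BGNF_top_PHO:
  assumes d: "3 \<le> d" and T: "in_image_D d T" and Gr: "in_ker_D d Gr"
    and eq: "(\<lambda>x1 x2 y1 y2. pot d v x1 x2) = (\<lambda>x1 x2 y1 y2. Dop T x1 x2 y1 y2 + Gr x1 x2 y1 y2)"
  shows "is_BGNF (PHO d v) d (with_oscillator Gr)"
proof -
  define Gk where "Gk k = (if k = d then Gr else (\<lambda>_ _ _ _. 0))" for k
  define Wk where "Wk k = (if k = d then T else (\<lambda>_ _ _ _. 0))" for k
  have ne: "d \<noteq> 2 * d - 2" using d by simp
  have ker: "in_ker_D k (Gk k)" for k using Gr by (auto simp: Gk_def in_ker_D_zero)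
  have im: "in_image_D k (Wk k)" for k using T by (auto simp: Wk_def in_image_D_zero)
  have G: "with_oscillator Gr = with_oscillator (\<lambda>\<xi>1 \<xi>2 \<eta>1 \<eta>2. \<Sum>k=3..d. Gk k \<xi>1 \<xi>2 \<eta>1 \<eta>2)"
  proof -
    have "(\<Sum>k=3..d. Gk k x1 x2 y1 y2) = (\<Sum>k=3..d. if k = d then Gr x1 x2 y1 y2 else 0)" for x1 x2 y1 y2
      by (intro sum.cong) (auto simp: Gk_def)
    then show ?thesis using d by simp
  qed
  have "no_terms_upto d (bg_residual d v d Gk Wk)"
    unfolding no_terms_upto_iff
  proof (intro conjI allI)
    show "polyfun4 (bg_residual d v d Gk Wk)"
      using ker im by (intro polyfun4_bg_residual) (auto intro: hom_poly_polyfun4 in_ker_D_hom_poly in_image_D_hom_poly)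
    fix x1 x2 y1 y2
    have "((\<lambda>s. bg_residual d v d Gk Wk (s*x1) (s*x2) (s*y1) (s*y2) / s ^ d) \<longlongrightarrow>
     (if d = d then pot d v x1 x2 else 0) + (if d = 2 * d - 2 then quad_bracket (Wk d) x1 x2 y1 y2 else 0)
     - Dop (Wk d) x1 x2 y1 y2 - Gk d x1 x2 y1 y2) (at 0)"
      by (rule bg_residual_limit[OF in_ker_D_hom_poly[OF ker] in_image_D_hom_poly[OF im]])
         (use d in \<open>auto simp: Gk_def Wk_def\<close>)
    moreover have e: "(if d = d then pot d v x1 x2 else 0) + (if d = 2 * d - 2 then quad_bracket (Wk d) x1 x2 y1 y2 else 0)
     - Dop (Wk d) x1 x2 y1 y2 - Gk d x1 x2 y1 y2 = 0"
      using ne eq[THEN fun_cong, THEN fun_cong, THEN fun_cong, THEN fun_cong, of x1 x2 y1 y2]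
      by (simp add: Gk_def Wk_def)
    ultimately show "((\<lambda>s. bg_residual d v d Gk Wk (s*x1) (s*x2) (s*y1) (s*y2) / s ^ d) \<longlongrightarrow> 0) (at 0)"
      unfolding e by blast
  qed
  then show ?thesis unfolding is_BGNF_iff using ker im G[unfolded with_oscillator_def]
    by (intro exI[of _ Gk] exI[of _ Wk]) (simp add: with_oscillator_def)
qed

section \<open>Sharing a normal form as a condition on orbit averages\<close>

lemma Dop_inj_odd:
  assumes "odd k" "hom_poly k F" "hom_poly k G" "Dop F = Dop G"
  shows "F = G"
proof -
  have "in_ker_D k (\<lambda>x1 x2 y1 y2. F x1 x2 y1 y2 - G x1 x2 y1 y2)"
    unfolding in_ker_D_def using assms by (simp add: hom_poly_diff Dop_diff[OF hom_poly_polyfun4 hom_poly_polyfun4])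
  from in_ker_D_odd_zero[OF this assms(1)] show ?thesis by (simp add: fun_eq_iff)
qed

lemma on_flow_diff_add:
  "on_flow (\<lambda>x1 x2 y1 y2. F x1 x2 y1 y2 - G x1 x2 y1 y2) t x1 x2 y1 y2
    = on_flow F t x1 x2 y1 y2 - on_flow G t x1 x2 y1 y2"
  "on_flow (\<lambda>x1 x2 y1 y2. F x1 x2 y1 y2 + G x1 x2 y1 y2) t x1 x2 y1 y2
    = on_flow F t x1 x2 y1 y2 + on_flow G t x1 x2 y1 y2"
  by (simp_all add: on_flow_def)

text \<open>Any homogeneous solution W of D W = V may be supplied, since in odd degree it agrees
  with the term W_d of the generating function. A common normal form makes the difference of bracket
  and potential an element of the image of D; conversely, the mean of that difference is 2 pi times
  its kernel part.\<close>

theorem share_BGNF_iff_average: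
  assumes d: "odd d" "3 \<le> d" and W: "hom_poly d W" "Dop W = (\<lambda>x1 x2 y1 y2. pot d v x1 x2)"
  shows "share_BGNF (PHO d v) (PHO (2 * d - 2) w) (2 * d - 2) \<longleftrightarrow>
    (\<forall>x1 x2 y1 y2. ((\<lambda>t. on_flow (\<lambda>x1 x2 y1 y2. quad_bracket W x1 x2 y1 y2 - pot (2 * d - 2) w x1 x2) t x1 x2 y1 y2)
        has_integral 0) {0..2*pi})"
    (is "?L \<longleftrightarrow> (\<forall>x1 x2 y1 y2. (?I x1 x2 y1 y2 has_integral 0) {0..2*pi})")
proof -
  let ?r = "2 * d - 2"
  let ?V = "\<lambda>x1 x2 y1 y2::real. pot ?r w x1 x2"
  let ?QV = "\<lambda>x1 x2 y1 y2. quad_bracket W x1 x2 y1 y2 - pot ?r w x1 x2"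
  have r: "3 \<le> ?r" using d by simp
  show ?thesis
  proof
    assume ?L
    then obtain G where G: "is_BGNF (PHO d v) ?r G" "is_BGNF (PHO ?r w) ?r G" unfolding share_BGNF_def by blast
    obtain W' T Gr where 1: "hom_poly d W'" "Dop W' = (\<lambda>x1 x2 y1 y2. pot d v x1 x2)"
      "hom_poly ?r T" "G = with_oscillator Gr"
      "quad_bracket W' = (\<lambda>x1 x2 y1 y2. Dop T x1 x2 y1 y2 + Gr x1 x2 y1 y2)"
      by (rule BGNF_odd_PHO[OF d G(1)])
    obtain T' Gr' where 2: "hom_poly ?r T'" "G = with_oscillator Gr'"
      "?V = (\<lambda>x1 x2 y1 y2. Dop T' x1 x2 y1 y2 + Gr' x1 x2 y1 y2)"
      by (rule BGNF_top_PHO[OF r G(2)])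
    have WW: "W' = W" using Dop_inj_odd[OF d(1) 1(1) W(1)] 1(2) W(2) by simp
    have GG: "Gr' = Gr" using 1(4) 2(2) by (simp add: with_oscillator_inject)
    have p: "polyfun4 T" "polyfun4 T'" using 1 2 by (auto intro: hom_poly_polyfun4)
    have "?QV = Dop (\<lambda>x1 x2 y1 y2. T x1 x2 y1 y2 - T' x1 x2 y1 y2)"
    proof (intro ext)
      fix x1 x2 y1 y2
      show "?QV x1 x2 y1 y2 = Dop (\<lambda>x1 x2 y1 y2. T x1 x2 y1 y2 - T' x1 x2 y1 y2) x1 x2 y1 y2"
        using 1(5)[THEN fun_cong, THEN fun_cong, THEN fun_cong, THEN fun_cong, of x1 x2 y1 y2]
          2(3)[THEN fun_cong, THEN fun_cong, THEN fun_cong, THEN fun_cong, of x1 x2 y1 y2]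
        unfolding Dop_diff[OF p] WW GG by simp
    qed
    then show "\<forall>x1 x2 y1 y2. (?I x1 x2 y1 y2 has_integral 0) {0..2*pi}"
      using on_flow_integral_Dop[OF polyfun4_diff[OF p]] by simp
  next
    assume int: "\<forall>x1 x2 y1 y2. (?I x1 x2 y1 y2 has_integral 0) {0..2*pi}"
    \<comment> \<open>W is only known to solve D W = V. Splitting V, which has no kernel part in odd
      degree, gives D W = D (D U0), and injectivity of D identifies W with D U0.\<close>
    have "in_image_D d W"
    proof -
      obtain G0 U0 where 0: "hom_poly d G0" "hom_poly d U0" "Dop G0 = (\<lambda>_ _ _ _. 0)"
        "(\<lambda>x1 x2 y1 y2. pot d v x1 x2) = (\<lambda>x1 x2 y1 y2. G0 x1 x2 y1 y2 + Dop (Dop U0) x1 x2 y1 y2)"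
        by (rule kernel_image_split[OF hom_poly_pot])
      have "G0 = (\<lambda>_ _ _ _. 0)" using in_ker_D_odd_zero[OF _ d(1)] 0 by (simp add: in_ker_D_def)
      then have "Dop W = Dop (Dop U0)" using 0(4) W(2) by simp
      then have "W = Dop U0" by (rule Dop_inj_odd[OF d(1) W(1) hom_poly_Dop[OF 0(2)]])
      then show ?thesis using 0(2) unfolding in_image_D_def by blast
    qed
    have hQ: "hom_poly ?r (quad_bracket W)" using W(1) d by (intro hom_poly_quad_bracket) auto
    have hQV: "hom_poly ?r ?QV" by (intro hom_poly_diff hQ hom_poly_pot)
    obtain G1 U1 where 1: "hom_poly ?r G1" "hom_poly ?r U1" "Dop G1 = (\<lambda>_ _ _ _. 0)"
      "?QV = (\<lambda>x1 x2 y1 y2. G1 x1 x2 y1 y2 + Dop (Dop U1) x1 x2 y1 y2)"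
      by (rule kernel_image_split[OF hQV])
    \<comment> \<open>The kernel part G2 of the even potential will be the common normal form
      term.\<close>
    obtain G2 U2 where 2: "hom_poly ?r G2" "hom_poly ?r U2" "Dop G2 = (\<lambda>_ _ _ _. 0)"
      "?V = (\<lambda>x1 x2 y1 y2. G2 x1 x2 y1 y2 + Dop (Dop U2) x1 x2 y1 y2)"
      by (rule kernel_image_split[OF hom_poly_pot])
    note p = 1(1,2)[THEN hom_poly_polyfun4] 2(1,2)[THEN hom_poly_polyfun4]
    have G1: "G1 x1 x2 y1 y2 = 0" for x1 x2 y1 y2
    proof -
      have "((\<lambda>t. on_flow ?QV t x1 x2 y1 y2 - on_flow (Dop (Dop U1)) t x1 x2 y1 y2) has_integral (0 - 0)) {0..2*pi}"
        using int by (intro has_integral_diff on_flow_integral_Dop polyfun4_Dop p) auto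
      moreover have "on_flow ?QV t x1 x2 y1 y2 - on_flow (Dop (Dop U1)) t x1 x2 y1 y2 = G1 x1 x2 y1 y2" for t
        unfolding 1(4) using on_flow_ker[OF p(1) 1(3)] by (simp add: on_flow_diff_add)
      ultimately have "((\<lambda>t::real. G1 x1 x2 y1 y2) has_integral 0) {0..2*pi}" by simp
      moreover have "((\<lambda>t::real. G1 x1 x2 y1 y2) has_integral (2*pi) * G1 x1 x2 y1 y2) {0..2*pi}"
        using has_integral_const_real[of "G1 x1 x2 y1 y2" 0 "2*pi"] by simp
      ultimately have "(2*pi) * G1 x1 x2 y1 y2 = 0" by (rule has_integral_unique[rotated])
      then show ?thesis by simp
    qed
    let ?U = "\<lambda>x1 x2 y1 y2. U1 x1 x2 y1 y2 + U2 x1 x2 y1 y2"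
    have "quad_bracket W = (\<lambda>x1 x2 y1 y2. Dop (Dop ?U) x1 x2 y1 y2 + G2 x1 x2 y1 y2)"
    proof (intro ext)
      fix x1 x2 y1 y2
      show "quad_bracket W x1 x2 y1 y2 = Dop (Dop ?U) x1 x2 y1 y2 + G2 x1 x2 y1 y2"
        using 1(4)[THEN fun_cong, THEN fun_cong, THEN fun_cong, THEN fun_cong, of x1 x2 y1 y2]
          2(4)[THEN fun_cong, THEN fun_cong, THEN fun_cong, THEN fun_cong, of x1 x2 y1 y2]
        unfolding Dop_add[OF p(2,4)] Dop_add[OF polyfun4_Dop[OF p(2)] polyfun4_Dop[OF p(4)]] G1 by simp
    qed
    moreover have "in_image_D ?r (Dop ?U)" unfolding in_image_D_def using hom_poly_add[OF 1(2) 2(2)] by blast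
    moreover have ker: "in_ker_D ?r G2" using 2 by (simp add: in_ker_D_def)
    ultimately have a: "is_BGNF (PHO d v) ?r (with_oscillator G2)"
      using is_BGNF_odd_PHO[OF d(2) \<open>in_image_D d W\<close> W(2)] by blast
    have b: "is_BGNF (PHO ?r w) ?r (with_oscillator G2)"
    proof (rule is_BGNF_top_PHO[OF r _ ker])
      show "in_image_D ?r (Dop U2)" unfolding in_image_D_def using 2(2) by blast
      show "?V = (\<lambda>x1 x2 y1 y2. Dop (Dop U2) x1 x2 y1 y2 + G2 x1 x2 y1 y2)"
        unfolding 2(4) by (simp add: add.commute)
    qed
    show ?L unfolding share_BGNF_def using a b by blast
  qed
qed

subsection \<open>One degree of freedom\<close>

text \<open>For n = 2 h, B_h solves (D^2 + 1) B_h = X^n and A_h = D B_h, where D is the rotation field of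
  the (X, Y) plane; consequently W = X A_h + Y B_h solves D W = X^(n+1) and has gradient
  (n + 1) (A_h, B_h).\<close>

fun oscB :: "nat \<Rightarrow> real \<Rightarrow> real \<Rightarrow> real" where
  "oscB 0 X Y = 1"
| "oscB (Suc h) X Y = (2 * real (Suc h) * (2 * real (Suc h) - 1) * (X\<^sup>2 + Y\<^sup>2) * oscB h X Y - X ^ (2 * Suc h))
     / (4 * (real (Suc h))\<^sup>2 - 1)"

fun oscA :: "nat \<Rightarrow> real \<Rightarrow> real \<Rightarrow> real" where
  "oscA 0 X Y = 0"
| "oscA (Suc h) X Y = (2 * real (Suc h) * (2 * real (Suc h) - 1) * (X\<^sup>2 + Y\<^sup>2) * oscA h X Y
     + 2 * real (Suc h) * X ^ (2 * h + 1) * Y) / (4 * (real (Suc h))\<^sup>2 - 1)"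

definition oscW :: "nat \<Rightarrow> real \<Rightarrow> real \<Rightarrow> real" where
  "oscW h X Y = X * oscA h X Y + Y * oscB h X Y"

text \<open>With n = 2h + 2 the denominator is n^2 - 1. The recursion for B comes from (D^2 + 1) X^n
  = n (n - 1) (X^2 + Y^2) X^(n-2) - (n^2 - 1) X^n: solve for X^n and use that D kills X^2 +
  Y^2.\<close>

lemma osc_denom: "4 * (real (Suc h))\<^sup>2 - 1 = (2 * real h + 1) * (2 * real h + 3)" "4 * (real (Suc h))\<^sup>2 - 1 > 0"
proof -
  show 1: "4 * (real (Suc h))\<^sup>2 - 1 = (2 * real h + 1) * (2 * real h + 3)"
    by (simp add: power2_eq_square algebra_simps)
  show "4 * (real (Suc h))\<^sup>2 - 1 > 0" unfolding 1 by (intro mult_pos_pos) linarith+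
qed

lemma oscB_Suc: "(2 * real h + 1) * (2 * real h + 3) * oscB (Suc h) X Y
    = (2 * real h + 2) * (2 * real h + 1) * (X\<^sup>2 + Y\<^sup>2) * oscB h X Y - X ^ (2 * h + 2)"
  using osc_denom[of h] by (simp add: field_simps)

lemma oscA_Suc: "(2 * real h + 1) * (2 * real h + 3) * oscA (Suc h) X Y
    = (2 * real h + 2) * (2 * real h + 1) * (X\<^sup>2 + Y\<^sup>2) * oscA h X Y + (2 * real h + 2) * X ^ (2 * h + 1) * Y"
  using osc_denom[of h] by (simp add: field_simps)

declare oscB.simps(2)[simp del] oscA.simps(2)[simp del]

text \<open>Given that W has gradient (n + 1) (A, B), this says D W = X^(n+1). It has to be proved
  before the gradient formula, whose induction relies on it.\<close>

lemma oscB_oscA_rotation: "(2 * real h + 1) * (X * oscB h X Y - Y * oscA h X Y) = X ^ (2 * h + 1)"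
proof (induction h)
  case (Suc h)
  define p where "p = (2 * real h + 1) * (2 * real h + 3)"
  have p: "p \<noteq> 0" unfolding p_def osc_denom(1)[symmetric] using osc_denom(2)[of h] by linarith
  have "p * ((2 * real (Suc h) + 1) * (X * oscB (Suc h) X Y - Y * oscA (Suc h) X Y))
     = (2 * real h + 3) * (X * (p * oscB (Suc h) X Y) - Y * (p * oscA (Suc h) X Y))"
    by (simp add: algebra_simps)
  also have "\<dots> = (2 * real h + 3) * ((2 * real h + 2) * (X\<^sup>2 + Y\<^sup>2) * ((2 * real h + 1) * (X * oscB h X Y - Y * oscA h X Y))
     - X ^ (2 * h + 3) - (2 * real h + 2) * X ^ (2 * h + 1) * Y\<^sup>2)"
    unfolding p_def oscB_Suc oscA_Suc by (simp add: algebra_simps power2_eq_square power_add eval_nat_numeral)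
  also have "\<dots> = p * X ^ (2 * Suc h + 1)"
    unfolding Suc.IH p_def by (simp add: algebra_simps power2_eq_square power_add eval_nat_numeral)
  finally show ?case using p by simp
qed simp

text \<open>The hypotheses say that (f, g) moves along the rotation, so the derivative is D: this is
  D B = A, and the next lemma is D A = X^n - B.\<close>

lemma has_derivative_oscB_rotation:
  assumes "(f has_real_derivative - g t) (at t)" "(g has_real_derivative f t) (at t)"
  shows "((\<lambda>t. oscB h (f t) (g t)) has_real_derivative oscA h (f t) (g t)) (at t)"
proof (induction h)
  case (Suc h)
  show ?case unfolding oscB.simps(2) oscA.simps(2)
    by (rule derivative_eq_intros refl assms Suc osc_denom(2)[THEN less_imp_neq, symmetric] | simp)+
qed simp

lemma has_derivative_oscA_rotation:
  assumes "(f has_real_derivative - g t) (at t)" "(g has_real_derivative f t) (at t)"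
  shows "((\<lambda>t. oscA h (f t) (g t)) has_real_derivative f t ^ (2 * h) - oscB h (f t) (g t)) (at t)"
proof (induction h)
  case (Suc h)
  define p where "p = (2 * real h + 1) * (2 * real h + 3)"
  have p: "p \<noteq> 0" unfolding p_def osc_denom(1)[symmetric] using osc_denom(2)[of h] by linarith
  define X Y where "X = f t" and "Y = g t"
  have D: "((\<lambda>t. oscA (Suc h) (f t) (g t)) has_real_derivative
      (2 * real (Suc h) * (2 * real (Suc h) - 1) * (X\<^sup>2 + Y\<^sup>2) * (X ^ (2 * h) - oscB h X Y)
     + 2 * real (Suc h) * (X ^ (2 * h + 1) * X - (2 * real h + 1) * X ^ (2 * h) * Y * Y)) / (4 * (real (Suc h))\<^sup>2 - 1)) (at t)"
    unfolding oscA.simps(2)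
    by (rule derivative_eq_intros refl assms Suc osc_denom(2)[THEN less_imp_neq, symmetric] | simp)+
       (simp add: X_def Y_def algebra_simps power2_eq_square)
  have E: "p * (X ^ (2 * Suc h) - oscB (Suc h) X Y) = 2 * real (Suc h) * (2 * real (Suc h) - 1) * (X\<^sup>2 + Y\<^sup>2) * (X ^ (2 * h) - oscB h X Y)
     + 2 * real (Suc h) * (X ^ (2 * h + 1) * X - (2 * real h + 1) * X ^ (2 * h) * Y * Y)"
    unfolding right_diff_distrib[of p] unfolding p_def oscB_Suc
    by (simp add: algebra_simps power2_eq_square)
  show ?case using D
    unfolding osc_denom(1) p_def[symmetric] X_def[symmetric] Y_def[symmetric] E[symmetric]
      nonzero_mult_div_cancel_left[OF p] .
qed (auto intro!: derivative_eq_intros)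

text \<open>A recursion for W that no longer mentions A and B separately, so that the gradient can
  be found by differentiating it inductively.\<close>

lemma oscW_Suc: "(2 * real h + 3) * oscW (Suc h) X Y = X ^ (2 * h + 2) * Y + (2 * real h + 2) * (X\<^sup>2 + Y\<^sup>2) * oscW h X Y"
proof -
  have "(2 * real h + 1) * ((2 * real h + 3) * oscW (Suc h) X Y)
    = X * ((2 * real h + 1) * (2 * real h + 3) * oscA (Suc h) X Y) + Y * ((2 * real h + 1) * (2 * real h + 3) * oscB (Suc h) X Y)"
    by (simp add: oscW_def algebra_simps)
  also have "\<dots> = (2 * real h + 1) * (X ^ (2 * h + 2) * Y + (2 * real h + 2) * (X\<^sup>2 + Y\<^sup>2) * oscW h X Y)"
    unfolding oscA_Suc oscB_Suc by (simp add: oscW_def algebra_simps)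
  finally show ?thesis by (simp del: of_nat_Suc)
qed

lemma oscW_Suc': "oscW (Suc h) X Y = (X ^ (2 * h + 2) * Y + (2 * real h + 2) * (X\<^sup>2 + Y\<^sup>2) * oscW h X Y) / (2 * real h + 3)"
  using oscW_Suc[of h X Y] by (simp add: field_simps)

lemma oscW_deriv:
  assumes "(f has_real_derivative f') (at t)" "(g has_real_derivative g') (at t)"
  shows "((\<lambda>t. oscW h (f t) (g t)) has_real_derivative
     (2 * real h + 1) * (oscA h (f t) (g t) * f' + oscB h (f t) (g t) * g')) (at t)"
proof (induction h)
  case 0
  show ?case using assms by (simp add: oscW_def)
next
  case (Suc h)
  define X Y where "X = f t" and "Y = g t"
  have a: "(2 * real h + 1) * (X * oscB h X Y - Y * oscA h X Y) = X ^ (2 * h + 1)"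
    by (rule oscB_oscA_rotation)
  have D: "((\<lambda>t. oscW (Suc h) (f t) (g t)) has_real_derivative
     ((2 * real h + 2) * X ^ (2 * h + 1) * f' * Y + X ^ (2 * h + 2) * g'
      + (2 * real h + 2) * ((2 * X * f' + 2 * Y * g') * oscW h X Y
        + (X\<^sup>2 + Y\<^sup>2) * ((2 * real h + 1) * (oscA h X Y * f' + oscB h X Y * g')))) / (2 * real h + 3)) (at t)"
    unfolding oscW_Suc'
    by (rule derivative_eq_intros refl assms Suc | simp)+
       (simp add: X_def Y_def algebra_simps)
  let ?q = "2 * real h + 1" and ?r = "2 * real h + 3"
  \<comment> \<open>The recursion of A and the X-derivative of the recursion of W differ by a
    multiple of the identity \<open>a\<close>, which is the extra last term below; \<open>B\<close>
    is the same for the Y-derivative. The factor \<open>?q\<close> allows the recursions to be used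
    without denominators.\<close>
  have A: "?q * (?r * ?r * oscA (Suc h) X Y) = ?q * ((2 * real h + 2) * X ^ (2 * h + 1) * Y
      + (2 * real h + 2) * (2 * X * oscW h X Y + (X\<^sup>2 + Y\<^sup>2) * (?q * oscA h X Y)))"
  proof -
    have "?q * (?r * ?r * oscA (Suc h) X Y) = ?r * (?q * ?r * oscA (Suc h) X Y)" by (simp add: algebra_simps)
    also have "\<dots> = ?q * ((2 * real h + 2) * X ^ (2 * h + 1) * Y
      + (2 * real h + 2) * (2 * X * oscW h X Y + (X\<^sup>2 + Y\<^sup>2) * (?q * oscA h X Y)))
      + 2 * (2 * real h + 2) * Y * (X ^ (2 * h + 1) - ?q * (X * oscB h X Y - Y * oscA h X Y))"
      unfolding oscA_Suc oscW_def by (simp add: algebra_simps power2_eq_square)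
    finally show ?thesis using a by simp
  qed
  have B: "?q * (?r * ?r * oscB (Suc h) X Y) = ?q * (X ^ (2 * h + 2)
      + (2 * real h + 2) * (2 * Y * oscW h X Y + (X\<^sup>2 + Y\<^sup>2) * (?q * oscB h X Y)))"
  proof -
    have "?q * (?r * ?r * oscB (Suc h) X Y) = ?r * (?q * ?r * oscB (Suc h) X Y)" by (simp add: algebra_simps)
    also have "\<dots> = ?q * (X ^ (2 * h + 2)
      + (2 * real h + 2) * (2 * Y * oscW h X Y + (X\<^sup>2 + Y\<^sup>2) * (?q * oscB h X Y)))
      - 2 * (2 * real h + 2) * X * (X ^ (2 * h + 1) - ?q * (X * oscB h X Y - Y * oscA h X Y))"
      unfolding oscB_Suc oscW_def by (simp add: algebra_simps power2_eq_square)
    finally show ?thesis using a by simp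
  qed
  have q: "?q \<noteq> 0" "?r \<noteq> 0" by linarith+
  have A': "?r * ?r * oscA (Suc h) X Y = (2 * real h + 2) * X ^ (2 * h + 1) * Y
      + (2 * real h + 2) * (2 * X * oscW h X Y + (X\<^sup>2 + Y\<^sup>2) * (?q * oscA h X Y))"
    using A q by (simp only: mult_cancel_left) blast
  have B': "?r * ?r * oscB (Suc h) X Y = X ^ (2 * h + 2)
      + (2 * real h + 2) * (2 * Y * oscW h X Y + (X\<^sup>2 + Y\<^sup>2) * (?q * oscB h X Y))"
    using B q by (simp only: mult_cancel_left) blast
  have E: "?r * ?r * (oscA (Suc h) X Y * f' + oscB (Suc h) X Y * g') = (2 * real h + 2) * X ^ (2 * h + 1) * f' * Y + X ^ (2 * h + 2) * g'
      + (2 * real h + 2) * ((2 * X * f' + 2 * Y * g') * oscW h X Y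
        + (X\<^sup>2 + Y\<^sup>2) * ((2 * real h + 1) * (oscA h X Y * f' + oscB h X Y * g')))"
  proof -
    have "?r * ?r * (oscA (Suc h) X Y * f' + oscB (Suc h) X Y * g')
       = (?r * ?r * oscA (Suc h) X Y) * f' + (?r * ?r * oscB (Suc h) X Y) * g'" by (simp add: algebra_simps)
    also have "\<dots> = (2 * real h + 2) * X ^ (2 * h + 1) * f' * Y + X ^ (2 * h + 2) * g'
      + (2 * real h + 2) * ((2 * X * f' + 2 * Y * g') * oscW h X Y
        + (X\<^sup>2 + Y\<^sup>2) * ((2 * real h + 1) * (oscA h X Y * f' + oscB h X Y * g')))"
      unfolding A' B' by (simp add: algebra_simps)
    finally show ?thesis .
  qed
  have r: "2 * real (Suc h) + 1 = ?r" by simp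
  show ?case using D
    unfolding X_def[symmetric] Y_def[symmetric] r E[symmetric] mult.assoc[of ?r] nonzero_mult_div_cancel_left[OF q(2)] .
qed

text \<open>On the unit circle the recursion subtracts at most 1 from (2h + 2) ((2h + 1) B_h), which
  the induction hypothesis bounds below by 2h + 2.\<close>

lemma oscB_lower_bound:
  assumes "X\<^sup>2 + Y\<^sup>2 = 1" shows "oscB h X Y \<ge> 1 / (2 * real h + 1)"
proof (induction h)
  case (Suc h)
  have "X\<^sup>2 \<le> 1" using assms zero_le_power2[of Y] by linarith
  then have "(X\<^sup>2) ^ (h + 1) \<le> 1" by (rule power_le_one[OF zero_le_power2])
  moreover have "(X\<^sup>2) ^ (h + 1) = X ^ (2 * h + 2)"
    unfolding power_mult[symmetric] by (rule arg_cong[of _ _ "power X"]) simp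
  ultimately have "X ^ (2 * h + 2) \<le> 1" by simp
  moreover have "(2 * real h + 2) * ((2 * real h + 1) * oscB h X Y) \<ge> (2 * real h + 2) * 1"
    using Suc by (intro mult_left_mono) (auto simp: field_simps)
  moreover have "(2 * real h + 1) * (2 * real h + 3) * oscB (Suc h) X Y
    = (2 * real h + 2) * ((2 * real h + 1) * oscB h X Y) - X ^ (2 * h + 2)"
    using oscB_Suc[of h X Y] unfolding assms by (simp only: mult_1_right mult.assoc)
  moreover have "a - 1 \<le> c" if "x \<le> 1" "a * 1 \<le> b" "c = b - x" for a b c x :: real using that by linarith
  ultimately have "(2 * real h + 2) - 1 \<le> (2 * real h + 1) * (2 * real h + 3) * oscB (Suc h) X Y" by blast
  moreover have "(2 * real h + 2) - 1 = (2 * real h + 1) * 1" by simp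
  ultimately have "(2 * real h + 1) * ((2 * real h + 3) * oscB (Suc h) X Y) \<ge> (2 * real h + 1) * 1"
    unfolding mult.assoc by metis
  then have "(2 * real h + 3) * oscB (Suc h) X Y \<ge> 1"
    by (rule mult_left_le_imp_le) simp
  then show ?case by (simp add: field_simps)
qed simp

text \<open>Eliminating Y in favour of the invariant X^2 + Y^2 makes averages along the rotation
  linear in moments of X alone.\<close>

lemma oscB_expand:
  "\<exists>\<beta>. \<forall>X Y. oscB h X Y = (\<Sum>j\<le>h. \<beta> j * (X\<^sup>2 + Y\<^sup>2) ^ (h - j) * X ^ (2 * j))"
proof (induction h)
  case 0
  show ?case by (intro exI[of _ "\<lambda>_. 1"]) simp
next
  case (Suc h)
  then obtain \<beta> where b: "\<And>X Y. oscB h X Y = (\<Sum>j\<le>h. \<beta> j * (X\<^sup>2 + Y\<^sup>2) ^ (h - j) * X ^ (2 * j))" by blast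
  let ?p = "4 * (real (Suc h))\<^sup>2 - 1" and ?q = "2 * real (Suc h) * (2 * real (Suc h) - 1)"
  let ?b = "\<lambda>j. if j = Suc h then - 1 / ?p else ?q / ?p * \<beta> j"
  have "oscB (Suc h) X Y = (\<Sum>j\<le>Suc h. ?b j * (X\<^sup>2 + Y\<^sup>2) ^ (Suc h - j) * X ^ (2 * j))" for X Y
  proof -
    have "(\<Sum>j\<le>h. ?b j * (X\<^sup>2 + Y\<^sup>2) ^ (Suc h - j) * X ^ (2 * j))
       = (\<Sum>j\<le>h. ?q / ?p * (X\<^sup>2 + Y\<^sup>2) * (\<beta> j * (X\<^sup>2 + Y\<^sup>2) ^ (h - j) * X ^ (2 * j)))"
      by (intro sum.cong) (auto simp: Suc_diff_le)
    also have "\<dots> = ?q / ?p * (X\<^sup>2 + Y\<^sup>2) * oscB h X Y"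
      unfolding b sum_distrib_left ..
    finally have 1: "(\<Sum>j\<le>h. ?b j * (X\<^sup>2 + Y\<^sup>2) ^ (Suc h - j) * X ^ (2 * j)) = ?q / ?p * (X\<^sup>2 + Y\<^sup>2) * oscB h X Y" .
    show ?thesis unfolding sum.atMost_Suc 1 oscB.simps(2) by (simp add: diff_divide_distrib)
  qed
  then show ?case by (intro exI[of _ ?b] allI)
qed

lemma polyfun4_osc:
  assumes "polyfun4 F" "polyfun4 G"
  shows "polyfun4 (\<lambda>x1 x2 y1 y2. oscB h (F x1 x2 y1 y2) (G x1 x2 y1 y2))"
    "polyfun4 (\<lambda>x1 x2 y1 y2. oscA h (F x1 x2 y1 y2) (G x1 x2 y1 y2))"
    "polyfun4 (\<lambda>x1 x2 y1 y2. oscW h (F x1 x2 y1 y2) (G x1 x2 y1 y2))"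
proof -
  show B: "polyfun4 (\<lambda>x1 x2 y1 y2. oscB h (F x1 x2 y1 y2) (G x1 x2 y1 y2))"
    by (induction h) (auto simp: oscB.simps(2) intro!: polyfun4_intros assms simp del: of_nat_Suc power_Suc)
  show A: "polyfun4 (\<lambda>x1 x2 y1 y2. oscA h (F x1 x2 y1 y2) (G x1 x2 y1 y2))"
    by (induction h) (auto simp: oscA.simps(2) intro!: polyfun4_intros assms simp del: of_nat_Suc power_Suc)
  show "polyfun4 (\<lambda>x1 x2 y1 y2. oscW h (F x1 x2 y1 y2) (G x1 x2 y1 y2))"
    unfolding oscW_def by (intro polyfun4_add polyfun4_mult A B assms)
qed

lemma oscW_scale: "oscW h (s * X) (s * Y) = s ^ (2 * h + 1) * oscW h X Y"
proof (induction h)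
  case 0
  show ?case by (simp add: oscW_def)
next
  case (Suc h)
  show ?case unfolding oscW_Suc' Suc
    by (simp add: power_mult_distrib power_add power2_eq_square field_simps)
qed

subsection \<open>Averages over the flow\<close>

abbreviation rotX :: "real \<Rightarrow> real \<Rightarrow> real \<Rightarrow> real" where
  "rotX X Y t \<equiv> cos t * X - sin t * Y"
abbreviation rotY :: "real \<Rightarrow> real \<Rightarrow> real \<Rightarrow> real" where
  "rotY X Y t \<equiv> sin t * X + cos t * Y"

lemma rot_norm: "(rotX X Y t)\<^sup>2 + (rotY X Y t)\<^sup>2 = X\<^sup>2 + Y\<^sup>2"
proof -
  have "(c * X - s * Y)\<^sup>2 + (s * X + c * Y)\<^sup>2 = (c\<^sup>2 + s\<^sup>2) * (X\<^sup>2 + Y\<^sup>2)" for c s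
    unfolding power2_eq_square by (simp add: algebra_simps)
  from this[of "cos t" "sin t"] show ?thesis by simp
qed

lemma rot_deriv:
  "((rotX X Y) has_real_derivative - rotY X Y t) (at t)"
  "((rotY X Y) has_real_derivative rotX X Y t) (at t)"
  by (auto intro!: derivative_eq_intros)

lemma periodic_deriv_integral:
  fixes F f :: "real \<Rightarrow> real"
  assumes "\<And>t. (F has_real_derivative f t) (at t)" "F (2 * pi) = F 0"
  shows "(f has_integral 0) {0..2*pi}"
proof -
  have "(f has_integral (F (2*pi) - F 0)) {0..2*pi}"
    by (intro fundamental_theorem_of_calculus)
       (auto simp flip: has_real_derivative_iff_has_vector_derivative intro!: has_field_derivative_at_within assms(1))
  then show ?thesis by (simp add: assms(2))
qed

text \<open>The Wallis integral of cos^(2m) over a full period.\<close>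

fun cos_moment :: "nat \<Rightarrow> real" where
  "cos_moment 0 = 2 * pi"
| "cos_moment (Suc m) = (2 * real m + 1) / (2 * real m + 2) * cos_moment m"

lemma cos_moment_pos: "cos_moment m > 0"
  by (induction m) auto

text \<open>The periodic function X^(2m+1) Y has a derivative with mean zero; with Y^2 replaced by
  the constant norm minus X^2 this is the Wallis recursion.\<close>

lemma rotX_power_integral:
  "((\<lambda>t. rotX X Y t ^ (2 * m)) has_integral cos_moment m * (X\<^sup>2 + Y\<^sup>2) ^ m) {0..2*pi}"
proof (induction m)
  case 0
  show ?case using has_integral_const_real[of "1::real" 0 "2*pi"] by simp
next
  case (Suc m)
  let ?r = "X\<^sup>2 + Y\<^sup>2" and ?q = "2 * real m + 2"
  have "((\<lambda>t. rotX X Y t ^ (2 * m + 1) * rotY X Y t) has_real_derivative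
      ?q * rotX X Y t ^ (2 * Suc m) - (2 * real m + 1) * ?r * rotX X Y t ^ (2 * m)) (at t)" for t
  proof -
    have "((\<lambda>t. rotX X Y t ^ (2 * m + 1) * rotY X Y t) has_real_derivative
      (2 * real m + 1) * rotX X Y t ^ (2 * m) * (- rotY X Y t) * rotY X Y t + rotX X Y t ^ (2 * m + 1) * rotX X Y t) (at t)"
      by (rule DERIV_cong, rule DERIV_mult[OF DERIV_power[OF rot_deriv(1)] rot_deriv(2)])
         (simp add: algebra_simps)
    moreover have "(2 * real m + 1) * rotX X Y t ^ (2 * m) * (- rotY X Y t) * rotY X Y t + rotX X Y t ^ (2 * m + 1) * rotX X Y t
      = ?q * rotX X Y t ^ (2 * Suc m) - (2 * real m + 1) * ((rotX X Y t)\<^sup>2 + (rotY X Y t)\<^sup>2) * rotX X Y t ^ (2 * m)"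
    proof -
      have "(2 * real m + 1) * x ^ (2 * m) * (- y) * y + x ^ (2 * m + 1) * x
        = ?q * x ^ (2 * Suc m) - (2 * real m + 1) * (x\<^sup>2 + y\<^sup>2) * x ^ (2 * m)" for x y :: real
        by (simp add: power2_eq_square algebra_simps)
      then show ?thesis .
    qed
    ultimately show ?thesis unfolding rot_norm by simp
  qed
  then have "((\<lambda>t. ?q * rotX X Y t ^ (2 * Suc m) - (2 * real m + 1) * ?r * rotX X Y t ^ (2 * m)) has_integral 0) {0..2*pi}"
    by (rule periodic_deriv_integral) simp
  then have "((\<lambda>t. (?q * rotX X Y t ^ (2 * Suc m) - (2 * real m + 1) * ?r * rotX X Y t ^ (2 * m)) / ?q
      + (2 * real m + 1) / ?q * ?r * rotX X Y t ^ (2 * m)) has_integral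
      (0 / ?q + (2 * real m + 1) / ?q * ?r * (cos_moment m * ?r ^ m))) {0..2*pi}"
    by (intro has_integral_add has_integral_divide has_integral_mult_right Suc)
  moreover have "(?q * rotX X Y t ^ (2 * Suc m) - (2 * real m + 1) * ?r * rotX X Y t ^ (2 * m)) / ?q
      + (2 * real m + 1) / ?q * ?r * rotX X Y t ^ (2 * m) = rotX X Y t ^ (2 * Suc m)" for t
  proof -
    have q: "?q \<noteq> 0" by linarith
    have "(?q * a - (2 * real m + 1) * ?r * b) / ?q + (2 * real m + 1) / ?q * ?r * b = a" for a b
      using q by (simp add: diff_divide_distrib)
    then show ?thesis .
  qed
  ultimately show ?case by (simp add: mult_ac)
qed

lemma cos_power_integral: "((\<lambda>t. cos t ^ (2 * m)) has_integral cos_moment m) {0..2*pi}"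
  using rotX_power_integral[of 1 0 m] by simp

lemma sin2_cos_power_integral:
  "((\<lambda>t. cos t ^ (2 * m) * (sin t)\<^sup>2) has_integral cos_moment (Suc m) / (2 * real m + 1)) {0..2*pi}"
proof -
  have "((\<lambda>t. cos t ^ (2 * m) - cos t ^ (2 * Suc m)) has_integral cos_moment m - cos_moment (Suc m)) {0..2*pi}"
    by (intro has_integral_diff cos_power_integral)
  moreover have "cos t ^ (2 * m) - cos t ^ (2 * Suc m) = cos t ^ (2 * m) * (sin t)\<^sup>2" for t :: real
  proof -
    have "c ^ (2 * m) - c ^ (2 * Suc m) = c ^ (2 * m) * (1 - c\<^sup>2)" for c :: real
      by (simp add: power2_eq_square algebra_simps)
    then show ?thesis unfolding sin_squared_eq .
  qed
  moreover have "cos_moment m - cos_moment (Suc m) = cos_moment (Suc m) / (2 * real m + 1)"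
  proof -
    have "2 * real m + 1 \<noteq> 0" "2 * real m + 2 \<noteq> 0" by linarith+
    then show ?thesis by (simp add: divide_simps) (simp add: algebra_simps)
  qed
  ultimately show ?thesis by simp
qed

definition oscJ :: "nat \<Rightarrow> real \<Rightarrow> real \<Rightarrow> real \<Rightarrow> real \<Rightarrow> real" where
  "oscJ h X Y X' Y' = integral {0..2*pi} (\<lambda>t. oscB h (rotX X Y t) (rotY X Y t) * rotX X' Y' t ^ (2 * h))"

lemma continuous_on_oscB: "continuous_on S (\<lambda>t. oscB h (rotX X Y t) (rotY X Y t))"
  by (intro continuous_at_imp_continuous_on ballI DERIV_isCont[OF has_derivative_oscB_rotation[OF rot_deriv]])

lemma oscJ_integral:
  "((\<lambda>t. oscB h (rotX X Y t) (rotY X Y t) * rotX X' Y' t ^ (2 * h)) has_integral oscJ h X Y X' Y') {0..2*pi}"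
  unfolding oscJ_def
  by (intro integrable_integral integrable_continuous_interval continuous_intros continuous_on_oscB)

text \<open>Integration by parts: along the rotation the derivative of B A' is A A' + B (X'^n - B'),
  and it has mean zero. So the average of the bracket only involves B X'^n.\<close>

lemma oscA_oscB_integral:
  "((\<lambda>t. oscA h (rotX X Y t) (rotY X Y t) * oscA h (rotX X' Y' t) (rotY X' Y' t)
       - oscB h (rotX X Y t) (rotY X Y t) * oscB h (rotX X' Y' t) (rotY X' Y' t)) has_integral - oscJ h X Y X' Y') {0..2*pi}"
proof -
  let ?A = "\<lambda>t. oscA h (rotX X Y t) (rotY X Y t)" and ?B = "\<lambda>t. oscB h (rotX X Y t) (rotY X Y t)"
  let ?A' = "\<lambda>t. oscA h (rotX X' Y' t) (rotY X' Y' t)" and ?B' = "\<lambda>t. oscB h (rotX X' Y' t) (rotY X' Y' t)"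
  have "((\<lambda>t. ?B t * ?A' t) has_real_derivative ?A t * ?A' t + (rotX X' Y' t ^ (2 * h) - ?B' t) * ?B t) (at t)" for t
    by (rule DERIV_mult[OF has_derivative_oscB_rotation has_derivative_oscA_rotation]; rule rot_deriv)
  then have "((\<lambda>t. ?A t * ?A' t + (rotX X' Y' t ^ (2 * h) - ?B' t) * ?B t) has_integral 0) {0..2*pi}"
    by (rule periodic_deriv_integral) simp
  from has_integral_diff[OF this oscJ_integral[of h X Y X' Y']]
  show ?thesis by (simp add: algebra_simps)
qed

locale oscB_coeffs =
  fixes h :: nat and \<beta> :: "nat \<Rightarrow> real"
  assumes oscB_eq: "oscB h X Y = (\<Sum>j\<le>h. \<beta> j * (X\<^sup>2 + Y\<^sup>2) ^ (h - j) * X ^ (2 * j))"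
begin

text \<open>The integral of B X^n over the unit circle, as \<open>L_integral\<close>
  confirms.\<close>

definition L :: real where "L = (\<Sum>j\<le>h. \<beta> j * cos_moment (h + j))"

text \<open>For a single point the integrand is a polynomial in X with coefficients in the norm, and
  its moments give a pure power of the norm. This is what makes the orthogonal case
  solvable.\<close>

lemma oscJ_diag: "oscJ h X Y X Y = L * (X\<^sup>2 + Y\<^sup>2) ^ (2 * h)"
proof -
  have "((\<lambda>t. \<Sum>j\<le>h. (\<beta> j * (X\<^sup>2 + Y\<^sup>2) ^ (h - j)) * rotX X Y t ^ (2 * (h + j))) has_integral
     (\<Sum>j\<le>h. (\<beta> j * (X\<^sup>2 + Y\<^sup>2) ^ (h - j)) * (cos_moment (h + j) * (X\<^sup>2 + Y\<^sup>2) ^ (h + j)))) {0..2*pi}"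
    by (intro has_integral_sum has_integral_mult_right rotX_power_integral) simp
  moreover have "(\<Sum>j\<le>h. (\<beta> j * (X\<^sup>2 + Y\<^sup>2) ^ (h - j)) * rotX X Y t ^ (2 * (h + j)))
     = oscB h (rotX X Y t) (rotY X Y t) * rotX X Y t ^ (2 * h)" for t
    unfolding oscB_eq rot_norm sum_distrib_right
    by (intro sum.cong) (auto simp: power_add distrib_left mult_ac)
  moreover have "(\<Sum>j\<le>h. (\<beta> j * (X\<^sup>2 + Y\<^sup>2) ^ (h - j)) * (cos_moment (h + j) * (X\<^sup>2 + Y\<^sup>2) ^ (h + j))) = L * (X\<^sup>2 + Y\<^sup>2) ^ (2 * h)"
  proof -
    have "b * r ^ (h - j) * (c * r ^ (h + j)) = b * c * r ^ (2 * h)" if "j \<le> h" for b c r :: real and j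
    proof -
      have "r ^ (2 * h) = r ^ (h - j) * r ^ (h + j)" unfolding power_add[symmetric] using that by (intro arg_cong[of _ _ "power r"]) simp
      then show ?thesis by simp
    qed
    then show ?thesis unfolding L_def sum_distrib_right by (intro sum.cong) auto
  qed
  ultimately have "((\<lambda>t. oscB h (rotX X Y t) (rotY X Y t) * rotX X Y t ^ (2 * h)) has_integral L * (X\<^sup>2 + Y\<^sup>2) ^ (2 * h)) {0..2*pi}"
    by simp
  then show ?thesis by (rule has_integral_unique[OF oscJ_integral])
qed

text \<open>With Y = Y' = 0 both points oscillate as multiples of cos t, and the integrand factors
  into a power of X X' and a function of t.\<close>

lemma oscJ_straight: "oscJ h X 0 X' 0 = L * (X * X') ^ (2 * h)"
proof -
  have 1: "((\<lambda>t. \<Sum>j\<le>h. (\<beta> j * (X * X') ^ (2 * h)) * cos t ^ (2 * (h + j))) has_integral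
     (\<Sum>j\<le>h. (\<beta> j * (X * X') ^ (2 * h)) * cos_moment (h + j))) {0..2*pi}"
    by (intro has_integral_sum has_integral_mult_right cos_power_integral) simp
  have 2: "(\<Sum>j\<le>h. (\<beta> j * (X * X') ^ (2 * h)) * cos t ^ (2 * (h + j)))
     = oscB h (rotX X 0 t) (rotY X 0 t) * rotX X' 0 t ^ (2 * h)" for t
  proof -
    have "b * (X * X') ^ (2 * h) * c ^ (2 * (h + j)) = b * (X\<^sup>2) ^ (h - j) * (c * X) ^ (2 * j) * (c * X') ^ (2 * h)"
      if "j \<le> h" for b c :: real and j
    proof -
      have "X ^ (2 * h) = (X\<^sup>2) ^ (h - j) * X ^ (2 * j)"
        unfolding power_mult[symmetric] power_add[symmetric] using that by (intro arg_cong[of _ _ "power X"]) simp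
      then show ?thesis by (simp add: power_mult_distrib power_add distrib_left mult_ac)
    qed
    then show ?thesis unfolding oscB_eq rot_norm sum_distrib_right
      by (intro sum.cong) auto
  qed
  have 3: "(\<Sum>j\<le>h. (\<beta> j * (X * X') ^ (2 * h)) * cos_moment (h + j)) = L * (X * X') ^ (2 * h)"
    unfolding L_def sum_distrib_right by (intro sum.cong) auto
  have "((\<lambda>t. oscB h (rotX X 0 t) (rotY X 0 t) * rotX X' 0 t ^ (2 * h)) has_integral L * (X * X') ^ (2 * h)) {0..2*pi}"
    using 1 unfolding 2 3 .
  then show ?thesis by (rule has_integral_unique[OF oscJ_integral])
qed

lemma L_integral: "((\<lambda>t. oscB h (cos t) (sin t) * cos t ^ (2 * h)) has_integral L) {0..2*pi}"
  using oscJ_integral[of h 1 0 1 0] oscJ_straight[of 1 1] by simp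

lemma L_pos: "L > 0"
proof -
  have "((\<lambda>t. 1 / (2 * real h + 1) * cos t ^ (2 * h)) has_integral 1 / (2 * real h + 1) * cos_moment h) {0..2*pi}"
    by (intro has_integral_mult_right cos_power_integral)
  from has_integral_le[OF this L_integral] have "1 / (2 * real h + 1) * cos_moment h \<le> L"
    by (rule meta_mp) (intro mult_right_mono oscB_lower_bound, auto simp: power_mult)
  moreover have "1 / (2 * real h + 1) * cos_moment h > 0" using cos_moment_pos by simp
  ultimately show ?thesis by linarith
qed

end

subsection \<open>Second order expansion near a straight orbit\<close>

lemma coeff_linear_power_upto_2:
  fixes a b :: real
  shows "coeff ([:a, b:] ^ n) 0 = a ^ n" "coeff ([:a, b:] ^ n) 1 = real n * a ^ (n - 1) * b"
    "coeff ([:a, b:] ^ n) 2 = real (n choose 2) * a ^ (n - 2) * b\<^sup>2"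
proof -
  have mul: "coeff ([:a, b:] * p) (Suc k) = a * coeff p (Suc k) + b * coeff p k" for p k by simp
  show 0: "coeff ([:a, b:] ^ n) 0 = a ^ n" for n by (induction n) auto
  show 1: "coeff ([:a, b:] ^ n) 1 = real n * a ^ (n - 1) * b" for n
  proof (induction n)
    case (Suc n)
    have "coeff ([:a, b:] ^ Suc n) 1 = a * (real n * a ^ (n - 1) * b) + b * a ^ n"
      using mul[of "[:a, b:] ^ n" 0] Suc 0[of n] by (simp del: mult_pCons_left)
    then show ?case by (cases n) (auto simp: algebra_simps)
  qed simp
  show "coeff ([:a, b:] ^ n) 2 = real (n choose 2) * a ^ (n - 2) * b\<^sup>2"
  proof (induction n)
    case (Suc n)
    have "coeff ([:a, b:] ^ Suc n) 2 = a * (real (n choose 2) * a ^ (n - 2) * b\<^sup>2) + b * (real n * a ^ (n - 1) * b)"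
      using mul[of "[:a, b:] ^ n" 1] Suc 1[of n] by (simp del: mult_pCons_left add: numeral_2_eq_2)
    moreover have "real (Suc n choose 2) = real n + real (n choose 2)"
      by (simp add: numeral_2_eq_2)
    moreover have "a * (real (n choose 2) * a ^ (n - 2) * b\<^sup>2) = real (n choose 2) * a ^ (n - 1) * b\<^sup>2"
    proof (cases "n \<ge> 2")
      case True
      then have "n - 1 = Suc (n - 2)" by simp
      then show ?thesis by simp
    qed (auto simp: binomial_eq_0)
    ultimately show ?case by (simp add: power2_eq_square algebra_simps)
  qed simp
qed

lemma coeff_even_quadratic_power_upto_2:
  fixes a b :: real
  shows "coeff ([:a, 0, b:] ^ n) 0 = a ^ n" "coeff ([:a, 0, b:] ^ n) 1 = 0"
    "coeff ([:a, 0, b:] ^ n) 2 = real n * a ^ (n - 1) * b"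
proof -
  show 0: "coeff ([:a, 0, b:] ^ n) 0 = a ^ n" for n by (induction n) auto
  show 1: "coeff ([:a, 0, b:] ^ n) 1 = 0" for n by (induction n) auto
  show "coeff ([:a, 0, b:] ^ n) 2 = real n * a ^ (n - 1) * b"
  proof (induction n)
    case (Suc n)
    have "coeff ([:a, 0, b:] ^ Suc n) 2 = a * (real n * a ^ (n - 1) * b) + b * a ^ n"
      using Suc 0[of n] by (simp add: numeral_2_eq_2)
    then show ?case by (cases n) (auto simp: algebra_simps)
  qed simp
qed

lemma coeff_mult_upto_2:
  fixes p q :: "real poly"
  shows "coeff (p * q) 0 = coeff p 0 * coeff q 0"
    "coeff (p * q) 1 = coeff p 0 * coeff q 1 + coeff p 1 * coeff q 0"
    "coeff (p * q) 2 = coeff p 0 * coeff q 2 + coeff p 1 * coeff q 1 + coeff p 2 * coeff q 0"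
  by (simp_all add: coeff_mult numeral_2_eq_2)

text \<open>Polynomials in the perturbation parameter, with coefficients depending on t. Bounded
  degree and continuity let the integral over t be taken coefficientwise, which replaces
  differentiation under the integral sign.\<close>

definition cont_poly_family :: "(real \<Rightarrow> real poly) \<Rightarrow> bool" where
  "cont_poly_family P \<longleftrightarrow> (\<exists>D. \<forall>t. degree (P t) \<le> D) \<and> (\<forall>r. continuous_on UNIV (\<lambda>t. coeff (P t) r))"

lemma cont_poly_family_const: "cont_poly_family (\<lambda>_. p)"
  by (auto simp: cont_poly_family_def)

lemma cont_poly_family_linear:
  assumes "continuous_on UNIV f" "continuous_on UNIV g"
  shows "cont_poly_family (\<lambda>t. [:f t, g t:])"
  unfolding cont_poly_family_def
proof (intro conjI exI[of _ 1] allI)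
  fix r show "continuous_on UNIV (\<lambda>t. coeff [:f t, g t:] r)"
    using assms by (cases r; cases "r - 1") (auto simp: coeff_pCons)
qed auto

lemma cont_poly_family_mult:
  assumes "cont_poly_family P" "cont_poly_family Q" shows "cont_poly_family (\<lambda>t. P t * Q t)"
proof -
  obtain D E where "\<forall>t. degree (P t) \<le> D" "\<forall>t. degree (Q t) \<le> E"
    using assms by (auto simp: cont_poly_family_def)
  then have "\<forall>t. degree (P t * Q t) \<le> D + E" by (meson add_mono degree_mult_le order_trans)
  then show ?thesis using assms unfolding cont_poly_family_def
    by (auto simp: coeff_mult intro!: continuous_intros)
qed

lemma cont_poly_family_power: "cont_poly_family P \<Longrightarrow> cont_poly_family (\<lambda>t. P t ^ n)"
  by (induction n) (auto intro: cont_poly_family_mult cont_poly_family_const)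

lemma cont_poly_family_add:
  assumes "cont_poly_family P" "cont_poly_family Q" shows "cont_poly_family (\<lambda>t. P t + Q t)"
proof -
  obtain D E where "\<forall>t. degree (P t) \<le> D" "\<forall>t. degree (Q t) \<le> E"
    using assms by (auto simp: cont_poly_family_def)
  then have "\<forall>t. degree (P t + Q t) \<le> max D E"
    by (meson degree_add_le le_max_iff_disj)
  then show ?thesis using assms unfolding cont_poly_family_def
    by (auto intro!: continuous_intros)
qed

lemma cont_poly_family_sum:
  "(\<And>j. j \<in> J \<Longrightarrow> cont_poly_family (P j)) \<Longrightarrow> cont_poly_family (\<lambda>t. \<Sum>j\<in>J. P j t)"
  by (induction J rule: infinite_finite_induct) (auto intro: cont_poly_family_add cont_poly_family_const)

lemma cont_poly_family_integral:
  assumes "cont_poly_family P"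
  obtains R where "\<And>e. ((\<lambda>t. poly (P t) e) has_integral poly R e) {0..2*pi}"
    "\<And>r. ((\<lambda>t. coeff (P t) r) has_integral coeff R r) {0..2*pi}"
proof -
  obtain D where D: "\<And>t. degree (P t) \<le> D" and c: "\<And>r. continuous_on UNIV (\<lambda>t. coeff (P t) r)"
    using assms by (auto simp: cont_poly_family_def)
  let ?i = "\<lambda>r. integral {0..2*pi} (\<lambda>t. coeff (P t) r)"
  have i: "((\<lambda>t. coeff (P t) r) has_integral ?i r) {0..2*pi}" for r
    by (intro integrable_integral integrable_continuous_interval continuous_on_subset[OF c]) auto
  define R where "R = (\<Sum>r\<le>D. monom (?i r) r)"
  have R: "coeff R r = ?i r" for r
  proof (cases "r \<le> D")
    case False
    then have "coeff (P t) r = 0" for t using D[of t] by (intro coeff_eq_0) simp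
    then show ?thesis using False by (simp add: R_def coeff_sum)
  qed (simp add: R_def coeff_sum)
  have P: "poly (P t) e = (\<Sum>r\<le>D. coeff (P t) r * e ^ r)" for t e
    unfolding poly_altdef using D[of t] by (intro sum.mono_neutral_left) (auto intro: coeff_eq_0)
  show ?thesis
  proof (rule that[of R])
    show "((\<lambda>t. coeff (P t) r) has_integral coeff R r) {0..2*pi}" for r unfolding R by (rule i)
    have "poly R e = (\<Sum>r\<le>D. ?i r * e ^ r)" for e unfolding R_def by (simp add: poly_sum poly_monom)
    then show "((\<lambda>t. poly (P t) e) has_integral poly R e) {0..2*pi}" for e
      unfolding P by (simp only:) (intro has_integral_sum has_integral_mult_left i, simp)
  qed
qed

context oscB_coeffs
begin

text \<open>The coefficients of B_h minus the multiple of X^n that cancels its mean against X^n over the circle.\<close>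

definition \<gamma> :: "nat \<Rightarrow> real" where
  "\<gamma> j = \<beta> j - (if j = h then L / cos_moment (2 * h) else 0)"

text \<open>The weight of \<open>\<gamma> j\<close> is the integral of cos^(2(h+j)-2) sin^2 over a
  period, so this is the mean of the corrected B against X^(n-2) Y^2 on the unit circle, up to the
  factor 2 pi.\<close>

definition \<kappa> :: real where
  "\<kappa> = (\<Sum>j\<le>h. \<gamma> j * (cos_moment (h + j) / (2 * real h + 2 * real j - 1)))"

lemma \<gamma>_sum: "(\<Sum>j\<le>h. \<gamma> j * f j) = (\<Sum>j\<le>h. \<beta> j * f j) - L / cos_moment (2 * h) * f h"
proof -
  have "(\<Sum>j\<le>h. \<gamma> j * f j) = (\<Sum>j\<le>h. \<beta> j * f j) - (\<Sum>j\<le>h. if j = h then L / cos_moment (2 * h) * f h else 0)"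
    unfolding sum_subtractf[symmetric] by (intro sum.cong) (auto simp: \<gamma>_def algebra_simps)
  then show ?thesis by simp
qed

text \<open>The normalization for which the correction was chosen; it removes the unwanted part of
  the second-order coefficient.\<close>

lemma \<gamma>_moment_zero: "(\<Sum>j\<le>h. \<gamma> j * cos_moment (h + j)) = 0"
  unfolding \<gamma>_sum L_def[symmetric] using cos_moment_pos[of "2 * h"] by (simp add: mult_2)

text \<open>Green's identity for b'' + b = cos^n against cos^n expresses the uncorrected sum S by
  the Wallis integral and L. The outcome is n (n - 1) (2n - 1) \<open>\<kappa>\<close> = (2n - 1)
  \<open>cos_moment (2 * h)\<close> + (n - 1)^2 L, in which both terms are nonnegative and the first
  is positive.\<close>

lemma \<kappa>_pos:
  assumes "h \<ge> 1" shows "\<kappa> > 0"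
proof -
  obtain g where g: "h = Suc g" using assms by (cases h) auto
  define n where "n = 2 * real h"
  have n: "n \<ge> 2" using assms by (simp add: n_def)
  let ?b = "\<lambda>t. oscB h (cos t) (sin t)" and ?a = "\<lambda>t. oscA h (cos t) (sin t)"
  define S where "S = (\<Sum>j\<le>h. \<beta> j * (cos_moment (h + j) / (2 * real h + 2 * real j - 1)))"
  have S: "((\<lambda>t. cos t ^ (2 * g) * (sin t)\<^sup>2 * ?b t) has_integral S) {0..2*pi}"
  proof -
    have "((\<lambda>t. \<Sum>j\<le>h. \<beta> j * (cos t ^ (2 * (g + j)) * (sin t)\<^sup>2)) has_integral
       (\<Sum>j\<le>h. \<beta> j * (cos_moment (Suc (g + j)) / (2 * real (g + j) + 1)))) {0..2*pi}"
      by (intro has_integral_sum has_integral_mult_right sin2_cos_power_integral) simp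
    moreover have "(\<Sum>j\<le>h. \<beta> j * (cos_moment (Suc (g + j)) / (2 * real (g + j) + 1))) = S"
      unfolding S_def by (intro sum.cong) (auto simp: g algebra_simps simp del: cos_moment.simps)
    moreover have "(\<Sum>j\<le>h. \<beta> j * (cos t ^ (2 * (g + j)) * (sin t)\<^sup>2)) = cos t ^ (2 * g) * (sin t)\<^sup>2 * ?b t" for t
      unfolding oscB_eq sum_distrib_left by (intro sum.cong) (auto simp: power_add distrib_left)
    ultimately show ?thesis by simp
  qed
  \<comment> \<open>The function differentiated is cos^n b' - (cos^n)' b, where b' is
    \<open>?a\<close>.\<close>
  have "((\<lambda>t. cos t ^ (2 * h) * ?a t + n * (cos t ^ (2 * g + 1) * sin t) * ?b t) has_real_derivative
     cos t ^ (2 * (2 * h)) + (n - 1) * (?b t * cos t ^ (2 * h)) - n * (n - 1) * (cos t ^ (2 * g) * (sin t)\<^sup>2 * ?b t)) (at t)" for t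
  proof -
    have a: "(?a has_real_derivative cos t ^ (2 * h) - ?b t) (at t)" and b: "(?b has_real_derivative ?a t) (at t)"
      by (rule has_derivative_oscA_rotation has_derivative_oscB_rotation; auto intro!: derivative_eq_intros)+
    have p: "((\<lambda>t. cos t ^ (2 * h)) has_real_derivative - (n * cos t ^ (2 * g + 1) * sin t)) (at t)"
      by (rule DERIV_cong[OF DERIV_power[OF DERIV_cos]]) (simp add: n_def g)
    have q: "((\<lambda>t. n * (cos t ^ (2 * g + 1) * sin t)) has_real_derivative n * (cos t ^ (2 * h) - (n - 1) * cos t ^ (2 * g) * (sin t)\<^sup>2)) (at t)"
      by (rule DERIV_cong[OF DERIV_cmult[OF DERIV_mult[OF DERIV_power[OF DERIV_cos] DERIV_sin]]])
         (simp add: n_def g power2_eq_square algebra_simps)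
    have "((\<lambda>t. cos t ^ (2 * h) * ?a t + n * (cos t ^ (2 * g + 1) * sin t) * ?b t) has_real_derivative
      (- (n * cos t ^ (2 * g + 1) * sin t) * ?a t + (cos t ^ (2 * h) - ?b t) * cos t ^ (2 * h)) +
      (n * (cos t ^ (2 * h) - (n - 1) * cos t ^ (2 * g) * (sin t)\<^sup>2) * ?b t + ?a t * (n * (cos t ^ (2 * g + 1) * sin t)))) (at t)"
      by (intro DERIV_add DERIV_mult a b p q)
    moreover have "(- (n * u * s) * A + (c - B) * c) + (n * (c - (n - 1) * v * s2) * B + A * (n * (u * s)))
       = c * c + (n - 1) * (B * c) - n * (n - 1) * (v * s2 * B)" for u s A c B v s2 :: real
      by (simp add: algebra_simps)
    moreover have "cos t ^ (2 * (2 * h)) = cos t ^ (2 * h) * cos t ^ (2 * h)"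
      unfolding power_add[symmetric] by (intro arg_cong[of _ _ "power (cos t)"]) simp
    ultimately show ?thesis by metis
  qed
  then have "((\<lambda>t. cos t ^ (2 * (2 * h)) + (n - 1) * (?b t * cos t ^ (2 * h)) - n * (n - 1) * (cos t ^ (2 * g) * (sin t)\<^sup>2 * ?b t)) has_integral 0) {0..2*pi}"
    by (rule periodic_deriv_integral) simp
  moreover have "((\<lambda>t. cos t ^ (2 * (2 * h)) + (n - 1) * (?b t * cos t ^ (2 * h)) - n * (n - 1) * (cos t ^ (2 * g) * (sin t)\<^sup>2 * ?b t)) has_integral
     cos_moment (2 * h) + (n - 1) * L - n * (n - 1) * S) {0..2*pi}"
    by (intro has_integral_add has_integral_diff has_integral_mult_right cos_power_integral L_integral S)
  ultimately have e: "cos_moment (2 * h) + (n - 1) * L - n * (n - 1) * S = 0" by (rule has_integral_unique[rotated])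
  have "\<kappa> = S - L / cos_moment (2 * h) * (cos_moment (h + h) / (2 * real h + 2 * real h - 1))"
    unfolding \<kappa>_def S_def by (rule \<gamma>_sum)
  moreover have "h + h = 2 * h" "2 * real h + 2 * real h - 1 = 2 * n - 1" by (simp_all add: n_def)
  ultimately have "\<kappa> = S - L / cos_moment (2 * h) * (cos_moment (2 * h) / (2 * n - 1))" by metis
  then have k: "\<kappa> = S - L / (2 * n - 1)" using cos_moment_pos[of "2 * h"] by simp
  have "n * (n - 1) * (2 * n - 1) * \<kappa> = (2 * n - 1) * (n * (n - 1) * S) - n * (n - 1) * L"
  proof -
    have "n * (n - 1) * (q * (S - z)) = q * (n * (n - 1) * S) - n * (n - 1) * (z * q)" for q z
      by (simp add: algebra_simps)
    from this[of "2 * n - 1" "L / (2 * n - 1)"] show ?thesis unfolding k using n by (simp add: mult.assoc)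
  qed
  also have "n * (n - 1) * S = cos_moment (2 * h) + (n - 1) * L" using e by simp
  also have "(2 * n - 1) * (cos_moment (2 * h) + (n - 1) * L) - n * (n - 1) * L
     = (2 * n - 1) * cos_moment (2 * h) + (n - 1) * (n - 1) * L" by (simp add: algebra_simps)
  also have "\<dots> > 0" using n L_pos cos_moment_pos[of "2 * h"]
    by (intro add_pos_nonneg mult_pos_pos mult_nonneg_nonneg) auto
  finally have "0 < n * (n - 1) * (2 * n - 1) * \<kappa>" .
  moreover have "n * (n - 1) * (2 * n - 1) > 0" using n by (intro mult_pos_pos) auto
  ultimately show ?thesis by (rule zero_less_mult_pos)
qed

text \<open>The contribution of one pair to the mean condition after V' has been replaced by the
  value that the straight orbits force; \<open>shared_second_order\<close> uses it in this
  role.\<close>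

definition oscN :: "real \<Rightarrow> real \<Rightarrow> real \<Rightarrow> real \<Rightarrow> real" where
  "oscN X Y X' Y' = oscJ h X Y X' Y'
     - L / cos_moment (2 * h) * integral {0..2*pi} (\<lambda>t. (rotX X Y t * rotX X' Y' t) ^ (2 * h))"

lemma oscN_integral:
  "((\<lambda>t. \<Sum>j\<le>h. \<gamma> j * (X\<^sup>2 + Y\<^sup>2) ^ (h - j) * rotX X Y t ^ (2 * j) * rotX X' Y' t ^ (2 * h)) has_integral oscN X Y X' Y') {0..2*pi}"
proof -
  have "((\<lambda>t. (rotX X Y t * rotX X' Y' t) ^ (2 * h)) has_integral
     integral {0..2*pi} (\<lambda>t. (rotX X Y t * rotX X' Y' t) ^ (2 * h))) {0..2*pi}"
    by (intro integrable_integral integrable_continuous_interval continuous_intros)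
  from has_integral_diff[OF oscJ_integral[of h X Y X' Y'] has_integral_mult_right[OF this, of "L / cos_moment (2 * h)"]]
  have 1: "((\<lambda>t. oscB h (rotX X Y t) (rotY X Y t) * rotX X' Y' t ^ (2 * h)
      - L / cos_moment (2 * h) * (rotX X Y t * rotX X' Y' t) ^ (2 * h)) has_integral oscN X Y X' Y') {0..2*pi}"
    unfolding oscN_def .
  have 2: "(\<Sum>j\<le>h. \<gamma> j * (X\<^sup>2 + Y\<^sup>2) ^ (h - j) * rotX X Y t ^ (2 * j) * rotX X' Y' t ^ (2 * h))
    = oscB h (rotX X Y t) (rotY X Y t) * rotX X' Y' t ^ (2 * h)
      - L / cos_moment (2 * h) * (rotX X Y t * rotX X' Y' t) ^ (2 * h)" for t
    unfolding mult.assoc \<gamma>_sum oscB_eq rot_norm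
    by (simp add: sum_distrib_left sum_distrib_right power_mult_distrib mult_ac)
  show ?thesis using 1 unfolding 2 .
qed

text \<open>Scaling Y and Y' by e makes the average a polynomial in e. The vanishing moment of
  \<open>\<gamma>\<close> is exactly what completes its second-order coefficient to the square of a
  determinant.\<close>

lemma oscN_second_order:
  assumes "h \<ge> 1"
  obtains R where "\<And>e. poly R e = oscN X (e * Y) X' (e * Y')"
    "coeff R 2 = \<kappa> * (real h * (2 * real h - 1)) * ((X * X') ^ (2 * h - 2) * (X * Y' - X' * Y)\<^sup>2)"
proof -
  obtain g where g: "h = Suc g" using assms by (cases h) auto
  define P where "P t = (\<Sum>j\<le>h. [:\<gamma> j:] * ([:X\<^sup>2, 0, Y\<^sup>2:] ^ (h - j)
     * ([:cos t * X, - (sin t * Y):] ^ (2 * j) * [:cos t * X', - (sin t * Y'):] ^ (2 * h))))" for t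
  have "cont_poly_family P"
    unfolding P_def
    by (intro cont_poly_family_sum cont_poly_family_mult cont_poly_family_power cont_poly_family_const
        cont_poly_family_linear continuous_intros)
  then obtain R where R: "\<And>e. ((\<lambda>t. poly (P t) e) has_integral poly R e) {0..2*pi}"
    "\<And>r. ((\<lambda>t. coeff (P t) r) has_integral coeff R r) {0..2*pi}"
    by (rule cont_poly_family_integral) blast
  have 1: "poly R e = oscN X (e * Y) X' (e * Y')" for e
  proof -
    have "poly (P t) e = (\<Sum>j\<le>h. \<gamma> j * (X\<^sup>2 + (e * Y)\<^sup>2) ^ (h - j) * rotX X (e * Y) t ^ (2 * j) * rotX X' (e * Y') t ^ (2 * h))" for t
      unfolding P_def poly_sum
      by (intro sum.cong) (auto simp: poly_power power2_eq_square mult_ac)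
    then show ?thesis using R(1)[of e] oscN_integral[of X "e * Y" X' "e * Y'"] has_integral_unique by simp
  qed
  \<comment> \<open>The monomials carrying Y^2, Y Y' and Y'^2; the target is the combination U - 2 V
    + Z.\<close>
  define U where "U = Y\<^sup>2 * X ^ (2 * g) * X' ^ (2 * h)"
  define V where "V = Y * Y' * (X * X') ^ (2 * g + 1)"
  define Z where "Z = Y'\<^sup>2 * X ^ (2 * h) * X' ^ (2 * g)"
  let ?n2 = "real h * (2 * real h - 1)"
  have coef: "coeff ([:X\<^sup>2, 0, Y\<^sup>2:] ^ (h - j)
     * ([:cos t * X, - (sin t * Y):] ^ (2 * j) * [:cos t * X', - (sin t * Y'):] ^ (2 * h))) 2
     = cos t ^ (2 * (g + j)) * (sin t)\<^sup>2 * (real j * (2 * real j - 1) * U + 2 * real j * (2 * real h) * V + ?n2 * Z)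
       + real (h - j) * cos t ^ (2 * (h + j)) * U" if "j \<le> h" for t j
  proof -
    let ?c = "cos t" and ?s = "sin t"
    have ch: "real (2 * i choose 2) = real i * (2 * real i - 1)" for i
      by (cases i) (auto simp: choose_two field_simps)
    \<comment> \<open>The four sources of e^2: both factors from the power of the first point (T1),
      one factor from each point (T2), both from the second point (T3), and one from the norm of the
      first point (T4).\<close>
    have T1: "(X\<^sup>2) ^ (h - j) * (real j * (2 * real j - 1) * (?c * X) ^ (2 * j - 2) * (- (?s * Y))\<^sup>2 * (?c * X') ^ (2 * h))
       = ?c ^ (2 * (g + j)) * ?s\<^sup>2 * (real j * (2 * real j - 1) * U)"
    proof (cases j)
      case (Suc i)
      have X: "X ^ (2 * g) = (X\<^sup>2) ^ (h - j) * X ^ (2 * i)"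
        unfolding power_mult[symmetric] power_add[symmetric] using that Suc g
        by (intro arg_cong[of _ _ "power X"]) simp
      have C: "?c ^ (2 * (g + j)) = ?c ^ (2 * i) * ?c ^ (2 * h)"
        unfolding power_add[symmetric] using Suc g by (intro arg_cong[of _ _ "power (cos t)"]) simp
      have J: "2 * j - 2 = 2 * i" using Suc by simp
      show ?thesis unfolding U_def X C J power_mult_distrib power2_minus by (simp only: mult_ac)
    qed simp
    have T2: "(X\<^sup>2) ^ (h - j) * (real (2 * j) * (?c * X) ^ (2 * j - 1) * (- (?s * Y)) * (real (2 * h) * (?c * X') ^ (2 * h - 1) * (- (?s * Y'))))
       = ?c ^ (2 * (g + j)) * ?s\<^sup>2 * (2 * real j * (2 * real h) * V)"
    proof (cases j)
      case (Suc i)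
      have X: "X ^ (2 * g + 1) = (X\<^sup>2) ^ (h - j) * X ^ (2 * i + 1)"
        unfolding power_mult[symmetric] power_add[symmetric] using that Suc g
        by (intro arg_cong[of _ _ "power X"]) simp
      have C: "?c ^ (2 * (g + j)) = ?c ^ (2 * i + 1) * ?c ^ (2 * g + 1)"
        unfolding power_add[symmetric] using Suc g by (intro arg_cong[of _ _ "power (cos t)"]) simp
      have J: "2 * j - 1 = 2 * i + 1" "2 * h - 1 = 2 * g + 1" using Suc g by simp_all
      show ?thesis unfolding V_def J power_mult_distrib X C power2_eq_square of_nat_mult of_nat_numeral
        by (simp only: mult_ac mult_minus_left mult_minus_right minus_minus)
    qed simp
    have T3: "(X\<^sup>2) ^ (h - j) * ((?c * X) ^ (2 * j) * (?n2 * (?c * X') ^ (2 * h - 2) * (- (?s * Y'))\<^sup>2))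
       = ?c ^ (2 * (g + j)) * ?s\<^sup>2 * (?n2 * Z)"
    proof -
      have X: "X ^ (2 * h) = (X\<^sup>2) ^ (h - j) * X ^ (2 * j)"
        unfolding power_mult[symmetric] power_add[symmetric] using that
        by (intro arg_cong[of _ _ "power X"]) simp
      have C: "?c ^ (2 * (g + j)) = ?c ^ (2 * j) * ?c ^ (2 * g)"
        unfolding power_add[symmetric] by (intro arg_cong[of _ _ "power (cos t)"]) simp
      have J: "2 * h - 2 = 2 * g" using g by simp
      show ?thesis unfolding Z_def X C J power_mult_distrib power2_minus by (simp only: mult_ac)
    qed
    have T4: "real (h - j) * (X\<^sup>2) ^ (h - j - 1) * Y\<^sup>2 * ((?c * X) ^ (2 * j) * (?c * X') ^ (2 * h))
       = real (h - j) * ?c ^ (2 * (h + j)) * U"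
    proof (cases "h - j")
      case (Suc i)
      have X: "X ^ (2 * g) = (X\<^sup>2) ^ i * X ^ (2 * j)"
        unfolding power_mult[symmetric] power_add[symmetric] using that Suc g
        by (intro arg_cong[of _ _ "power X"]) simp
      have C: "?c ^ (2 * (h + j)) = ?c ^ (2 * j) * ?c ^ (2 * h)"
        unfolding power_add[symmetric] by (intro arg_cong[of _ _ "power (cos t)"]) simp
      show ?thesis unfolding U_def X C power_mult_distrib Suc diff_Suc_1 by (simp only: mult_ac)
    qed simp
    have "coeff ([:X\<^sup>2, 0, Y\<^sup>2:] ^ (h - j)
     * ([:cos t * X, - (sin t * Y):] ^ (2 * j) * [:cos t * X', - (sin t * Y'):] ^ (2 * h))) 2
     = (X\<^sup>2) ^ (h - j) * (real j * (2 * real j - 1) * (?c * X) ^ (2 * j - 2) * (- (?s * Y))\<^sup>2 * (?c * X') ^ (2 * h))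
      + (X\<^sup>2) ^ (h - j) * (real (2 * j) * (?c * X) ^ (2 * j - 1) * (- (?s * Y)) * (real (2 * h) * (?c * X') ^ (2 * h - 1) * (- (?s * Y'))))
      + (X\<^sup>2) ^ (h - j) * ((?c * X) ^ (2 * j) * (?n2 * (?c * X') ^ (2 * h - 2) * (- (?s * Y'))\<^sup>2))
      + real (h - j) * (X\<^sup>2) ^ (h - j - 1) * Y\<^sup>2 * ((?c * X) ^ (2 * j) * (?c * X') ^ (2 * h))"
      unfolding coeff_mult_upto_2 coeff_linear_power_upto_2 coeff_even_quadratic_power_upto_2 ch by (simp only: algebra_simps mult_zero_left)
    then show ?thesis unfolding T1 T2 T3 T4 by (simp only: algebra_simps)
  qed
  have int: "((\<lambda>t. coeff (P t) 2) has_integral (\<Sum>j\<le>h. \<gamma> j *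
      (cos_moment (Suc (g + j)) / (2 * real (g + j) + 1) * (real j * (2 * real j - 1) * U + 2 * real j * (2 * real h) * V + ?n2 * Z)
       + real (h - j) * cos_moment (h + j) * U))) {0..2*pi}"
  proof -
    have "((\<lambda>t. \<Sum>j\<le>h. \<gamma> j * (cos t ^ (2 * (g + j)) * (sin t)\<^sup>2 * (real j * (2 * real j - 1) * U + 2 * real j * (2 * real h) * V + ?n2 * Z)
       + real (h - j) * cos t ^ (2 * (h + j)) * U)) has_integral (\<Sum>j\<le>h. \<gamma> j *
      (cos_moment (Suc (g + j)) / (2 * real (g + j) + 1) * (real j * (2 * real j - 1) * U + 2 * real j * (2 * real h) * V + ?n2 * Z)
       + real (h - j) * cos_moment (h + j) * U))) {0..2*pi}"
      by (intro has_integral_sum has_integral_add has_integral_mult_right has_integral_mult_left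
          sin2_cos_power_integral cos_power_integral) simp
    moreover have "coeff (P t) 2 = (\<Sum>j\<le>h. \<gamma> j * (cos t ^ (2 * (g + j)) * (sin t)\<^sup>2 * (real j * (2 * real j - 1) * U + 2 * real j * (2 * real h) * V + ?n2 * Z)
       + real (h - j) * cos t ^ (2 * (h + j)) * U))" for t
      unfolding P_def coeff_sum by (intro sum.cong refl) (simp add: coef)
    ultimately show ?thesis by simp
  qed
  have "coeff R 2 = (\<Sum>j\<le>h. \<gamma> j *
      (cos_moment (Suc (g + j)) / (2 * real (g + j) + 1) * (real j * (2 * real j - 1) * U + 2 * real j * (2 * real h) * V + ?n2 * Z)
       + real (h - j) * cos_moment (h + j) * U))"
    by (rule has_integral_unique[OF R(2) int])
  \<comment> \<open>Writing the moment as K (2h + 2j - 1), the U-terms from T1 and T4 add up to h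
    (2h - 1) K, free of j. The coefficient 4 h j K of V is -2 h (2h - 1) K plus 2 h times the
    moment, and this last part sums to zero.\<close>
  also have "\<dots> = (\<Sum>j\<le>h. (?n2 * (U + Z) - 2 * ?n2 * V) * (\<gamma> j * (cos_moment (h + j) / (2 * real h + 2 * real j - 1)))
       + 2 * real h * V * (\<gamma> j * cos_moment (h + j)))"
  proof (intro sum.cong refl)
    fix j assume "j \<in> {..h}"
    then have j: "real (h - j) = real h - real j" by simp
    define q where "q = 2 * real h + 2 * real j - 1"
    have q: "q \<noteq> 0" "2 * real (g + j) + 1 = q" using g by (auto simp: q_def)
    define K where "K = cos_moment (h + j) / q"
    have K: "cos_moment (h + j) = K * (2 * real h + 2 * real j - 1)" using q(1) unfolding K_def q_def by simp
    have gj: "Suc (g + j) = h + j" using g by simp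
    show "\<gamma> j * (cos_moment (Suc (g + j)) / (2 * real (g + j) + 1) * (real j * (2 * real j - 1) * U + 2 * real j * (2 * real h) * V + ?n2 * Z)
       + real (h - j) * cos_moment (h + j) * U)
     = (?n2 * (U + Z) - 2 * ?n2 * V) * (\<gamma> j * (cos_moment (h + j) / (2 * real h + 2 * real j - 1)))
       + 2 * real h * V * (\<gamma> j * cos_moment (h + j))"
      unfolding gj q(2) j q_def[symmetric] K_def[symmetric] unfolding K
      by (simp add: algebra_simps)
  qed
  also have "\<dots> = (?n2 * (U + Z) - 2 * ?n2 * V) * \<kappa>"
    unfolding sum.distrib sum_distrib_left[symmetric] \<kappa>_def[symmetric] \<gamma>_moment_zero by simp
  also have "\<dots> = \<kappa> * ?n2 * ((X * X') ^ (2 * h - 2) * (X * Y' - X' * Y)\<^sup>2)"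
  proof -
    have "U + Z - 2 * V = (X * X') ^ (2 * g) * (X * Y' - X' * Y)\<^sup>2"
      unfolding U_def V_def Z_def g by (simp add: power2_eq_square power_mult_distrib algebra_simps)
    moreover have "(?n2 * (U + Z) - 2 * ?n2 * V) * \<kappa> = \<kappa> * ?n2 * (U + Z - 2 * V)" by (simp add: algebra_simps)
    moreover have "2 * h - 2 = 2 * g" using g by simp
    ultimately show ?thesis by simp
  qed
  finally show ?thesis using that[of R] 1 by blast
qed

end

subsection \<open>Potentials that are sums of powers of linear forms\<close>

definition pot_average :: "nat \<Rightarrow> (nat \<Rightarrow> real) \<Rightarrow> real \<Rightarrow> real \<Rightarrow> real \<Rightarrow> real \<Rightarrow> real" where
  "pot_average d w x1 x2 y1 y2 = integral {0..2*pi} (\<lambda>t. pot d w (rotX x1 y1 t) (rotX x2 y2 t))"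

lemma pot_average_integral:
  "((\<lambda>t. pot d w (rotX x1 y1 t) (rotX x2 y2 t)) has_integral pot_average d w x1 x2 y1 y2) {0..2*pi}"
  unfolding pot_average_def
  by (intro integrable_integral integrable_continuous_interval) (unfold pot_def, intro continuous_intros)

text \<open>The potential is the sum of a_i (l_i q_1 + m_i q_2)^(2h+1). The locale is used twice:
  with the forms i q_1 + q_2 for an arbitrary potential, and with two orthonormal forms for a
  separable one.\<close>

locale power_sum = oscB_coeffs +
  fixes I :: "nat set" and a l m :: "nat \<Rightarrow> real"
  assumes fin: "finite I" and h1: "h \<ge> 1"
begin

definition \<xi> :: "nat \<Rightarrow> real \<Rightarrow> real \<Rightarrow> real" where
  "\<xi> i x1 x2 = l i * x1 + m i * x2"

text \<open>The weighted Gram matrix of the linear forms: the bracket of W pairs gradients, so each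
  pair of powers is weighted by an inner product.\<close>

definition g :: "nat \<Rightarrow> nat \<Rightarrow> real" where
  "g i k = a i * a k * (l i * l k + m i * m k)"

definition W :: fun4 where
  "W = (\<lambda>x1 x2 y1 y2. \<Sum>i\<in>I. a i * oscW h (\<xi> i x1 x2) (\<xi> i y1 y2))"

lemma W_grad:
  "grad4 W
    (\<lambda>x1 x2 y1 y2. \<Sum>i\<in>I. a i * ((2 * real h + 1) * (oscA h (\<xi> i x1 x2) (\<xi> i y1 y2) * l i)))
    (\<lambda>x1 x2 y1 y2. \<Sum>i\<in>I. a i * ((2 * real h + 1) * (oscA h (\<xi> i x1 x2) (\<xi> i y1 y2) * m i)))
    (\<lambda>x1 x2 y1 y2. \<Sum>i\<in>I. a i * ((2 * real h + 1) * (oscB h (\<xi> i x1 x2) (\<xi> i y1 y2) * l i)))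
    (\<lambda>x1 x2 y1 y2. \<Sum>i\<in>I. a i * ((2 * real h + 1) * (oscB h (\<xi> i x1 x2) (\<xi> i y1 y2) * m i)))"
  unfolding W_def
proof (rule grad4_sum)
  fix i
  show "grad4 (\<lambda>x1 x2 y1 y2. a i * oscW h (\<xi> i x1 x2) (\<xi> i y1 y2))
     (\<lambda>x1 x2 y1 y2. a i * ((2 * real h + 1) * (oscA h (\<xi> i x1 x2) (\<xi> i y1 y2) * l i)))
     (\<lambda>x1 x2 y1 y2. a i * ((2 * real h + 1) * (oscA h (\<xi> i x1 x2) (\<xi> i y1 y2) * m i)))
     (\<lambda>x1 x2 y1 y2. a i * ((2 * real h + 1) * (oscB h (\<xi> i x1 x2) (\<xi> i y1 y2) * l i)))
     (\<lambda>x1 x2 y1 y2. a i * ((2 * real h + 1) * (oscB h (\<xi> i x1 x2) (\<xi> i y1 y2) * m i)))"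
    unfolding grad4_def \<xi>_def
    by (intro allI impI, rule DERIV_cong, rule DERIV_cmult[OF oscW_deriv],
        (rule DERIV_add DERIV_cmult | assumption)+) (simp add: algebra_simps)
qed

lemmas W_pd = grad4_pd[OF W_grad]

lemma polyfun4_\<xi>: "polyfun4 (\<lambda>x1 x2 y1 y2. \<xi> i x1 x2)" "polyfun4 (\<lambda>x1 x2 y1 y2. \<xi> i y1 y2)"
  unfolding \<xi>_def by (intro polyfun4_intros)+

lemma hom_poly_W: "hom_poly (2 * h + 1) W"
proof -
  have "polyfun4 W" unfolding W_def
    by (intro polyfun4_sum polyfun4_mult polyfun4_const polyfun4_osc(3) polyfun4_\<xi>)
  moreover have "W (s*x1) (s*x2) (s*y1) (s*y2) = s ^ (2 * h + 1) * W x1 x2 y1 y2" for s x1 x2 y1 y2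
  proof -
    have s: "\<xi> i (s * u) (s * v) = s * \<xi> i u v" for i u v by (simp add: \<xi>_def algebra_simps)
    show ?thesis unfolding W_def s oscW_scale sum_distrib_left by (intro sum.cong) (auto simp: mult_ac)
  qed
  ultimately show ?thesis by (simp add: hom_poly_iff)
qed

lemma Dop_W: "Dop W = (\<lambda>x1 x2 y1 y2. \<Sum>i\<in>I. a i * \<xi> i x1 x2 ^ (2 * h + 1))"
proof (intro ext)
  fix x1 x2 y1 y2
  have "Dop W x1 x2 y1 y2 = (\<Sum>i\<in>I. a i * ((2 * real h + 1) *
      (\<xi> i x1 x2 * oscB h (\<xi> i x1 x2) (\<xi> i y1 y2) - \<xi> i y1 y2 * oscA h (\<xi> i x1 x2) (\<xi> i y1 y2))))"
    unfolding Dop_pd W_pd sum_distrib_left sum.distrib[symmetric] sum_subtractf[symmetric]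
    by (intro sum.cong refl) (simp add: \<xi>_def algebra_simps)
  then show "Dop W x1 x2 y1 y2 = (\<Sum>i\<in>I. a i * \<xi> i x1 x2 ^ (2 * h + 1))"
    unfolding oscB_oscA_rotation .
qed

lemma quad_bracket_W:
  "quad_bracket W x1 x2 y1 y2 = (2 * real h + 1)\<^sup>2 / 2 * (\<Sum>i\<in>I. \<Sum>k\<in>I. g i k *
     (oscA h (\<xi> i x1 x2) (\<xi> i y1 y2) * oscA h (\<xi> k x1 x2) (\<xi> k y1 y2)
    - oscB h (\<xi> i x1 x2) (\<xi> i y1 y2) * oscB h (\<xi> k x1 x2) (\<xi> k y1 y2)))"
  unfolding quad_bracket_def W_pd power2_eq_square[of "sum _ _"] sum_product
  unfolding sum.distrib[symmetric] sum_subtractf[symmetric] sum_divide_distrib sum_distrib_left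
  by (intro sum.cong refl) (simp add: g_def power2_eq_square algebra_simps add_divide_distrib diff_divide_distrib)

text \<open>A linear form acts alike on x and y and therefore commutes with the flow, so an orbit in
  four dimensions becomes one rotating point for each form.\<close>

lemma \<xi>_rot:
  "\<xi> i (rotX x1 y1 t) (rotX x2 y2 t) = rotX (\<xi> i x1 x2) (\<xi> i y1 y2) t"
  "\<xi> i (rotY x1 y1 t) (rotY x2 y2 t) = rotY (\<xi> i x1 x2) (\<xi> i y1 y2) t"
  by (simp_all add: \<xi>_def algebra_simps)

lemma quad_bracket_W_average:
  "((\<lambda>t. on_flow (quad_bracket W) t x1 x2 y1 y2) has_integral
     - ((2 * real h + 1)\<^sup>2 / 2 * (\<Sum>i\<in>I. \<Sum>k\<in>I. g i k * oscJ h (\<xi> i x1 x2) (\<xi> i y1 y2) (\<xi> k x1 x2) (\<xi> k y1 y2)))) {0..2*pi}"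
proof -
  have "((\<lambda>t. on_flow (quad_bracket W) t x1 x2 y1 y2) has_integral
     (2 * real h + 1)\<^sup>2 / 2 * (\<Sum>i\<in>I. \<Sum>k\<in>I. g i k * - oscJ h (\<xi> i x1 x2) (\<xi> i y1 y2) (\<xi> k x1 x2) (\<xi> k y1 y2))) {0..2*pi}"
    unfolding on_flow_def quad_bracket_W \<xi>_rot
    by (intro has_integral_mult_right has_integral_sum fin oscA_oscB_integral)
  then show ?thesis by (simp add: sum_negf)
qed

lemma share_BGNF_power_sum:
  assumes v: "\<And>q1 q2. pot (2 * h + 1) v q1 q2 = (\<Sum>i\<in>I. a i * \<xi> i q1 q2 ^ (2 * h + 1))"
  shows "share_BGNF (PHO (2 * h + 1) v) (PHO (4 * h) w) (4 * h) \<longleftrightarrow>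
    (\<forall>x1 x2 y1 y2. (2 * real h + 1)\<^sup>2 / 2 * (\<Sum>i\<in>I. \<Sum>k\<in>I. g i k * oscJ h (\<xi> i x1 x2) (\<xi> i y1 y2) (\<xi> k x1 x2) (\<xi> k y1 y2))
        + pot_average (4 * h) w x1 x2 y1 y2 = 0)"
proof -
  let ?J = "\<lambda>x1 x2 y1 y2. (2 * real h + 1)\<^sup>2 / 2 * (\<Sum>i\<in>I. \<Sum>k\<in>I. g i k * oscJ h (\<xi> i x1 x2) (\<xi> i y1 y2) (\<xi> k x1 x2) (\<xi> k y1 y2))"
  have d: "2 * (2 * h + 1) - 2 = 4 * h" "3 \<le> 2 * h + 1" "odd (2 * h + 1)" using h1 by auto
  have DW: "Dop W = (\<lambda>x1 x2 y1 y2. pot (2 * h + 1) v x1 x2)" unfolding Dop_W v ..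
  have int: "((\<lambda>t. on_flow (\<lambda>x1 x2 y1 y2. quad_bracket W x1 x2 y1 y2 - pot (4 * h) w x1 x2) t x1 x2 y1 y2) has_integral
     - ?J x1 x2 y1 y2 - pot_average (4 * h) w x1 x2 y1 y2) {0..2*pi}" for x1 x2 y1 y2
    using has_integral_diff[OF quad_bracket_W_average[of x1 x2 y1 y2] pot_average_integral[of "4 * h" w x1 y1 x2 y2]]
    unfolding on_flow_def by simp
  have "((\<lambda>t. on_flow (\<lambda>x1 x2 y1 y2. quad_bracket W x1 x2 y1 y2 - pot (4 * h) w x1 x2) t x1 x2 y1 y2) has_integral 0) {0..2*pi}
     \<longleftrightarrow> ?J x1 x2 y1 y2 + pot_average (4 * h) w x1 x2 y1 y2 = 0" for x1 x2 y1 y2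
  proof
    assume "((\<lambda>t. on_flow (\<lambda>x1 x2 y1 y2. quad_bracket W x1 x2 y1 y2 - pot (4 * h) w x1 x2) t x1 x2 y1 y2) has_integral 0) {0..2*pi}"
    from has_integral_unique[OF this int] show "?J x1 x2 y1 y2 + pot_average (4 * h) w x1 x2 y1 y2 = 0" by linarith
  next
    assume "?J x1 x2 y1 y2 + pot_average (4 * h) w x1 x2 y1 y2 = 0"
    then have "- ?J x1 x2 y1 y2 - pot_average (4 * h) w x1 x2 y1 y2 = 0" by linarith
    with int[of x1 x2 y1 y2] show "((\<lambda>t. on_flow (\<lambda>x1 x2 y1 y2. quad_bracket W x1 x2 y1 y2 - pot (4 * h) w x1 x2) t x1 x2 y1 y2) has_integral 0) {0..2*pi}"
      by metis
  qed
  then show ?thesis using share_BGNF_iff_average[OF d(3,2) hom_poly_W DW, of w] unfolding d(1) by simp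
qed

text \<open>The factor (2h+1)^2 / 2 comes from the bracket, L from its average along straight
  orbits, and \<open>cos_moment (2 * h)\<close> from the average of V' along them. The double sum
  multiplied by this constant in \<open>shared_potential\<close> is |grad V|^2 / (2h+1)^2.\<close>

definition \<Lambda> :: real where
  "\<Lambda> = (2 * real h + 1)\<^sup>2 / 2 * (L / cos_moment (2 * h))"

lemma \<Lambda>_pos: "\<Lambda> > 0"
proof -
  have "(2 * real h + 1)\<^sup>2 > 0" by (simp add: add_pos_pos pos_add_strict add_nonneg_pos)
  then show ?thesis unfolding \<Lambda>_def using L_pos cos_moment_pos by (intro mult_pos_pos divide_pos_pos) auto
qed

text \<open>On orbits through y = 0 the potential is cos^(4h) t times its initial value, so its
  average determines it, while \<open>oscJ_straight\<close> evaluates the average of the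
  bracket.\<close>

lemma shared_potential:
  assumes v: "\<And>q1 q2. pot (2 * h + 1) v q1 q2 = (\<Sum>i\<in>I. a i * \<xi> i q1 q2 ^ (2 * h + 1))"
    and share: "share_BGNF (PHO (2 * h + 1) v) (PHO (4 * h) w) (4 * h)"
  shows "pot (4 * h) w x1 x2 = - \<Lambda> * (\<Sum>i\<in>I. \<Sum>k\<in>I. g i k * (\<xi> i x1 x2 * \<xi> k x1 x2) ^ (2 * h))"
proof -
  let ?S = "\<Sum>i\<in>I. \<Sum>k\<in>I. g i k * (\<xi> i x1 x2 * \<xi> k x1 x2) ^ (2 * h)"
  have "((\<lambda>t. cos t ^ (2 * (2 * h)) * pot (4 * h) w x1 x2) has_integral cos_moment (2 * h) * pot (4 * h) w x1 x2) {0..2*pi}"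
    by (intro has_integral_mult_left cos_power_integral)
  moreover have "cos t ^ (2 * (2 * h)) * pot (4 * h) w x1 x2 = pot (4 * h) w (rotX x1 0 t) (rotX x2 0 t)" for t
    using pot_scale[of "4 * h" w "cos t" x1 x2] by simp
  ultimately have "((\<lambda>t. pot (4 * h) w (rotX x1 0 t) (rotX x2 0 t)) has_integral cos_moment (2 * h) * pot (4 * h) w x1 x2) {0..2*pi}"
    by simp
  then have 1: "pot_average (4 * h) w x1 x2 0 0 = cos_moment (2 * h) * pot (4 * h) w x1 x2"
    by (rule has_integral_unique[OF pot_average_integral])
  have 0: "\<xi> i 0 0 = 0" for i by (simp add: \<xi>_def)
  have 2: "(2 * real h + 1)\<^sup>2 / 2 * (\<Sum>i\<in>I. \<Sum>k\<in>I. g i k * oscJ h (\<xi> i x1 x2) (\<xi> i 0 0) (\<xi> k x1 x2) (\<xi> k 0 0))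
        + pot_average (4 * h) w x1 x2 0 0 = 0"
    using share unfolding share_BGNF_power_sum[OF v] by blast
  have 3: "(\<Sum>i\<in>I. \<Sum>k\<in>I. g i k * oscJ h (\<xi> i x1 x2) (\<xi> i 0 0) (\<xi> k x1 x2) (\<xi> k 0 0)) = L * ?S"
    unfolding 0 oscJ_straight sum_distrib_left by (intro sum.cong refl) (simp add: mult_ac)
  have "cos_moment (2 * h) * pot (4 * h) w x1 x2 = - ((2 * real h + 1)\<^sup>2 / 2 * (L * ?S))"
    using 2[unfolded 3 1] unfolding add_eq_0_iff by simp
  then have "pot (4 * h) w x1 x2 = - ((2 * real h + 1)\<^sup>2 / 2 * (L * ?S)) / cos_moment (2 * h)"
    using cos_moment_pos[of "2 * h"] by (simp add: field_simps)
  then show ?thesis unfolding \<Lambda>_def by simp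
qed

text \<open>Substituting the forced V' leaves the identity that the weighted sum of
  \<open>oscN\<close> vanishes on all orbits; its second-order part in y then gives the claim, since
  the common constant is nonzero.\<close>

lemma shared_second_order:
  assumes v: "\<And>q1 q2. pot (2 * h + 1) v q1 q2 = (\<Sum>i\<in>I. a i * \<xi> i q1 q2 ^ (2 * h + 1))"
    and share: "share_BGNF (PHO (2 * h + 1) v) (PHO (4 * h) w) (4 * h)"
  shows "(\<Sum>i\<in>I. \<Sum>k\<in>I. g i k * ((\<xi> i x1 x2 * \<xi> k x1 x2) ^ (2 * h - 2)
     * (\<xi> i x1 x2 * \<xi> k y1 y2 - \<xi> k x1 x2 * \<xi> i y1 y2)\<^sup>2)) = 0"
proof -
  let ?c = "(2 * real h + 1)\<^sup>2 / 2"
  have c: "?c \<noteq> 0" using \<Lambda>_pos unfolding \<Lambda>_def by auto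
  have N: "(\<Sum>i\<in>I. \<Sum>k\<in>I. g i k * oscN (\<xi> i x1 x2) (\<xi> i y1 y2) (\<xi> k x1 x2) (\<xi> k y1 y2)) = 0" for x1 x2 y1 y2
  proof -
    let ?M = "\<lambda>i k. integral {0..2*pi} (\<lambda>t. (rotX (\<xi> i x1 x2) (\<xi> i y1 y2) t * rotX (\<xi> k x1 x2) (\<xi> k y1 y2) t) ^ (2 * h))"
    have "((\<lambda>t. - \<Lambda> * (\<Sum>i\<in>I. \<Sum>k\<in>I. g i k * (rotX (\<xi> i x1 x2) (\<xi> i y1 y2) t * rotX (\<xi> k x1 x2) (\<xi> k y1 y2) t) ^ (2 * h)))
       has_integral - \<Lambda> * (\<Sum>i\<in>I. \<Sum>k\<in>I. g i k * ?M i k)) {0..2*pi}"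
      by (intro has_integral_mult_right has_integral_sum fin integrable_integral integrable_continuous_interval continuous_intros)
    then have "((\<lambda>t. pot (4 * h) w (rotX x1 y1 t) (rotX x2 y2 t)) has_integral - \<Lambda> * (\<Sum>i\<in>I. \<Sum>k\<in>I. g i k * ?M i k)) {0..2*pi}"
      unfolding shared_potential[OF v share] \<xi>_rot .
    then have 1: "pot_average (4 * h) w x1 x2 y1 y2 = - \<Lambda> * (\<Sum>i\<in>I. \<Sum>k\<in>I. g i k * ?M i k)"
      by (rule has_integral_unique[OF pot_average_integral])
    have "?c * (\<Sum>i\<in>I. \<Sum>k\<in>I. g i k * oscJ h (\<xi> i x1 x2) (\<xi> i y1 y2) (\<xi> k x1 x2) (\<xi> k y1 y2))
        + pot_average (4 * h) w x1 x2 y1 y2 = 0"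
      using share unfolding share_BGNF_power_sum[OF v] by blast
    then have "?c * (\<Sum>i\<in>I. \<Sum>k\<in>I. g i k * oscJ h (\<xi> i x1 x2) (\<xi> i y1 y2) (\<xi> k x1 x2) (\<xi> k y1 y2))
        - ?c * (L / cos_moment (2 * h) * (\<Sum>i\<in>I. \<Sum>k\<in>I. g i k * ?M i k)) = 0"
      unfolding 1 \<Lambda>_def by (simp only: mult_minus_left mult.assoc)
    moreover have "(\<Sum>i\<in>I. \<Sum>k\<in>I. g i k * oscN (\<xi> i x1 x2) (\<xi> i y1 y2) (\<xi> k x1 x2) (\<xi> k y1 y2))
      = (\<Sum>i\<in>I. \<Sum>k\<in>I. g i k * oscJ h (\<xi> i x1 x2) (\<xi> i y1 y2) (\<xi> k x1 x2) (\<xi> k y1 y2))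
        - L / cos_moment (2 * h) * (\<Sum>i\<in>I. \<Sum>k\<in>I. g i k * ?M i k)"
      unfolding oscN_def sum_distrib_left sum_subtractf[symmetric]
      by (intro sum.cong refl) (simp only: right_diff_distrib mult_ac)
    ultimately have "?c * (\<Sum>i\<in>I. \<Sum>k\<in>I. g i k * oscN (\<xi> i x1 x2) (\<xi> i y1 y2) (\<xi> k x1 x2) (\<xi> k y1 y2)) = 0"
      by (simp only: right_diff_distrib)
    then show ?thesis using c by simp
  qed
  have "\<exists>R. (\<forall>e. poly R e = oscN (\<xi> i x1 x2) (e * \<xi> i y1 y2) (\<xi> k x1 x2) (e * \<xi> k y1 y2)) \<and>
    coeff R 2 = \<kappa> * (real h * (2 * real h - 1)) * ((\<xi> i x1 x2 * \<xi> k x1 x2) ^ (2 * h - 2)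
      * (\<xi> i x1 x2 * \<xi> k y1 y2 - \<xi> k x1 x2 * \<xi> i y1 y2)\<^sup>2)" for i k
    by (rule oscN_second_order[OF h1, of "\<xi> i x1 x2" "\<xi> i y1 y2" "\<xi> k x1 x2" "\<xi> k y1 y2"]) blast
  then obtain R where R: "\<And>i k e. poly (R i k) e = oscN (\<xi> i x1 x2) (e * \<xi> i y1 y2) (\<xi> k x1 x2) (e * \<xi> k y1 y2)"
    "\<And>i k. coeff (R i k) 2 = \<kappa> * (real h * (2 * real h - 1)) * ((\<xi> i x1 x2 * \<xi> k x1 x2) ^ (2 * h - 2)
      * (\<xi> i x1 x2 * \<xi> k y1 y2 - \<xi> k x1 x2 * \<xi> i y1 y2)\<^sup>2)" by metis
  \<comment> \<open>The identity holds at (x, e y) for every e, so it is an identity between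
    polynomials in e and may be compared at degree 2.\<close>
  have "(\<Sum>i\<in>I. \<Sum>k\<in>I. smult (g i k) (R i k)) = 0"
  proof -
    have "poly (\<Sum>i\<in>I. \<Sum>k\<in>I. smult (g i k) (R i k)) e = 0" for e
    proof -
      have e: "e * \<xi> i y1 y2 = \<xi> i (e * y1) (e * y2)" for i by (simp add: \<xi>_def algebra_simps)
      show ?thesis unfolding poly_sum poly_smult R(1) e by (rule N)
    qed
    then show ?thesis using poly_all_0_iff_0 by blast
  qed
  then have "coeff (\<Sum>i\<in>I. \<Sum>k\<in>I. smult (g i k) (R i k)) 2 = 0" by simp
  then have "\<kappa> * (real h * (2 * real h - 1)) * (\<Sum>i\<in>I. \<Sum>k\<in>I. g i k * ((\<xi> i x1 x2 * \<xi> k x1 x2) ^ (2 * h - 2)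
     * (\<xi> i x1 x2 * \<xi> k y1 y2 - \<xi> k x1 x2 * \<xi> i y1 y2)\<^sup>2)) = 0"
    unfolding coeff_sum coeff_smult R(2) sum_distrib_left by (simp only: mult_ac)
  moreover have "\<kappa> * (real h * (2 * real h - 1)) \<noteq> 0" using \<kappa>_pos[OF h1] h1 by auto
  ultimately show ?thesis by simp
qed

text \<open>Orthogonality leaves the diagonal pairs, whose bracket averages are powers of the norms
  of the rotating points, the same shape as the averages of the powers of degree 4h. The constant
  \<open>\<Lambda>\<close> matches the two.\<close>

lemma share_BGNF_orthogonal:
  assumes v: "\<And>q1 q2. pot (2 * h + 1) v q1 q2 = (\<Sum>i\<in>I. a i * \<xi> i q1 q2 ^ (2 * h + 1))"
    and orth: "\<And>i k. i \<in> I \<Longrightarrow> k \<in> I \<Longrightarrow> i \<noteq> k \<Longrightarrow> g i k = 0"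
    and w: "\<And>q1 q2. pot (4 * h) w q1 q2 = - \<Lambda> * (\<Sum>i\<in>I. g i i * \<xi> i q1 q2 ^ (4 * h))"
  shows "share_BGNF (PHO (2 * h + 1) v) (PHO (4 * h) w) (4 * h)"
  unfolding share_BGNF_power_sum[OF v]
proof (intro allI)
  fix x1 x2 y1 y2
  let ?r = "\<lambda>i. (\<xi> i x1 x2)\<^sup>2 + (\<xi> i y1 y2)\<^sup>2"
  have "(\<Sum>k\<in>I. g i k * oscJ h (\<xi> i x1 x2) (\<xi> i y1 y2) (\<xi> k x1 x2) (\<xi> k y1 y2)) = g i i * (L * ?r i ^ (2 * h))" if "i \<in> I" for i
  proof -
    have "(\<Sum>k\<in>I. g i k * oscJ h (\<xi> i x1 x2) (\<xi> i y1 y2) (\<xi> k x1 x2) (\<xi> k y1 y2))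
       = (\<Sum>k\<in>{i}. g i k * oscJ h (\<xi> i x1 x2) (\<xi> i y1 y2) (\<xi> k x1 x2) (\<xi> k y1 y2))"
      using orth that fin by (intro sum.mono_neutral_right) auto
    then show ?thesis by (simp add: oscJ_diag)
  qed
  then have 1: "(\<Sum>i\<in>I. \<Sum>k\<in>I. g i k * oscJ h (\<xi> i x1 x2) (\<xi> i y1 y2) (\<xi> k x1 x2) (\<xi> k y1 y2)) = (\<Sum>i\<in>I. g i i * (L * ?r i ^ (2 * h)))"
    by simp
  have "((\<lambda>t. - \<Lambda> * (\<Sum>i\<in>I. g i i * rotX (\<xi> i x1 x2) (\<xi> i y1 y2) t ^ (2 * (2 * h)))) has_integral
     - \<Lambda> * (\<Sum>i\<in>I. g i i * (cos_moment (2 * h) * ?r i ^ (2 * h)))) {0..2*pi}"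
    by (intro has_integral_mult_right has_integral_sum fin rotX_power_integral)
  then have "((\<lambda>t. pot (4 * h) w (rotX x1 y1 t) (rotX x2 y2 t)) has_integral
     - \<Lambda> * (\<Sum>i\<in>I. g i i * (cos_moment (2 * h) * ?r i ^ (2 * h)))) {0..2*pi}"
    unfolding w \<xi>_rot by simp
  then have 2: "pot_average (4 * h) w x1 x2 y1 y2 = - \<Lambda> * (\<Sum>i\<in>I. g i i * (cos_moment (2 * h) * ?r i ^ (2 * h)))"
    by (rule has_integral_unique[OF pot_average_integral])
  have 3: "(\<Sum>i\<in>I. g i i * (z * ?r i ^ (2 * h))) = z * (\<Sum>i\<in>I. g i i * ?r i ^ (2 * h))" for z
    unfolding sum_distrib_left by (intro sum.cong) auto
  show "(2 * real h + 1)\<^sup>2 / 2 * (\<Sum>i\<in>I. \<Sum>k\<in>I. g i k * oscJ h (\<xi> i x1 x2) (\<xi> i y1 y2) (\<xi> k x1 x2) (\<xi> k y1 y2))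
        + pot_average (4 * h) w x1 x2 y1 y2 = 0"
    unfolding 1 2 3 \<Lambda>_def using cos_moment_pos[of "2 * h"] by simp
qed

end

subsection \<open>Separability\<close>

lemma cos_sin_squares_times: "y * (cos p * cos p) + y * (sin p * sin p) = (y::real)"
  unfolding distrib_left[symmetric] power2_eq_square[symmetric] by simp

lemma pderiv_sum: "pderiv (\<Sum>i\<in>I. p i) = (\<Sum>i\<in>I. pderiv (p i))"
  by (induction I rule: infinite_finite_induct) (simp_all add: pderiv_add)

lemma pot_power_sum:
  assumes "finite I"
  shows "pot d (\<lambda>r. \<Sum>i\<in>I. b i * l i ^ r * m i ^ (d - r)) q1 q2 = (\<Sum>i\<in>I. b i * (l i * q1 + m i * q2) ^ d)"
proof -
  have "(\<Sum>i\<in>I. b i * (l i * q1 + m i * q2) ^ d)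
      = (\<Sum>i\<in>I. \<Sum>r=0..d. b i * (real (d choose r) * (l i * q1) ^ r * (m i * q2) ^ (d - r)))"
    unfolding binomial_ring sum_distrib_left by (simp add: atMost_atLeast0)
  also have "\<dots> = (\<Sum>r=0..d. \<Sum>i\<in>I. b i * (real (d choose r) * (l i * q1) ^ r * (m i * q2) ^ (d - r)))"
    by (rule sum.swap)
  also have "\<dots> = pot d (\<lambda>r. \<Sum>i\<in>I. b i * l i ^ r * m i ^ (d - r)) q1 q2"
    unfolding pot_def sum_distrib_right
    by (intro sum.cong refl) (simp add: power_mult_distrib mult_ac)
  finally show ?thesis ..
qed

lemma pot_cong: "(\<And>r. r \<le> d \<Longrightarrow> v r = w r) \<Longrightarrow> pot d v q1 q2 = pot d w q1 q2"
  unfolding pot_def by (intro sum.cong) auto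

lemma pot_eq_0_coeffs:
  assumes "\<And>t. pot d v t 1 = 0" "r \<le> d"
  shows "v r = 0"
proof -
  have "\<forall>t. (\<Sum>r\<le>d. (v r * real (d choose r)) * t ^ r) = 0"
    using assms(1) by (simp add: pot_def atMost_atLeast0)
  then have "\<forall>r\<le>d. v r * real (d choose r) = 0" unfolding polyfun_eq_0 .
  then show ?thesis using assms(2) by (auto simp: binomial_eq_0_iff)
qed

text \<open>Dual form of Lagrange interpolation at the nodes 0, ..., d.\<close>

lemma moment_interpolation:
  fixes v :: "nat \<Rightarrow> real"
  shows "\<exists>b. \<forall>r\<le>d. (\<Sum>i\<le>d. b i * real i ^ r) = v r"
proof -
  define p where "p i = (\<Prod>k\<in>{..d}-{i}. smult (1 / (real i - real k)) [:- real k, 1:])" for i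
  have pp: "poly (p i) (real j) = (if j = i then 1 else 0)" if "i \<le> d" "j \<le> d" for i j
  proof (cases "j = i")
    case True
    have "poly (smult (1 / (real i - real k)) [:- real k, 1:]) (real i) = 1" if "k \<noteq> i" for k
    proof -
      have e: "poly [:- real k, 1:] (real i) = real i - real k" by simp
      show ?thesis unfolding poly_smult e using that by simp
    qed
    then show ?thesis unfolding p_def poly_prod using True by (auto intro!: prod.neutral simp del: poly_smult poly_pCons)
  next
    case False
    then show ?thesis unfolding p_def poly_prod using that by (auto intro!: prod_zero bexI[of _ j])
  qed
  have deg: "degree (p i) \<le> d" if "i \<le> d" for i
  proof -
    have "degree (p i) \<le> (\<Sum>k\<in>{..d}-{i}. degree (smult (1 / (real i - real k)) [:- real k, 1:]))"
      unfolding p_def by (rule degree_prod_sum_le[unfolded o_def]) simp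
    also have "\<dots> \<le> (\<Sum>k\<in>{..d}-{i}. 1)"
      by (intro sum_mono order_trans[OF degree_smult_le]) simp
    also have "\<dots> = d" using that by simp
    finally show ?thesis .
  qed
  have mon: "(\<Sum>i\<le>d. smult (real i ^ r) (p i)) = monom 1 r" if "r \<le> d" for r
  proof (rule ccontr)
    assume "(\<Sum>i\<le>d. smult (real i ^ r) (p i)) \<noteq> monom 1 r"
    then have nz: "(\<Sum>i\<le>d. smult (real i ^ r) (p i)) - monom 1 r \<noteq> 0" (is "?q \<noteq> 0") by simp
    have "degree ?q \<le> d"
      using deg that by (intro degree_diff_le degree_sum_le order_trans[OF degree_smult_le] order_trans[OF degree_monom_le]) auto
    moreover have "poly ?q (real j) = 0" if "j \<le> d" for j
    proof -
      have "(\<Sum>i\<le>d. real i ^ r * poly (p i) (real j)) = (\<Sum>i\<le>d. if i = j then real j ^ r else 0)"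
        using that by (intro sum.cong) (auto simp: pp)
      then show ?thesis using that by (simp add: poly_sum poly_monom)
    qed
    then have "real ` {..d} \<subseteq> {x. poly ?q x = 0}" by auto
    then have "card (real ` {..d}) \<le> card {x. poly ?q x = 0}"
      by (intro card_mono poly_roots_finite nz)
    then have "Suc d \<le> card {x. poly ?q x = 0}" by (simp add: card_image inj_on_def)
    moreover have "card {x. poly ?q x = 0} \<le> degree ?q" by (rule card_poly_roots_bound[OF nz])
    ultimately show False by simp
  qed
  have "(\<Sum>i\<le>d. (\<Sum>s\<le>d. v s * coeff (p i) s) * real i ^ r) = v r" if "r \<le> d" for r
  proof -
    have "(\<Sum>i\<le>d. (\<Sum>s\<le>d. v s * coeff (p i) s) * real i ^ r) = (\<Sum>s\<le>d. \<Sum>i\<le>d. v s * (real i ^ r * coeff (p i) s))"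
      unfolding sum_distrib_right by (subst sum.swap) (intro sum.cong refl, simp)
    also have "\<dots> = (\<Sum>s\<le>d. v s * coeff (monom 1 r) s)"
      unfolding mon[OF that, symmetric] coeff_sum coeff_smult sum_distrib_left ..
    also have "\<dots> = (\<Sum>s\<le>d. if s = r then v r else 0)" by (intro sum.cong) auto
    finally show ?thesis using that by simp
  qed
  then show ?thesis by (intro exI[of _ "\<lambda>i. \<Sum>s\<le>d. v s * coeff (p i) s"]) blast
qed

text \<open>Since \<open>pot\<close> already carries the binomial factors, the coefficient at r on
  the right is the r-th moment of b at the nodes 0, ..., d.\<close>

lemma pot_as_power_sum:
  "\<exists>b. \<forall>q1 q2. pot d v q1 q2 = (\<Sum>i\<le>d. b i * (real i * q1 + 1 * q2) ^ d)"
proof -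
  obtain b where b: "\<And>r. r \<le> d \<Longrightarrow> (\<Sum>i\<le>d. b i * real i ^ r) = v r"
    using moment_interpolation[of d v] by blast
  have "pot d v q1 q2 = pot d (\<lambda>r. \<Sum>i\<le>d. b i * real i ^ r * 1 ^ (d - r)) q1 q2" for q1 q2
    by (rule pot_cong) (simp add: b)
  then show ?thesis unfolding pot_power_sum[OF finite_atMost] by blast
qed

text \<open>At a point t with g(t) nonzero, F = g(t) f - f(t) g vanishes and still has zero
  Wronskian with g. If F were nonzero, F' g = F g' would make F' vanish at t to at least the order
  of F, but differentiation lowers the order by one.\<close>

lemma wronskian_zero_dependent:
  fixes f g :: "real poly"
  assumes "pderiv f * g = f * pderiv g"
  shows "\<exists>A B. (A, B) \<noteq> (0, 0) \<and> smult A f + smult B g = 0"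
proof (cases "g = 0")
  case True
  then show ?thesis by (intro exI[of _ 0] exI[of _ 1]) simp
next
  case False
  then obtain t where t: "poly g t \<noteq> 0" using poly_all_0_iff_0 by blast
  define F where "F = smult (poly g t) f + smult (- poly f t) g"
  have Ft: "poly F t = 0" by (simp add: F_def)
  have W: "pderiv F * g = F * pderiv g"
    using assms by (simp add: F_def pderiv_add pderiv_diff pderiv_smult algebra_simps)
  have "F = 0"
  proof (rule ccontr)
    assume F: "F \<noteq> 0"
    have dF: "pderiv F \<noteq> 0"
    proof
      assume "pderiv F = 0"
      then obtain c where "F = [:c:]" using pderiv_iszero by blast
      then show False using Ft F by simp
    qed
    have g: "order t g = 0" using t order_root by blast
    have dg: "pderiv g \<noteq> 0" using W dF False F by auto
    have "order t (pderiv F * g) = order t (F * pderiv g)" using W by simp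
    then have "order t (pderiv F) = order t F + order t (pderiv g)"
      using dF dg False F g by (simp add: order_mult)
    moreover have "order t F = Suc (order t (pderiv F))" by (rule order_pderiv[OF F Ft])
    ultimately show False by simp
  qed
  then show ?thesis using t unfolding F_def by (intro exI[of _ "poly g t"] exI[of _ "- poly f t"]) simp
qed

lemma double_sum_symmetrize:
  fixes F :: "'a \<Rightarrow> 'a \<Rightarrow> real"
  shows "(\<Sum>i\<in>I. \<Sum>k\<in>I. F i k) = (\<Sum>i\<in>I. \<Sum>k\<in>I. F i k + F k i) / 2"
proof -
  have "(\<Sum>i\<in>I. \<Sum>k\<in>I. F k i) = (\<Sum>i\<in>I. \<Sum>k\<in>I. F i k)" by (rule sum.swap)
  then show ?thesis by (simp add: sum.distrib)
qed

text \<open>The quadratic form A (l^2 - m^2) + B l m is traceless, so in a suitably rotated frame it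
  is a multiple of the product of the coordinates. The angle is half the polar angle of the point
  (B, 2 A).\<close>

lemma half_angle_exists:
  fixes A B :: real
  assumes "(A, B) \<noteq> (0, 0)"
  obtains R \<psi> where "R \<noteq> 0" "0 \<le> \<psi>" "\<psi> < 2 * pi" "A = R * (sin \<psi> * cos \<psi>)" "B = R * ((cos \<psi>)\<^sup>2 - (sin \<psi>)\<^sup>2)"
proof -
  define R where "R = sqrt ((2 * A)\<^sup>2 + B\<^sup>2)"
  have "(2 * A)\<^sup>2 + B\<^sup>2 > 0" by (subst sum_power2_gt_zero_iff) (use assms in auto)
  then have R: "R > 0" "R\<^sup>2 = (2 * A)\<^sup>2 + B\<^sup>2" by (simp_all add: R_def)
  have "(B / R)\<^sup>2 + (2 * A / R)\<^sup>2 = 1"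
  proof -
    have e: "(B / R)\<^sup>2 + (2 * A / R)\<^sup>2 = ((2 * A)\<^sup>2 + B\<^sup>2) / R\<^sup>2"
      by (simp add: power_divide add_divide_distrib)
    show ?thesis unfolding e R(2)[symmetric] using R(1) by simp
  qed
  then obtain p where p: "0 \<le> p" "p < 2 * pi" "B / R = cos p" "2 * A / R = sin p"
    by (rule sincos_total_2pi)
  have s: "sin p = 2 * sin (p / 2) * cos (p / 2)" and c: "cos p = (cos (p / 2))\<^sup>2 - (sin (p / 2))\<^sup>2"
    using sin_double[of "p / 2"] cos_double[of "p / 2"] by simp_all
  have B: "B = R * cos p" and A: "2 * A = R * sin p" using p(3,4) R(1) by (auto simp: field_simps)
  show ?thesis
  proof (rule that[of R "p / 2"])
    show "A = R * (sin (p / 2) * cos (p / 2))" using A unfolding s by simp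
    show "B = R * ((cos (p / 2))\<^sup>2 - (sin (p / 2))\<^sup>2)" unfolding B c ..
  qed (use R p in auto)
qed

text \<open>Hypothesis \<open>dep\<close> is a linear relation between V_11 - V_22 and V_12 on the
  line q_2 = 1. In the rotated frame it states that the mixed second derivative vanishes, so only
  the two pure powers survive.\<close>

lemma separable_if_mixed_dependent:
  fixes a l m :: "nat \<Rightarrow> real"
  assumes fin: "finite I" and v: "\<And>q1 q2. pot (N + 2) v q1 q2 = (\<Sum>i\<in>I. a i * (l i * q1 + m i * q2) ^ (N + 2))"
    and nz: "\<exists>q1 q2. pot (N + 2) v q1 q2 \<noteq> 0"
    and AB: "(A, B) \<noteq> (0, 0)"
    and dep: "\<And>t. (\<Sum>i\<in>I. a i * (A * ((l i)\<^sup>2 - (m i)\<^sup>2) + B * (l i * m i)) * (l i * t + m i) ^ N) = 0"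
  shows "separable (N + 2) v"
proof -
  obtain R \<psi> where R: "R \<noteq> 0" "0 \<le> \<psi>" "\<psi> < 2 * pi" "A = R * (sin \<psi> * cos \<psi>)" "B = R * ((cos \<psi>)\<^sup>2 - (sin \<psi>)\<^sup>2)"
    by (rule half_angle_exists[OF AB])
  define l' where "l' i = l i * cos \<psi> - m i * sin \<psi>" for i
  define m' where "m' i = l i * sin \<psi> + m i * cos \<psi>" for i
  have rot: "l i * (cos \<psi> * x + sin \<psi> * y) + m i * (- sin \<psi> * x + cos \<psi> * y) = l' i * x + m' i * y" for i x y
    by (simp add: l'_def m'_def algebra_simps)
  have AB': "A * ((l i)\<^sup>2 - (m i)\<^sup>2) + B * (l i * m i) = R * (l' i * m' i)" for i
    unfolding R(4,5) l'_def m'_def by (simp add: power2_eq_square algebra_simps)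
  let ?c = "\<lambda>i. a i * (l' i * m' i)"
  \<comment> \<open>A form vanishing on the line q_2 = 1 has zero coefficients, so the relation
    extends to the whole plane and can be evaluated at rotated points.\<close>
  have hom: "(\<Sum>i\<in>I. ?c i * (l i * q1 + m i * q2) ^ N) = 0" for q1 q2
  proof -
    have "pot N (\<lambda>r. \<Sum>i\<in>I. ?c i * l i ^ r * m i ^ (N - r)) t 1 = 0" for t
    proof -
      have "R * (\<Sum>i\<in>I. ?c i * (l i * t + m i * 1) ^ N) = 0"
        using dep[of t] unfolding AB' sum_distrib_left by (simp add: mult_ac)
      then show ?thesis unfolding pot_power_sum[OF fin] using R(1) by simp
    qed
    from pot_eq_0_coeffs[OF this] have "pot N (\<lambda>r. \<Sum>i\<in>I. ?c i * l i ^ r * m i ^ (N - r)) q1 q2 = pot N (\<lambda>_. 0) q1 q2"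
      by (intro pot_cong) auto
    then show ?thesis unfolding pot_power_sum[OF fin] by (simp add: pot_def)
  qed
  have mid: "(\<Sum>i\<in>I. ?c i * l' i ^ r * m' i ^ (N - r)) = 0" if "r \<le> N" for r
  proof (rule pot_eq_0_coeffs[OF _ that])
    fix t show "pot N (\<lambda>r. \<Sum>i\<in>I. ?c i * l' i ^ r * m' i ^ (N - r)) t 1 = 0"
      unfolding pot_power_sum[OF fin] using hom[of "cos \<psi> * t + sin \<psi> * 1" "- sin \<psi> * t + cos \<psi> * 1"]
      unfolding rot .
  qed
  \<comment> \<open>The coefficients of V in the rotated frame. An inner one, at r = s + 1, contains
    the factor l' m' and equals the vanishing sum \<open>mid\<close> at s.\<close>
  define u where "u r = (\<Sum>i\<in>I. a i * l' i ^ r * m' i ^ (N + 2 - r))" for r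
  have u0: "u r = 0" if "0 < r" "r < N + 2" for r
  proof -
    obtain s where s: "r = Suc s" using \<open>0 < r\<close> by (cases r) auto
    then have "s \<le> N" using that by simp
    have "N + 2 - r = Suc (N - s)" using that s by simp
    then have "u r = (\<Sum>i\<in>I. ?c i * l' i ^ s * m' i ^ (N - s))"
      unfolding u_def s by (intro sum.cong refl) (simp add: mult_ac)
    then show ?thesis using mid[OF \<open>s \<le> N\<close>] by simp
  qed
  have V: "pot (N + 2) v (cos \<psi> * x + sin \<psi> * y) (- sin \<psi> * x + cos \<psi> * y) = u 0 * y ^ (N + 2) + u (N + 2) * x ^ (N + 2)" for x y
  proof -
    have "pot (N + 2) v (cos \<psi> * x + sin \<psi> * y) (- sin \<psi> * x + cos \<psi> * y) = pot (N + 2) u x y"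
      unfolding v rot u_def pot_power_sum[OF fin] ..
    also have "\<dots> = (\<Sum>r\<in>{0, N + 2}. u r * real ((N + 2) choose r) * x ^ r * y ^ (N + 2 - r))"
      unfolding pot_def
    proof (rule sum.mono_neutral_right)
      show "\<forall>r\<in>{0..N + 2} - {0, N + 2}. u r * real ((N + 2) choose r) * x ^ r * y ^ (N + 2 - r) = 0"
      proof
        fix r assume "r \<in> {0..N + 2} - {0, N + 2}"
        then have "u r = 0" by (intro u0) auto
        then show "u r * real ((N + 2) choose r) * x ^ r * y ^ (N + 2 - r) = 0" by simp
      qed
    qed auto
    also have "\<dots> = u 0 * y ^ (N + 2) + u (N + 2) * x ^ (N + 2)" by (simp del: power_Suc)
    finally show ?thesis .
  qed
  have "(u 0, u (N + 2)) \<noteq> (0, 0)"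
  proof
    assume z: "(u 0, u (N + 2)) = (0, 0)"
    obtain q1 q2 where q: "pot (N + 2) v q1 q2 \<noteq> 0" using nz by blast
    let ?x = "cos \<psi> * q1 - sin \<psi> * q2" and ?y = "sin \<psi> * q1 + cos \<psi> * q2"
    have "cos \<psi> * ?x + sin \<psi> * ?y = q1" "- sin \<psi> * ?x + cos \<psi> * ?y = q2"
      by (simp_all add: algebra_simps cos_sin_squares_times)
    then show False using V[of ?x ?y] q z by simp
  qed
  then show ?thesis unfolding separable_def separable_within_def using R(2,3) V by blast
qed

section \<open>The two directions of the equivalence\<close>

lemma share_imp_separable:
  assumes h: "h \<ge> 1" and nz: "is_PHO (2 * h + 1) v"
    and share: "share_BGNF (PHO (2 * h + 1) v) (PHO (4 * h) w) (4 * h)"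
  shows "separable (2 * h + 1) v"
proof -
  obtain b where b: "\<And>q1 q2. pot (2 * h + 1) v q1 q2 = (\<Sum>i\<le>2 * h + 1. b i * (real i * q1 + 1 * q2) ^ (2 * h + 1))"
    using pot_as_power_sum[of "2 * h + 1" v] by blast
  obtain \<beta> where \<beta>: "\<And>X Y. oscB h X Y = (\<Sum>j\<le>h. \<beta> j * (X\<^sup>2 + Y\<^sup>2) ^ (h - j) * X ^ (2 * j))"
    using oscB_expand[of h] by blast
  let ?I = "{..2 * h + 1}" and ?l = "\<lambda>i::nat. real i" and ?m = "\<lambda>i::nat. 1::real"
  interpret power_sum h \<beta> ?I b ?l ?m
    by unfold_locales (use \<beta> h in auto)
  define N where "N = 2 * h - 1"
  have N: "2 * h + 1 = N + 2" "2 * h - 2 = N - 1" "N \<ge> 1" using h by (auto simp: N_def)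
  have v: "\<And>q1 q2. pot (2 * h + 1) v q1 q2 = (\<Sum>i\<in>?I. b i * \<xi> i q1 q2 ^ (2 * h + 1))"
    unfolding b \<xi>_def ..
  \<comment> \<open>Up to a common constant factor, \<open>f\<close> and \<open>q\<close> are V_11 -
    V_22 and V_12 restricted to the points (t, 1).\<close>
  define f where "f = (\<Sum>i\<in>?I. smult (b i * ((?l i)\<^sup>2 - (?m i)\<^sup>2)) ([:?m i, ?l i:] ^ N))"
  define q where "q = (\<Sum>i\<in>?I. smult (b i * (?l i * ?m i)) ([:?m i, ?l i:] ^ N))"
  have pd: "pderiv ([:?m i, ?l i:] ^ N) = smult (real N * ?l i) ([:?m i, ?l i:] ^ (N - 1))" for i
    by (simp add: pderiv_power pderiv_pCons)
  have "poly (pderiv f * q) t = poly (f * pderiv q) t" for t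
  proof -
    define X where "X i = ?l i * t + ?m i" for i
    have X: "poly [:?m i, ?l i:] t = X i" for i by (simp add: X_def mult.commute)
    have XN: "X i ^ N = X i * X i ^ (N - 1)" for i using N(3) by (cases N) auto
    have xi: "\<xi> i t 1 = X i" "\<xi> i 1 0 = ?l i" for i by (simp_all add: \<xi>_def X_def)
    \<comment> \<open>Adding t times the first entries to the second ones leaves the determinant
      unchanged.\<close>
    have cross: "?l i * ?m k - ?l k * ?m i = ?l i * X k - ?l k * X i" for i k by (simp add: X_def algebra_simps)
    let ?F = "\<lambda>i k. real N * (b i * b k * (((?l i)\<^sup>2 - (?m i)\<^sup>2) * (?l k * ?m k)) * (X i * X k) ^ (N - 1) * (?l i * ?m k - ?l k * ?m i))"
    have "poly (pderiv f * q) t - poly (f * pderiv q) t = (\<Sum>i\<in>?I. \<Sum>k\<in>?I. ?F i k)"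
      unfolding f_def q_def pderiv_sum pderiv_smult pd poly_mult poly_sum poly_smult poly_power X sum_product sum_subtractf[symmetric]
      unfolding XN cross
      by (intro sum.cong refl) (simp add: power_mult_distrib algebra_simps)
    also have "\<dots> = (\<Sum>i\<in>?I. \<Sum>k\<in>?I. ?F i k + ?F k i) / 2" by (rule double_sum_symmetrize)
    also have "(\<Sum>i\<in>?I. \<Sum>k\<in>?I. ?F i k + ?F k i) = real N * (\<Sum>i\<in>?I. \<Sum>k\<in>?I. g i k * ((X i * X k) ^ (N - 1) * (X i * ?l k - X k * ?l i)\<^sup>2))"
      unfolding sum_distrib_left
    proof (intro sum.cong refl)
      fix i k
      have "X i * ?l k - X k * ?l i = - (?l i * ?m k - ?l k * ?m i)" by (simp add: X_def algebra_simps)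
      then have e: "(X i * ?l k - X k * ?l i)\<^sup>2 = (?l i * ?m k - ?l k * ?m i)\<^sup>2" by (simp only: power2_minus)
      have c: "(X k * X i) ^ (N - 1) = (X i * X k) ^ (N - 1)" by (simp add: mult.commute)
      \<comment> \<open>The determinant is antisymmetric in i and k, so it multiplies (l_i^2 -
        m_i^2) l_k m_k - (l_k^2 - m_k^2) l_i m_i. This difference is the inner product times the
        determinant, which produces the Gram weight and the square.\<close>
      show "?F i k + ?F k i = real N * (g i k * ((X i * X k) ^ (N - 1) * (X i * ?l k - X k * ?l i)\<^sup>2))"
        unfolding e c g_def by (simp add: power2_eq_square algebra_simps)
    qed
    \<comment> \<open>Base point (t, 1) and direction (1, 0), on which the forms take the values X i
      and l i.\<close>
    also have "\<dots> = 0" using shared_second_order[OF v share, of t 1 1 0] unfolding xi N(2) by simp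
    finally show ?thesis by simp
  qed
  then have "pderiv f * q = f * pderiv q" by (simp add: poly_eq_poly_eq_iff[symmetric] fun_eq_iff)
  then obtain A B where AB: "(A, B) \<noteq> (0, 0)" "smult A f + smult B q = 0"
    using wronskian_zero_dependent by blast
  have "(\<Sum>i\<in>?I. b i * (A * ((?l i)\<^sup>2 - (?m i)\<^sup>2) + B * (?l i * ?m i)) * (?l i * t + ?m i) ^ N) = 0" for t
  proof -
    have "poly (smult A f + smult B q) t = 0" unfolding AB(2) by simp
    then show ?thesis
      unfolding f_def q_def poly_add poly_smult poly_sum poly_power sum_distrib_left sum.distrib[symmetric]
      by (simp add: algebra_simps)
  qed
  from separable_if_mixed_dependent[OF finite_atMost _ _ AB(1) this, of v]
  show ?thesis using b nz unfolding is_PHO_def N(1) by blast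
qed

text \<open>A potential separable within a rotation is a sum of powers of two orthonormal linear forms.\<close>

lemma separable_within_imp_share:
  assumes h: "h \<ge> 1" and "separable_within (2 * h + 1) v \<psi>"
  shows "\<exists>w. is_PHO (4 * h) w \<and> share_BGNF (PHO (2 * h + 1) v) (PHO (4 * h) w) (4 * h)"
    and "share_BGNF (PHO (2 * h + 1) v) (PHO (4 * h) w) (4 * h) \<Longrightarrow> separable_within (4 * h) w \<psi>"
proof -
  obtain v0 vd where nz: "(v0, vd) \<noteq> (0, 0)" and
    sep: "\<And>x y. pot (2 * h + 1) v (cos \<psi> * x + sin \<psi> * y) (- sin \<psi> * x + cos \<psi> * y) = v0 * y ^ (2 * h + 1) + vd * x ^ (2 * h + 1)"
    using assms(2) unfolding separable_within_def by blast
  obtain \<beta> where \<beta>: "\<And>X Y. oscB h X Y = (\<Sum>j\<le>h. \<beta> j * (X\<^sup>2 + Y\<^sup>2) ^ (h - j) * X ^ (2 * j))"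
    using oscB_expand[of h] by blast
  let ?I = "{0, 1::nat}"
  \<comment> \<open>Index 0 stands for the second rotated coordinate with weight v0, index 1 for the
    first with weight vd; their coefficient vectors are orthonormal.\<close>
  define a where "a i = (if i = 0 then v0 else vd)" for i :: nat
  define l where "l i = (if i = 0 then sin \<psi> else cos \<psi>)" for i :: nat
  define m where "m i = (if i = 0 then cos \<psi> else - sin \<psi>)" for i :: nat
  interpret power_sum h \<beta> ?I a l m
    by unfold_locales (use \<beta> h in auto)
  have xi: "\<xi> 0 (cos \<psi> * x + sin \<psi> * y) (- sin \<psi> * x + cos \<psi> * y) = y"
    "\<xi> 1 (cos \<psi> * x + sin \<psi> * y) (- sin \<psi> * x + cos \<psi> * y) = x" for x y
    by (simp_all add: \<xi>_def l_def m_def algebra_simps cos_sin_squares_times)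
  have inv: "cos \<psi> * \<xi> 1 q1 q2 + sin \<psi> * \<xi> 0 q1 q2 = q1"
    "- sin \<psi> * \<xi> 1 q1 q2 + cos \<psi> * \<xi> 0 q1 q2 = q2" for q1 q2
    by (simp_all add: \<xi>_def l_def m_def algebra_simps cos_sin_squares_times)
  have v: "pot (2 * h + 1) v q1 q2 = (\<Sum>i\<in>?I. a i * \<xi> i q1 q2 ^ (2 * h + 1))" for q1 q2
    using sep[of "\<xi> 1 q1 q2" "\<xi> 0 q1 q2"] unfolding inv by (simp add: a_def)
  have g: "g 0 0 = v0\<^sup>2" "g 1 1 = vd\<^sup>2" "g 0 1 = 0" "g 1 0 = 0"
    by (simp_all add: g_def a_def l_def m_def power2_eq_square[symmetric] algebra_simps)
  \<comment> \<open>Chosen so that the potential is -\<open>\<Lambda>\<close> (v0^2 y^(4h) + vd^2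
    x^(4h)) in the rotated coordinates.\<close>
  define w0 where "w0 = (\<lambda>r. \<Sum>i\<in>?I. (- \<Lambda> * g i i) * l i ^ r * m i ^ (4 * h - r))"
  have w0: "pot (4 * h) w0 q1 q2 = - \<Lambda> * (\<Sum>i\<in>?I. g i i * \<xi> i q1 q2 ^ (4 * h))" for q1 q2
    unfolding w0_def pot_power_sum[OF fin] \<xi>_def sum_distrib_left by (simp only: mult.assoc)
  have nz': "(- \<Lambda> * v0\<^sup>2, - \<Lambda> * vd\<^sup>2) \<noteq> (0, 0)" using nz \<Lambda>_pos by auto
  have "share_BGNF (PHO (2 * h + 1) v) (PHO (4 * h) w0) (4 * h)"
    by (rule share_BGNF_orthogonal[OF v _ w0]) (use g in auto)
  moreover have "is_PHO (4 * h) w0"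
  proof -
    have e: "pot (4 * h) w0 (cos \<psi> * x + sin \<psi> * y) (- sin \<psi> * x + cos \<psi> * y) = - \<Lambda> * v0\<^sup>2 * y ^ (4 * h) + - \<Lambda> * vd\<^sup>2 * x ^ (4 * h)" for x y
      unfolding w0 using xi[of x y] g by (simp add: algebra_simps)
    have "\<exists>q1 q2. pot (4 * h) w0 q1 q2 \<noteq> 0"
    proof (cases "v0 = 0")
      case True
      then have "pot (4 * h) w0 (cos \<psi> * 1 + sin \<psi> * 0) (- sin \<psi> * 1 + cos \<psi> * 0) \<noteq> 0"
        unfolding e using nz' by simp
      then show ?thesis by blast
    next
      case False
      then have "pot (4 * h) w0 (cos \<psi> * 0 + sin \<psi> * 1) (- sin \<psi> * 0 + cos \<psi> * 1) \<noteq> 0"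
        unfolding e using \<Lambda>_pos h by (simp add: power_0_left)
      then show ?thesis by blast
    qed
    then show ?thesis unfolding is_PHO_def using h by auto
  qed
  ultimately show "\<exists>w. is_PHO (4 * h) w \<and> share_BGNF (PHO (2 * h + 1) v) (PHO (4 * h) w) (4 * h)" by blast
  assume share: "share_BGNF (PHO (2 * h + 1) v) (PHO (4 * h) w) (4 * h)"
  \<comment> \<open>The potential of any sharing w is forced by \<open>shared_potential\<close>, and
    the orthogonal forms leave only the two pure powers.\<close>
  have "pot (4 * h) w (cos \<psi> * x + sin \<psi> * y) (- sin \<psi> * x + cos \<psi> * y) = - \<Lambda> * v0\<^sup>2 * y ^ (4 * h) + - \<Lambda> * vd\<^sup>2 * x ^ (4 * h)" for x y
  proof -
    have p: "z ^ (2 * h) * z ^ (2 * h) = z ^ (4 * h)" for z :: real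
      unfolding power_add[symmetric] by (intro arg_cong[of _ _ "power z"]) simp
    show ?thesis unfolding shared_potential[OF v share] using xi[of x y] g
      by (simp add: power_mult_distrib p distrib_left)
  qed
  then show "separable_within (4 * h) w \<psi>" unfolding separable_within_def using nz' by blast
qed

theorem mainTheorem1:
  fixes \<delta> :: nat and v :: "nat \<Rightarrow> real"
  assumes "odd \<delta>" and "3 \<le> \<delta>" and "is_PHO \<delta> v"
  shows "((\<exists>w. is_PHO (2 * \<delta> - 2) w \<and> share_BGNF (PHO \<delta> v) (PHO (2 * \<delta> - 2) w) (2 * \<delta> - 2))
            \<longleftrightarrow> separable \<delta> v)
       \<and> (\<forall>\<psi> w. 0 \<le> \<psi> \<and> \<psi> < 2 * pi \<and> separable_within \<delta> v \<psi>
              \<and> is_PHO (2 * \<delta> - 2) w \<and> share_BGNF (PHO \<delta> v) (PHO (2 * \<delta> - 2) w) (2 * \<delta> - 2)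
              \<longrightarrow> separable_within (2 * \<delta> - 2) w \<psi>)"
proof -
  obtain h where \<delta>: "\<delta> = 2 * h + 1" using assms(1) by (elim oddE)
  have h: "h \<ge> 1" using assms(2) \<delta> by simp
  have d: "2 * \<delta> - 2 = 4 * h" using \<delta> by simp
  show ?thesis
    unfolding d unfolding \<delta>
    using share_imp_separable[OF h assms(3)[unfolded \<delta>]] separable_within_imp_share[OF h, of v]
    unfolding separable_def by blast
qed

end
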